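(* The conic hull $C_{6,2}\subseteq\mathbb R^{15}$ of $\Phi(\mathcal Z_2^6)$ is a polyhedral cone generated by 10 rays of type $(3,3)$ and 15 rays of type $(2,2,2)$. It has 975 facets, which form 8 orbits under the action of the symmetric group $\mathbf S_6$, and representatives of the 8 orbits are the facets given by the following valid inequalities (with $W_1,\dots,W_{15}$ as in the context): Type 1: $-W_1-W_2-W_6+W_8+W_{10}+W_{13}+W_{14}+W_{15}\ge0$; Type 2: $-3W_1-W_2-W_3+W_4-W_5-W_6-W_7+3W_8-W_9+3W_{10}+W_{11}-W_{12}+3W_{13}+W_{14}+3W_{15}\ge0$; Type 3: $-W_1-W_2-W_3+W_4-W_5-W_6-W_7+3W_8+W_9+W_{10}+W_{11}-W_{12}+W_{13}+W_{14}+W_{15}\ge0$; Type 4: $-W_1-W_2-W_3-W_4+W_5-W_6+W_7+W_8-W_9+W_{10}+W_{11}+W_{12}+W_{13}+W_{14}+W_{15}\ge0$; Type 5: $-W_1-W_5+W_8+W_{10}+W_{13}+W_{15}\ge0$; Type 6: $-W_1+W_{14}+W_{15}\ge0$; Type 7: $-W_1-W_2+W_4-W_6+2W_8+W_{10}-W_{12}+W_{13}+W_{15}\ge0$; Type 8: $-W_1-W_2-W_3+W_4-W_5-W_7+2W_8+2W_{10}-W_{12}+2W_{13}+2W_{15}\ge0$.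
   Context: $\mathcal Z_2$ is the set of zonoids in $\mathbb R^2$ (equivalently, centrally symmetric convex bodies in $\mathbb R^2$), and $\mathrm V(K,L)$ is the mixed area. For $Z=(Z_1,\dots,Z_6)$ write $\mathrm V_{ij}=\mathrm V(Z_i,Z_j)$ and let $\Phi(Z)\in\mathbb R^{15}$ have coordinates $\mathrm V_{I_1}\mathrm V_{I_2}\mathrm V_{I_3}$ indexed by the 15 partitions $I_1|I_2|I_3$ of $[6]$ into pairs. Denote these coordinates by $W_1,\dots,W_{15}$, corresponding respectively to the partitions $12|34|56$, $16|23|45$, $15|23|46$, $14|23|56$, $13|24|56$, $13|25|46$, $14|25|36$, $15|24|36$, $16|24|35$, $16|25|34$, $15|26|34$, $14|26|35$, $13|26|45$, $12|36|45$, $12|35|46$ (so e.g. $W_1=\mathrm V_{12}\mathrm V_{34}\mathrm V_{56}$). $\mathbf S_6$ acts on $\mathbb R^{15}$ by permuting the indices $1,\dots,6$. For a 6-tuple $U=(u_1,\dots,u_6)$ of nonzero vectors in $\mathbb R^2$, $\Phi(U)$ denotes $\Phi([0,u_1],\dots,[0,u_6])$, where $\mathrm V([0,u],[0,v])=\tfrac12|\det(u,v)|$. A ray is of type $(3,3)$ if it is spanned by $\Phi(U)$ where $\{1,\dots,6\}=J_1\sqcup J_2$, $|J_1|=|J_2|=3$, the vectors $u_i$, $i\in J_1$, are pairwise parallel, the $u_i$, $i\in J_2$, are pairwise parallel, and no $u_i$ ($i\in J_1$) is parallel to a $u_j$ ($j\in J_2$). A ray is of type $(2,2,2)$ if it is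 spanned by $\Phi(U)$ where $\{1,\dots,6\}=I_1\sqcup I_2\sqcup I_3$ with $|I_r|=2$, the vectors within each $I_r$ are parallel, and vectors from different $I_r$ are non-parallel. *)

theory Defs
  imports "HOL-Analysis.Analysis" "HOL-Library.Numeral_Type"
begin

text \<open>Zonoids in R^2 = centrally symmetric convex bodies (nonempty compact convex sets,
  possibly degenerate, symmetric about some centre).\<close>
definition zonoid2 :: "(real^2) set \<Rightarrow> bool" where
  "zonoid2 K \<longleftrightarrow> K \<noteq> {} \<and> compact K \<and> convex K \<and> (\<exists>c. \<forall>x\<in>K. 2 *\<^sub>R c - x \<in> K)"

definition minkowski_sum :: "(real^2) set \<Rightarrow> (real^2) set \<Rightarrow> (real^2) set" where
  "minkowski_sum K L = {x + y | x y. x \<in> K \<and> y \<in> L}"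

text \<open>Mixed area: V(K,L) = (vol(K+L) - vol K - vol L)/2, so V(K,K) = vol K.\<close>
definition mixed_area :: "(real^2) set \<Rightarrow> (real^2) set \<Rightarrow> real" where
  "mixed_area K L =
     (measure lebesgue (minkowski_sum K L) - measure lebesgue K - measure lebesgue L) / 2"

definition pair_partitions :: "((nat \<times> nat) \<times> (nat \<times> nat) \<times> (nat \<times> nat)) list" where
  "pair_partitions =
    [((1,2),(3,4),(5,6)), ((1,6),(2,3),(4,5)), ((1,5),(2,3),(4,6)), ((1,4),(2,3),(5,6)),
     ((1,3),(2,4),(5,6)), ((1,3),(2,5),(4,6)), ((1,4),(2,5),(3,6)), ((1,5),(2,4),(3,6)),
     ((1,6),(2,4),(3,5)), ((1,6),(2,5),(3,4)), ((1,5),(2,6),(3,4)), ((1,4),(2,6),(3,5)),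
     ((1,3),(2,6),(4,5)), ((1,2),(3,6),(4,5)), ((1,2),(3,5),(4,6))]"

definition part :: "nat \<Rightarrow> nat set set" where
  "part k = (case pair_partitions ! (k - 1) of ((a,b),(c,d),(e,f)) \<Rightarrow> {{a,b},{c,d},{e,f}})"

text \<open>Coordinate i of R^15 (type index 15, elements 0..14) corresponds to W_(i+1).\<close>
definition idx :: "15 \<Rightarrow> nat" where
  "idx i = nat (Rep_bit1 i) + 1"

definition Phi :: "(nat \<Rightarrow> (real^2) set) \<Rightarrow> real^15" where
  "Phi Z = (\<chi> i. \<Prod>I\<in>part (idx i). mixed_area (Z (Min I)) (Z (Max I)))"

definition PhiU :: "(nat \<Rightarrow> real^2) \<Rightarrow> real^15" where
  "PhiU u = Phi (\<lambda>i. closed_segment 0 (u i))"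

definition C62 :: "(real^15) set" where
  "C62 = convex_cone hull (Phi ` {Z. \<forall>i\<in>{1..6}. zonoid2 (Z i)})"

definition S6_act :: "(nat \<Rightarrow> nat) \<Rightarrow> real^15 \<Rightarrow> real^15" where
  "S6_act \<sigma> x = (\<chi> i. x $ (THE j. part (idx j) = (\<lambda>I. \<sigma> ` I) ` part (idx i)))"

definition facet_orbit :: "(real^15) set \<Rightarrow> (real^15) set set" where
  "facet_orbit F = {S6_act \<sigma> ` F | \<sigma>. \<sigma> permutes {1..6::nat}}"

definition par2 :: "real^2 \<Rightarrow> real^2 \<Rightarrow> bool" where
  "par2 u v \<longleftrightarrow> collinear {0, u, v}"

definition type33 :: "(nat \<Rightarrow> real^2) \<Rightarrow> bool" where
  "type33 u \<longleftrightarrow> (\<forall>i\<in>{1..6}. u i \<noteq> 0) \<and>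
     (\<exists>J1 J2. J1 \<union> J2 = {1..6} \<and> J1 \<inter> J2 = {} \<and> card J1 = 3 \<and> card J2 = 3 \<and>
        (\<forall>i\<in>J1. \<forall>j\<in>J1. par2 (u i) (u j)) \<and> (\<forall>i\<in>J2. \<forall>j\<in>J2. par2 (u i) (u j)) \<and>
        (\<forall>i\<in>J1. \<forall>j\<in>J2. \<not> par2 (u i) (u j)))"

definition type222 :: "(nat \<Rightarrow> real^2) \<Rightarrow> bool" where
  "type222 u \<longleftrightarrow> (\<forall>i\<in>{1..6}. u i \<noteq> 0) \<and>
     (\<exists>I1 I2 I3. I1 \<union> I2 \<union> I3 = {1..6} \<and> I1 \<inter> I2 = {} \<and> I1 \<inter> I3 = {} \<and> I2 \<inter> I3 = {} \<and>
        card I1 = 2 \<and> card I2 = 2 \<and> card I3 = 2 \<and>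
        (\<forall>r\<in>{I1,I2,I3}. \<forall>i\<in>r. \<forall>j\<in>r. par2 (u i) (u j)) \<and>
        (\<forall>r\<in>{I1,I2,I3}. \<forall>s\<in>{I1,I2,I3}. r \<noteq> s \<longrightarrow> (\<forall>i\<in>r. \<forall>j\<in>s. \<not> par2 (u i) (u j))))"

definition ray_of :: "real^15 \<Rightarrow> (real^15) set" where
  "ray_of v = {c *\<^sub>R v | c. c \<ge> 0}"

definition rays33 :: "(real^15) set set" where
  "rays33 = {ray_of (PhiU u) | u. type33 u}"

definition rays222 :: "(real^15) set set" where
  "rays222 = {ray_of (PhiU u) | u. type222 u}"

definition ineq_coeffs :: "nat \<Rightarrow> real list" where
  "ineq_coeffs t = [
     [-1,-1, 0, 0, 0,-1, 0, 1, 0, 1, 0, 0, 1, 1, 1],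
     [-3,-1,-1, 1,-1,-1,-1, 3,-1, 3, 1,-1, 3, 1, 3],
     [-1,-1,-1, 1,-1,-1,-1, 3, 1, 1, 1,-1, 1, 1, 1],
     [-1,-1,-1,-1, 1,-1, 1, 1,-1, 1, 1, 1, 1, 1, 1],
     [-1, 0, 0, 0,-1, 0, 0, 1, 0, 1, 0, 0, 1, 0, 1],
     [-1, 0, 0, 0, 0, 0, 0, 0, 0, 0, 0, 0, 0, 1, 1],
     [-1,-1, 0, 1, 0,-1, 0, 2, 0, 1, 0,-1, 1, 0, 1],
     [-1,-1,-1, 1,-1, 0,-1, 2, 0, 2, 0,-1, 2, 0, 2]] ! (t - 1)"

definition ineq_vec :: "nat \<Rightarrow> real^15" where
  "ineq_vec t = (\<chi> i. ineq_coeffs t ! (idx i - 1))"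

definition facet_rep :: "nat \<Rightarrow> (real^15) set" where
  "facet_rep t = C62 \<inter> {x. ineq_vec t \<bullet> x = 0}"

end

theory Submission
  imports Defs
begin

text \<open>
  In the plane, a centrally symmetric convex body is a limit of zonotopes, and the mixed area is
  additive in each argument. Since every coordinate of \<open>Phi\<close> is linear in each of the six bodies,
  the closed cone \<open>C62\<close> is generated by the images of segments. If one segment is not parallel to
  any other, it splits into two pieces parallel to its neighbours in the cyclic order of lines
  without changing any mixed area; hence configurations of type (3,3) and (2,2,2) suffice.

  The facets are the extreme rays of the dual cone. To see that the 975 normals found in the orbits of
  the eight inequalities generate it, one argues as in the simplex method: a linear functional that
  separates a point of the dual cone from the normals is minimal (relative to the coordinate sum) at
  some normal r, and it suffices that the dual cone lies in the sum of the line through r and the cone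
  of the normals. By symmetry only eight r have to be considered. There the nonnegative solutions
  of few linear equations have to be enumerated, which the double description method does; only
  their supports matter.
\<close>

section \<open>Area of Minkowski sums with a segment\<close>

text \<open>\<open>C62\<close> is a hull without closure, so its closedness cannot be used while
  bodies are approximated. Images of segments are therefore first placed in the hull of the 25 rays.
  That hull is closed because it is finitely generated, and limits of zonotopes are taken in it only
  afterwards.

  The local test at a normal r stands in for an enumeration of 975 extreme rays in dimension 15. An
  element of the dual cone is known modulo r from its values on the generators orthogonal to r.
  These values are nonnegative and satisfy the linear relations among those generators: at most five
  equations, and none for types 2, 5 and 8. Supports suffice because a nonnegative solution whose
  support lies inside that of another can be subtracted from it until one more coordinate vanishes.

  That each normal gives a facet is a separate rank statement: the tight generators span a
  hyperplane, certified by explicit combinations. The same fact makes the normal of a facet unique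
  up to scale, so facets can be counted through orbits and stabilizers of normals.\<close>

definition det2 :: "real^2 \<Rightarrow> real^2 \<Rightarrow> real" where
  "det2 u v = u$1 * v$2 - u$2 * v$1"

text \<open>The coordinates are exchanged because the product measure is integrated with its first
  component outermost; the slices then become horizontal.\<close>

definition swap_pair :: "real^2 \<Rightarrow> real \<times> real" where
  "swap_pair x = (x$2, x$1)"

lemma swap_pair_measurable: "swap_pair \<in> borel_measurable borel"
  unfolding swap_pair_def
  by (intro borel_measurable_continuous_onI continuous_intros)

text \<open>\<open>lborel\<close> is determined by its values on boxes, and the preimage of a box is
  the box with exchanged side lengths.\<close>

lemma distr_swap_pair: "distr lborel borel swap_pair = (lborel :: (real \<times> real) measure)"
proof (rule lborel_eqI[symmetric])
  fix l u :: "real \<times> real"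
  assume le: "\<And>b. b \<in> Basis \<Longrightarrow> l \<bullet> b \<le> u \<bullet> b"
  have l1: "fst l \<le> fst u" "snd l \<le> snd u"
    using le[of "(1,0)"] le[of "(0,1)"] by (auto simp: Basis_prod_def inner_prod_def)
  define l' u' :: "real^2" where "l' = vector [snd l, fst l]" and "u' = vector [snd u, fst u]"
  have eq: "swap_pair -` box l u = box l' u'"
    by (auto simp: swap_pair_def box_def Basis_prod_def Basis_vec_def l'_def u'_def
        inner_axis forall_2 inner_prod_def)
  have le': "l' \<bullet> b \<le> u' \<bullet> b" if b: "b \<in> Basis" for b
  proof -
    obtain i where "b = axis i 1" using b by (auto simp: Basis_vec_def)
    then show ?thesis using l1 exhaust_2[of i] by (auto simp: l'_def u'_def inner_axis)
  qed
  have "emeasure (distr lborel borel swap_pair) (box l u) = emeasure lborel (box l' u')"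
    using swap_pair_measurable eq by (subst emeasure_distr) auto
  also have "\<dots> = (\<Prod>b\<in>Basis. (u' - l') \<bullet> b)"
    using le' by (rule emeasure_lborel_box)
  also have "(\<Prod>b\<in>Basis. (u' - l') \<bullet> b) = (snd u - snd l) * (fst u - fst l)"
  proof -
    have B: "Basis = {axis 1 1, axis 2 (1::real) :: real^2}"
      by (auto simp: Basis_vec_def) (metis exhaust_2)
    have ne: "axis 1 1 \<noteq> (axis 2 1 :: real^2)" by (simp add: axis_eq_axis)
    show ?thesis unfolding B using ne
      by (simp add: inner_axis l'_def u'_def)
  qed
  also have "(snd u - snd l) * (fst u - fst l) = (\<Prod>b\<in>Basis. (u - l) \<bullet> b)"
  proof -
    have B: "Basis = {(1,0), (0,1) :: real \<times> real}" by (auto simp: Basis_prod_def)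
    show ?thesis unfolding B by (simp add: inner_prod_def)
  qed
  finally show "emeasure (distr lborel borel swap_pair) (box l u) = (\<Prod>b\<in>Basis. (u - l) \<bullet> b)" .
qed simp

text \<open>Tonelli's theorem, transported from pairs to \<open>real^2\<close>.\<close>

lemma emeasure_slices:
  assumes "K \<in> sets (borel :: (real^2) measure)"
  shows "emeasure lborel K = (\<integral>\<^sup>+ y. emeasure lborel {x. vector [x, y] \<in> K} \<partial>lborel)"
    and "(\<lambda>y. emeasure lborel {x. vector [x, y] \<in> K}) \<in> borel_measurable lborel"
proof -
  define g :: "real \<times> real \<Rightarrow> real^2" where "g p = vector [snd p, fst p]" for p
  have gm: "g \<in> borel_measurable borel"
  proof (rule borel_measurable_continuous_onI)
    have "g = (\<lambda>p. \<chi> i. if i = 1 then snd p else fst p)"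
      by (auto simp: g_def fun_eq_iff vec_eq_iff forall_2)
    moreover have "continuous_on UNIV (\<lambda>p::real \<times> real. if i = (1::2) then snd p else fst p)" for i
      by (cases "i = 1") (simp_all add: continuous_on_fst continuous_on_snd continuous_on_id)
    ultimately show "continuous_on UNIV g"
      by (simp add: continuous_on_vec_lambda)
  qed
  have T: "swap_pair -` (g -` K) = K"
  proof -
    have "vector [x $ 1, x $ 2] = x" for x :: "real^2" by (simp add: vec_eq_iff forall_2)
    then show ?thesis by (simp add: swap_pair_def g_def vimage_def)
  qed
  have gK: "g -` K \<in> sets borel" using measurable_sets[OF gm assms] by simp
  then have gK2: "g -` K \<in> sets (lborel \<Otimes>\<^sub>M lborel)" unfolding lborel_prod by simp
  have "emeasure lborel (g -` K) = emeasure (distr lborel borel swap_pair) (g -` K)"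
    by (simp add: distr_swap_pair)
  also have "\<dots> = emeasure lborel K"
    using swap_pair_measurable gK T by (subst emeasure_distr) auto
  finally have 1: "emeasure lborel K = emeasure lborel (g -` K)" ..
  have "emeasure (lborel \<Otimes>\<^sub>M lborel) (g -` K) = (\<integral>\<^sup>+ y. emeasure lborel (Pair y -` (g -` K)) \<partial>lborel)"
    using gK2 by (rule lborel.emeasure_pair_measure_alt)
  then show "emeasure lborel K = (\<integral>\<^sup>+ y. emeasure lborel {x. vector [x, y] \<in> K} \<partial>lborel)"
    unfolding 1 lborel_prod by (simp add: g_def vimage_def)
  have "(\<lambda>y. emeasure lborel (Pair y -` (g -` K))) \<in> borel_measurable lborel"
    using gK2 by (rule lborel.measurable_emeasure_Pair)
  then show "(\<lambda>y. emeasure lborel {x. vector [x, y] \<in> K}) \<in> borel_measurable lborel"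
    by (simp add: g_def vimage_def)
qed

lemma minkowski_sum_iff: "z \<in> minkowski_sum K L \<longleftrightarrow> (\<exists>x\<in>K. \<exists>y\<in>L. z = x + y)"
  unfolding minkowski_sum_def by blast

lemma compact_minkowski_sum: "compact K \<Longrightarrow> compact L \<Longrightarrow> compact (minkowski_sum K L)"
  unfolding minkowski_sum_def by (rule compact_sums)

lemma convex_minkowski_sum:
  assumes "convex K" "convex L"
  shows "convex (minkowski_sum K L)"
proof -
  have "minkowski_sum K L = (\<Union>x\<in>K. \<Union>y\<in>L. {x + y})"
    unfolding minkowski_sum_def by blast
  then show ?thesis using convex_sums[OF assms] by simp
qed

lemma minkowski_sum_nonempty: "K \<noteq> {} \<Longrightarrow> L \<noteq> {} \<Longrightarrow> minkowski_sum K L \<noteq> {}"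
  unfolding minkowski_sum_def by blast

lemma minkowski_sum_assoc:
  "minkowski_sum (minkowski_sum A B) C = minkowski_sum A (minkowski_sum B C)"
proof (intro set_eqI iffI)
  fix z assume "z \<in> minkowski_sum (minkowski_sum A B) C"
  then obtain a b c where "a \<in> A" "b \<in> B" "c \<in> C" "z = a + (b + c)"
    by (auto simp: minkowski_sum_iff add.assoc)
  then show "z \<in> minkowski_sum A (minkowski_sum B C)" by (meson minkowski_sum_iff)
next
  fix z assume "z \<in> minkowski_sum A (minkowski_sum B C)"
  then obtain a b c where "a \<in> A" "b \<in> B" "c \<in> C" "z = (a + b) + c"
    by (auto simp: minkowski_sum_iff add.assoc)
  then show "z \<in> minkowski_sum (minkowski_sum A B) C" by (meson minkowski_sum_iff)
qed

lemma minkowski_sum_commute: "minkowski_sum A B = minkowski_sum B A"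
  unfolding minkowski_sum_def using add.commute by blast

lemma minkowski_sum_0: "minkowski_sum A {0} = A"
  by (auto simp: minkowski_sum_def)

lemma measure_lebesgue_compact:
  fixes K :: "(real^2) set"
  assumes "compact K"
  shows "ennreal (measure lebesgue K) = emeasure lborel K"
proof -
  have K: "K \<in> sets lborel" using assms by (simp add: borel_compact)
  have "emeasure lborel K < \<infinity>" using assms compact_imp_bounded emeasure_bounded_finite by blast
  then show ?thesis using K
    by (simp add: emeasure_eq_ennreal_measure measure_completion)
qed

text \<open>Every nonempty horizontal slice of K is a compact interval, and adding the segment
  lengthens it by exactly 1. Integration over the heights adds the length of the vertical projection
  of K.\<close>

lemma area_add_unit_segment:
  fixes K :: "(real^2) set"
  assumes K: "compact K" "convex K" "K \<noteq> {}"
  shows "measure lebesgue (minkowski_sum K (closed_segment 0 (axis 1 1)))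
     = measure lebesgue K + (Sup ((\<lambda>x. x$2) ` K) - Inf ((\<lambda>x. x$2) ` K))"
proof -
  define K' where "K' = minkowski_sum K (closed_segment 0 (axis 1 1))"
  define P where "P = (\<lambda>x. x$2) ` K"
  have cK': "compact K'" unfolding K'_def using K by (intro compact_minkowski_sum) auto
  have lin2: "bounded_linear (\<lambda>x::real^2. x$2)" by (rule bounded_linear_vec_nth)
  have cP: "compact P" "connected P" "P \<noteq> {}"
    unfolding P_def using K linear_continuous_on[OF lin2]
    by (simp_all add: compact_continuous_image connected_continuous_image convex_connected)
  obtain c d where P: "P = {c..d}" using connected_compact_interval_1[of P] cP by auto
  have cd: "c \<le> d" "Sup P = d" "Inf P = c" using cP(3) P by auto
  define S where "S y = {x. vector [x, y] \<in> K}" for y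
  define S' where "S' y = {x. vector [x, y] \<in> K'}" for y
  have slice: "emeasure lborel (S' y) = emeasure lborel (S y) + indicator P y" for y
  proof (cases "y \<in> P")
    case False
    have no: "k$2 \<noteq> y" if "k \<in> K" for k using False that by (auto simp: P_def)
    have "S y = {}" using no by (force simp: S_def)
    moreover have "S' y = {}"
    proof -
      have False if "k \<in> K" "vector [x,y] = k + t *\<^sub>R axis 1 1" for x t k
        using arg_cong[OF that(2), of "\<lambda>v. v$2"] no[OF that(1)] by (simp add: axis_def)
      then show ?thesis by (auto simp: S'_def K'_def minkowski_sum_iff in_segment)
    qed
    ultimately show ?thesis using False by simp
  next
    case True
    define g :: "real \<Rightarrow> real^2" where "g x = vector [x, y]" for x
    have g: "g x = axis 2 y + x *\<^sub>R axis 1 1" for x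
      by (simp add: g_def vec_eq_iff forall_2 axis_def)
    have ne: "S y \<noteq> {}"
    proof -
      obtain x where "x \<in> K" "y = x$2" using True by (auto simp: P_def)
      moreover have "vector [x$1, x$2] = x" by (simp add: vec_eq_iff forall_2)
      ultimately have "x$1 \<in> S y" by (simp add: S_def)
      then show ?thesis by blast
    qed
    have cl: "closed (S y)"
    proof -
      have "continuous_on UNIV g" unfolding g by (intro continuous_intros)
      then have "closed (g -` K)"
        using K(1) by (intro closed_vimage) (auto simp: compact_imp_closed)
      then show ?thesis by (simp add: S_def g_def vimage_def)
    qed
    have bd: "bounded (S y)"
    proof -
      obtain B where "\<And>x. x \<in> K \<Longrightarrow> norm x \<le> B" using K(1) compact_imp_bounded bounded_iff by metis
      then have "norm x \<le> B" if "x \<in> S y" for x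
        using that component_le_norm_cart[of "vector [x,y] :: real^2" 1] by (force simp: S_def)
      then show ?thesis by (auto simp: bounded_iff)
    qed
    have cv: "convex (S y)"
    proof (rule convexI)
      fix a b u v :: real assume *: "a \<in> S y" "b \<in> S y" "0 \<le> u" "0 \<le> v" "u + v = 1"
      have "u *\<^sub>R g a + v *\<^sub>R g b \<in> K" using * K(2) by (auto simp: S_def g_def convex_def)
      moreover have "u *\<^sub>R g a + v *\<^sub>R g b = g (u *\<^sub>R a + v *\<^sub>R b)"
        using *(5) by (auto simp: g_def vec_eq_iff forall_2 simp flip: distrib_right)
      ultimately show "u *\<^sub>R a + v *\<^sub>R b \<in> S y" by (simp add: S_def g_def)
    qed
    obtain a b where ab: "S y = {a..b}"
      using connected_compact_interval_1[of "S y"] cl bd cv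
      by (auto simp: convex_connected compact_eq_bounded_closed)
    then have le: "a \<le> b" using ne by auto
    have "S' y = {a..b+1}"
    proof (intro set_eqI iffI)
      fix x assume "x \<in> S' y"
      then obtain k t where k: "k \<in> K" "0 \<le> t" "t \<le> 1" "vector [x,y] = k + t *\<^sub>R axis 1 1"
        by (auto simp: S'_def K'_def minkowski_sum_iff in_segment)
      have "k = g (x - t)"
        using arg_cong[OF k(4), of "\<lambda>v. v$1"] arg_cong[OF k(4), of "\<lambda>v. v$2"]
        by (auto simp: g_def vec_eq_iff forall_2 axis_def)
      then have "x - t \<in> S y" using k(1) by (simp add: S_def g_def)
      then show "x \<in> {a..b+1}" using ab k(2,3) by auto
    next
      fix x assume x: "x \<in> {a..b+1}"
      \<comment> \<open>This makes \<open>x - t\<close> the minimum of x and b, the point of the old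
        slice nearest to x from the left.\<close>
      define t where "t = (if x \<le> b then 0 else x - b)"
      have t: "0 \<le> t" "t \<le> 1" "x - t \<in> S y" using x le ab by (auto simp: t_def)
      have "vector [x,y] = g (x - t) + t *\<^sub>R axis 1 1"
        by (simp add: g_def vec_eq_iff forall_2 axis_def)
      moreover have "t *\<^sub>R axis 1 1 \<in> closed_segment 0 (axis 1 1 :: real^2)"
        using t unfolding in_segment by auto
      ultimately show "x \<in> S' y" using t(3) unfolding S'_def K'_def minkowski_sum_iff S_def g_def
        by blast
    qed
    then show ?thesis
      using True ab le by (simp add: ennreal_plus[symmetric] del: ennreal_plus flip: ennreal_1)
  qed
  have sK: "K \<in> sets borel" "K' \<in> sets borel" using K cK' by (auto simp: borel_compact)
  have Pm: "P \<in> sets lborel" using cP by (simp add: borel_compact)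
  have "emeasure lborel K' = (\<integral>\<^sup>+ y. emeasure lborel (S' y) \<partial>lborel)"
    using emeasure_slices(1)[OF sK(2)] by (simp add: S'_def)
  also have "\<dots> = (\<integral>\<^sup>+ y. emeasure lborel (S y) \<partial>lborel) + (\<integral>\<^sup>+ y. indicator P y \<partial>lborel)"
    unfolding slice using emeasure_slices(2)[OF sK(1)] Pm
    by (intro nn_integral_add) (auto simp: S_def)
  also have "\<dots> = emeasure lborel K + emeasure lborel P"
    using emeasure_slices(1)[OF sK(1)] Pm by (simp add: S_def)
  also have "emeasure lborel P = ennreal (d - c)" using P cd(1) by simp
  finally have "ennreal (measure lebesgue K') = ennreal (measure lebesgue K + (d - c))"
    using cd(1) by (simp add: measure_lebesgue_compact K cK' ennreal_plus)
  then have "measure lebesgue K' = measure lebesgue K + (d - c)"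
    using cd(1) by (subst (asm) ennreal_inj) auto
  then show ?thesis using cd by (simp add: K'_def P_def)
qed

section \<open>Support functions of compact sets\<close>

definition support_fun :: "(real^2) set \<Rightarrow> real^2 \<Rightarrow> real" where
  "support_fun K a = Sup ((\<lambda>x. a \<bullet> x) ` K)"

lemma support_fun_attained:
  assumes "compact K" "K \<noteq> {}"
  shows "\<exists>x\<in>K. support_fun K a = a \<bullet> x"
proof -
  have "continuous_on K (\<lambda>x. a \<bullet> x)" by (intro continuous_intros)
  then obtain x where x: "x \<in> K" "\<And>y. y \<in> K \<Longrightarrow> a \<bullet> y \<le> a \<bullet> x"
    using continuous_attains_sup[OF assms] by blast
  then have "support_fun K a = a \<bullet> x" unfolding support_fun_def by (intro cSup_eq_maximum) auto
  then show ?thesis using x by blast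
qed

lemma support_fun_upper:
  assumes "compact K" "x \<in> K"
  shows "a \<bullet> x \<le> support_fun K a"
proof -
  have "continuous_on K (\<lambda>x. a \<bullet> x)" by (intro continuous_intros)
  then have "bdd_above ((\<lambda>x. a \<bullet> x) ` K)"
    using assms(1) by (intro bounded_imp_bdd_above compact_imp_bounded compact_continuous_image)
  then show ?thesis unfolding support_fun_def using assms(2) by (intro cSup_upper) auto
qed

lemma support_fun_minkowski_sum:
  assumes K: "compact K" "K \<noteq> {}" and L: "compact L" "L \<noteq> {}"
  shows "support_fun (minkowski_sum K L) a = support_fun K a + support_fun L a"
proof -
  obtain x y where xy: "x \<in> K" "support_fun K a = a \<bullet> x" "y \<in> L" "support_fun L a = a \<bullet> y"
    using support_fun_attained assms by metis
  have KL: "compact (minkowski_sum K L)" "minkowski_sum K L \<noteq> {}"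
    using assms by (auto simp: compact_minkowski_sum minkowski_sum_nonempty)
  obtain x' y' where "x' \<in> K" "y' \<in> L" "support_fun (minkowski_sum K L) a = a \<bullet> (x' + y')"
    using support_fun_attained[OF KL, of a] by (metis minkowski_sum_iff)
  then have "support_fun (minkowski_sum K L) a \<le> support_fun K a + support_fun L a"
    using support_fun_upper[OF K(1), of x' a] support_fun_upper[OF L(1), of y' a]
    by (simp add: inner_add_right)
  moreover have "a \<bullet> (x + y) \<le> support_fun (minkowski_sum K L) a"
    using xy by (intro support_fun_upper[OF KL(1)]) (auto simp: minkowski_sum_iff)
  ultimately show ?thesis using xy by (simp add: inner_add_right)
qed

lemma support_fun_eqI:
  assumes "x \<in> K" "\<And>y. y \<in> K \<Longrightarrow> a \<bullet> y \<le> a \<bullet> x"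
  shows "support_fun K a = a \<bullet> x"
  unfolding support_fun_def using assms by (intro cSup_eq_maximum) auto

lemma support_fun_scaleR:
  assumes "compact K" "K \<noteq> {}" "0 \<le> c"
  shows "support_fun K (c *\<^sub>R a) = c * support_fun K a"
proof -
  obtain x where x: "x \<in> K" "support_fun K a = a \<bullet> x" using support_fun_attained assms by metis
  have "support_fun K (c *\<^sub>R a) = (c *\<^sub>R a) \<bullet> x"
    using x support_fun_upper[OF assms(1), of _ a] assms(3)
    by (intro support_fun_eqI) (auto intro: mult_left_mono)
  then show ?thesis using x by simp
qed

lemma support_fun_add_le:
  assumes "compact K" "K \<noteq> {}"
  shows "support_fun K (a + b) \<le> support_fun K a + support_fun K b"
proof -
  obtain x where x: "x \<in> K" "support_fun K (a + b) = (a + b) \<bullet> x"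
    using support_fun_attained assms by metis
  then show ?thesis
    using support_fun_upper[OF assms(1) x(1), of a] support_fun_upper[OF assms(1) x(1), of b]
    by (simp add: inner_add_left)
qed

lemma support_fun_minus:
  assumes K: "compact K" "K \<noteq> {}" and sym: "\<And>x. x \<in> K \<Longrightarrow> - x \<in> K"
  shows "support_fun K (- a) = support_fun K a"
proof -
  have "support_fun K (- a) \<le> support_fun K a" for a
  proof -
    obtain x where x: "x \<in> K" "support_fun K (- a) = - a \<bullet> x"
      using support_fun_attained[OF K] by metis
    then show ?thesis using support_fun_upper[OF K(1) sym[OF x(1)], of a] by simp
  qed
  from this[of a] this[of "- a"] show ?thesis by simp
qed

lemma support_fun_translation:
  assumes "compact K" "K \<noteq> {}"
  shows "support_fun ((+) c ` K) a = a \<bullet> c + support_fun K a"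
proof -
  obtain x where x: "x \<in> K" "support_fun K a = a \<bullet> x" using support_fun_attained assms by metis
  have "support_fun ((+) c ` K) a = a \<bullet> (c + x)"
    using x support_fun_upper[OF assms(1), of _ a]
    by (intro support_fun_eqI) (auto simp: inner_add_right)
  then show ?thesis using x by (simp add: inner_add_right)
qed

lemma support_fun_diff_le:
  assumes "compact K" "K \<noteq> {}" "\<And>x. x \<in> K \<Longrightarrow> norm x \<le> M"
  shows "\<bar>support_fun K a - support_fun K b\<bar> \<le> M * norm (a - b)"
proof -
  have *: "support_fun K a - support_fun K b \<le> M * norm (a - b)" for a b
  proof -
    obtain x where x: "x \<in> K" "support_fun K a = a \<bullet> x" using support_fun_attained assms by metis
    have "support_fun K a - support_fun K b \<le> (a - b) \<bullet> x"
      using support_fun_upper[OF assms(1) x(1), of b] x by (simp add: inner_diff_left)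
    also have "\<dots> \<le> norm (a - b) * norm x" by (rule norm_cauchy_schwarz)
    also have "\<dots> \<le> norm (a - b) * M" using assms(3)[OF x(1)] by (intro mult_left_mono) auto
    finally show ?thesis by (simp add: mult.commute)
  qed
  show ?thesis using *[of a b] *[of b a] by (simp add: norm_minus_commute)
qed

text \<open>A point of K outside L is separated from L by a line, and the normal direction of that
  line would violate the inequality.\<close>

lemma subset_if_support_fun_le:
  assumes K: "compact K" and L: "compact L" "convex L" "L \<noteq> {}" and le: "\<And>a. support_fun K a \<le> support_fun L a"
  shows "K \<subseteq> L"
proof (rule ccontr)
  assume "\<not> K \<subseteq> L"
  then obtain z where z: "z \<in> K" "z \<notin> L" by auto
  obtain a b where ab: "a \<bullet> z < b" "\<And>x. x \<in> L \<Longrightarrow> b < a \<bullet> x"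
    using separating_hyperplane_closed_point[OF L(2) compact_imp_closed[OF L(1)] z(2)] by blast
  obtain x where x: "x \<in> L" "support_fun L (- a) = - a \<bullet> x" using support_fun_attained L by metis
  have "- a \<bullet> z \<le> support_fun K (- a)" by (rule support_fun_upper[OF K z(1)])
  then show False using le[of "- a"] x ab(1) ab(2)[OF x(1)] by simp
qed

lemma support_fun_segment: "support_fun (closed_segment 0 u) a = max 0 (a \<bullet> u)"
proof (cases "a \<bullet> u \<ge> 0")
  case True
  have "support_fun (closed_segment 0 u) a = a \<bullet> u"
    using True by (intro support_fun_eqI) (auto simp: in_segment mult_left_le_one_le)
  then show ?thesis using True by simp
next
  case False
  have "support_fun (closed_segment 0 u) a = a \<bullet> 0"
    using False by (intro support_fun_eqI) (auto simp: in_segment mult_le_0_iff)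
  then show ?thesis using False by simp
qed

section \<open>Widths, zonotopes and mixed areas\<close>

definition rot90 :: "real^2 \<Rightarrow> real^2" where
  "rot90 u = vector [- u$2, u$1]"

lemma inner_rot90: "rot90 u \<bullet> x = det2 u x"
  by (simp add: rot90_def det2_def inner_vec_def sum_2)

text \<open>This is \<open>norm u\<close> times the extent of K perpendicular to u, that is, the
  area gained when a convex K is swept along u.\<close>

definition width :: "(real^2) set \<Rightarrow> real^2 \<Rightarrow> real" where
  "width K u = support_fun K (rot90 u) + support_fun K (- rot90 u)"

lemma width_minkowski_sum:
  "compact K \<Longrightarrow> K \<noteq> {} \<Longrightarrow> compact L \<Longrightarrow> L \<noteq> {} \<Longrightarrow>
    width (minkowski_sum K L) u = width K u + width L u"
  by (simp add: width_def support_fun_minkowski_sum)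

lemma width_segment: "width (closed_segment 0 v) u = \<bar>det2 u v\<bar>"
  by (simp add: width_def support_fun_segment inner_rot90)

lemma width_singleton_0: "width {0} u = 0"
  by (simp add: width_def support_fun_def)

text \<open>A linear map of determinant 1 carries the unit segment to
  \<open>closed_segment 0 u\<close>, so the horizontal case applies to the preimage of K.\<close>

lemma area_add_segment:
  assumes K: "compact K" "convex K" "K \<noteq> {}"
  shows "measure lebesgue (minkowski_sum K (closed_segment 0 u)) = measure lebesgue K + width K u"
proof (cases "u = 0")
  case True
  have "support_fun K 0 = 0" using support_fun_attained[OF K(1,3), of 0] by auto
  moreover have "rot90 0 = 0" by (simp add: rot90_def vec_eq_iff forall_2)
  ultimately show ?thesis using True by (simp add: minkowski_sum_0 width_def)
next
  case False
  \<comment> \<open>The scaling gives \<open>det2 u v = 1\<close>, so the map f with columns u and v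
    preserves area; g is its inverse by Cramer's rule.\<close>
  define v where "v = (1 / (u \<bullet> u)) *\<^sub>R rot90 u"
  define f :: "real^2 \<Rightarrow> real^2" where "f x = x$1 *\<^sub>R u + x$2 *\<^sub>R v" for x
  define g :: "real^2 \<Rightarrow> real^2" where "g x = vector [det2 x v, det2 u x]" for x
  have uu: "u \<bullet> u = u$1 * u$1 + u$2 * u$2" by (simp add: inner_vec_def sum_2)
  have uu0: "u$1 * u$1 + u$2 * u$2 \<noteq> 0" using False uu inner_eq_zero_iff[of u] by simp
  have d1: "u$1 * v$2 - u$2 * v$1 = 1"
    using uu0 by (simp add: v_def rot90_def uu flip: add_divide_distrib)
  have fg: "f (g x) = x" for x
  proof -
    have "(x$1 * v$2 - x$2 * v$1) * u$1 + (u$1 * x$2 - u$2 * x$1) * v$1 = x$1 * (u$1 * v$2 - u$2 * v$1)"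
      "(x$1 * v$2 - x$2 * v$1) * u$2 + (u$1 * x$2 - u$2 * x$1) * v$2 = x$2 * (u$1 * v$2 - u$2 * v$1)"
      by (simp_all add: algebra_simps)
    then show ?thesis unfolding d1 by (simp add: f_def g_def vec_eq_iff forall_2 det2_def)
  qed
  have linf: "linear f" by (rule linearI) (simp_all add: f_def algebra_simps)
  have ling: "linear g"
    by (rule linearI) (simp_all add: g_def vec_eq_iff forall_2 det2_def algebra_simps)
  have detf: "det (matrix f) = 1"
    using d1 by (simp add: det_2 matrix_def f_def axis_def mult.commute)
  define A where "A = g ` K"
  have A: "compact A" "convex A" "A \<noteq> {}"
    using K ling by (auto simp: A_def convex_linear_image linear_conv_bounded_linear
        intro!: compact_continuous_image linear_continuous_on)
  have KA: "K = f ` A" by (simp add: A_def image_image fg)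
  have fe: "f (axis 1 1) = u" by (simp add: f_def axis_def)
  have "minkowski_sum (f ` A) (f ` S) = f ` minkowski_sum A S" for S
  proof (intro set_eqI iffI)
    fix z assume "z \<in> minkowski_sum (f ` A) (f ` S)"
    then obtain x y where "x \<in> A" "y \<in> S" "z = f (x + y)"
      by (auto simp: minkowski_sum_iff linear_add[OF linf])
    then show "z \<in> f ` minkowski_sum A S" by (metis imageI minkowski_sum_iff)
  next
    fix z assume "z \<in> f ` minkowski_sum A S"
    then obtain x y where "x \<in> A" "y \<in> S" "z = f (x + y)" by (auto simp: minkowski_sum_iff)
    then show "z \<in> minkowski_sum (f ` A) (f ` S)"
      by (auto simp: minkowski_sum_iff linear_add[OF linf])
  qed
  moreover have "closed_segment 0 u = f ` closed_segment 0 (axis 1 1)"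
    using closed_segment_linear_image[OF linf, of 0 "axis 1 1"] fe linear_0[OF linf] by simp
  ultimately have "minkowski_sum K (closed_segment 0 u) = f ` minkowski_sum A (closed_segment 0 (axis 1 1))"
    unfolding KA by metis
  then have "measure lebesgue (minkowski_sum K (closed_segment 0 u))
      = measure lebesgue (minkowski_sum A (closed_segment 0 (axis 1 1)))"
    using detf linf A by (simp add: measure_linear_image lmeasurable_compact compact_minkowski_sum)
  also have "\<dots> = measure lebesgue A + (Sup ((\<lambda>x. x$2) ` A) - Inf ((\<lambda>x. x$2) ` A))"
    by (rule area_add_unit_segment[OF A])
  also have "measure lebesgue A = measure lebesgue K"
    unfolding KA using detf linf A by (simp add: measure_linear_image lmeasurable_compact)
  \<comment> \<open>The second coordinate of \<open>g x\<close> is \<open>det2 u x\<close>, which is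
    the inner product of \<open>rot90 u\<close> with x.\<close>
  also have "Sup ((\<lambda>x. x$2) ` A) - Inf ((\<lambda>x. x$2) ` A) = width K u"
    by (simp add: A_def image_image g_def width_def support_fun_def inner_rot90 Inf_real_def)
  finally show ?thesis .
qed

fun zonotope :: "(real^2) list \<Rightarrow> (real^2) set" where
  "zonotope [] = {0}"
| "zonotope (u # us) = minkowski_sum (closed_segment 0 u) (zonotope us)"

lemma zonotope_body: "compact (zonotope us) \<and> convex (zonotope us) \<and> zonotope us \<noteq> {}"
  by (induction us) (auto simp: compact_minkowski_sum convex_minkowski_sum minkowski_sum_nonempty)

lemma support_fun_zonotope: "support_fun (zonotope us) a = (\<Sum>u\<leftarrow>us. max 0 (a \<bullet> u))"
proof (induction us)
  case Nil
  then show ?case by (simp add: support_fun_def)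
next
  case (Cons u us)
  then show ?case
    using zonotope_body[of us] by (simp add: support_fun_minkowski_sum support_fun_segment)
qed

lemma width_zonotope: "width (zonotope us) u = (\<Sum>v\<leftarrow>us. \<bar>det2 u v\<bar>)"
proof (induction us)
  case Nil
  then show ?case by (simp add: width_singleton_0)
next
  case (Cons v us)
  then show ?case using zonotope_body[of us] by (simp add: width_minkowski_sum width_segment)
qed

text \<open>The segments are added one at a time; since width is additive in the body, the cross
  terms with K separate from those inside the zonotope. This is the linear part of the area
  polynomial, obtained without a general theory of mixed volumes.\<close>

lemma area_add_zonotope:
  assumes "compact K" "convex K" "K \<noteq> {}"
  shows "measure lebesgue (minkowski_sum K (zonotope us))
     = measure lebesgue K + (\<Sum>u\<leftarrow>us. width K u) + measure lebesgue (zonotope us)"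
  using assms
proof (induction us arbitrary: K)
  case Nil
  then show ?case by (simp add: minkowski_sum_0)
next
  case (Cons u us)
  let ?S = "closed_segment 0 u"
  have S: "compact ?S" "convex ?S" "?S \<noteq> {}" by auto
  have KS: "compact (minkowski_sum K ?S)" "convex (minkowski_sum K ?S)" "minkowski_sum K ?S \<noteq> {}"
    using Cons.prems S compact_minkowski_sum convex_minkowski_sum minkowski_sum_nonempty by auto
  have "measure lebesgue (minkowski_sum K (zonotope (u # us)))
    = measure lebesgue (minkowski_sum (minkowski_sum K ?S) (zonotope us))"
    by (simp add: minkowski_sum_assoc)
  also have "\<dots> = measure lebesgue (minkowski_sum K ?S)
      + (\<Sum>v\<leftarrow>us. width (minkowski_sum K ?S) v) + measure lebesgue (zonotope us)"
    by (rule Cons.IH[OF KS])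
  also have "(\<Sum>v\<leftarrow>us. width (minkowski_sum K ?S) v) = (\<Sum>v\<leftarrow>us. width K v) + (\<Sum>v\<leftarrow>us. width ?S v)"
    using Cons.prems S by (simp add: width_minkowski_sum sum_list_addf)
  also have "measure lebesgue (minkowski_sum K ?S) = measure lebesgue K + width K u"
    using Cons.prems by (intro area_add_segment)
  finally have 1: "measure lebesgue (minkowski_sum K (zonotope (u # us))) = measure lebesgue K + width K u
     + ((\<Sum>v\<leftarrow>us. width K v) + (\<Sum>v\<leftarrow>us. width ?S v)) + measure lebesgue (zonotope us)" .
  have 2: "measure lebesgue (zonotope (u # us))
      = (\<Sum>v\<leftarrow>us. width ?S v) + measure lebesgue (zonotope us)"
  proof -
    have "measure lebesgue ?S = 0"
      using area_add_segment[of "{0}" u] minkowski_sum_0[of ?S] minkowski_sum_commute[of ?S "{0}"]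
      by (simp add: width_singleton_0)
    then show ?thesis using Cons.IH[OF S] by simp
  qed
  show ?case unfolding 1 2 by simp
qed

lemma mixed_area_zonotope_right:
  assumes "compact K" "convex K" "K \<noteq> {}"
  shows "mixed_area K (zonotope us) = (\<Sum>u\<leftarrow>us. width K u) / 2"
  by (simp add: mixed_area_def area_add_zonotope[OF assms])

lemma mixed_area_zonotopes:
  "mixed_area (zonotope us) (zonotope vs) = (\<Sum>v\<leftarrow>vs. \<Sum>u\<leftarrow>us. \<bar>det2 v u\<bar>) / 2"
  using zonotope_body[of us] by (simp add: mixed_area_zonotope_right width_zonotope)

lemma mixed_area_segments:
  "mixed_area (closed_segment 0 u) (closed_segment 0 v) = \<bar>det2 u v\<bar> / 2"
  using mixed_area_zonotopes[of "[u]" "[v]"]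
  by (simp add: minkowski_sum_0) (simp add: det2_def abs_minus_commute mult.commute)

lemma mixed_area_commute: "mixed_area K L = mixed_area L K"
  by (simp add: mixed_area_def minkowski_sum_commute[of K])

lemma mixed_area_translation: "mixed_area ((+) c ` K) ((+) d ` L) = mixed_area K L"
proof -
  have "minkowski_sum ((+) c ` K) ((+) d ` L) = (+) (c + d) ` minkowski_sum K L"
    by (fastforce simp: minkowski_sum_iff image_iff algebra_simps)
  then show ?thesis by (simp add: mixed_area_def measure_translation)
qed

text \<open>K lies in L plus the square of side \<open>2 * e\<close> centred at 0, which contains
  the disc of radius e. The square is a translated zonotope. Each of its two sides contributes a
  width of L of at most \<open>4 * e * M\<close>, and the square itself has area
  \<open>4 * e\<^sup>2\<close>.\<close>

lemma area_le_if_support_fun_le: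
  assumes K: "compact K" and L: "compact L" "convex L" "L \<noteq> {}"
    and le: "\<And>a. support_fun K a \<le> support_fun L a + e * norm a" and e: "0 \<le> e"
    and M: "\<And>x. x \<in> L \<Longrightarrow> norm x \<le> M"
  shows "measure lebesgue K \<le> measure lebesgue L + 8 * e * M + 4 * e\<^sup>2"
proof -
  define us :: "(real^2) list" where "us = [axis 1 (2*e), axis 2 (2*e)]"
  define c :: "real^2" where "c = vector [-e, -e]"
  define Q where "Q = (+) c ` minkowski_sum L (zonotope us)"
  have LZ: "compact (minkowski_sum L (zonotope us))" "convex (minkowski_sum L (zonotope us))"
     "minkowski_sum L (zonotope us) \<noteq> {}"
    using L zonotope_body[of us]
    by (auto simp: compact_minkowski_sum convex_minkowski_sum minkowski_sum_nonempty)
  have Q: "compact Q" "convex Q" "Q \<noteq> {}"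
    unfolding Q_def using LZ by (auto intro!: compact_translation convex_translation)
  have "support_fun K a \<le> support_fun Q a" for a
  proof -
    have "support_fun Q a = support_fun L a + (a \<bullet> c + (\<Sum>u\<leftarrow>us. max 0 (a \<bullet> u)))"
      unfolding Q_def using LZ L zonotope_body[of us]
      by (simp add: support_fun_translation support_fun_minkowski_sum support_fun_zonotope)
    also have "a \<bullet> c + (\<Sum>u\<leftarrow>us. max 0 (a \<bullet> u)) = e * (\<bar>a$1\<bar> + \<bar>a$2\<bar>)"
    proof -
      have "max 0 (x * (2*e)) = e * \<bar>x\<bar> + e * x" for x :: real
        using e by (auto simp: max_def abs_if zero_le_mult_iff mult_le_0_iff)
      moreover have "a \<bullet> c = - e * a$1 - e * a$2"
        by (simp add: c_def inner_vec_def sum_2)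
      moreover have "(\<Sum>u\<leftarrow>us. max 0 (a \<bullet> u)) = max 0 (a$1 * (2*e)) + max 0 (a$2 * (2*e))"
        by (simp add: us_def inner_axis)
      ultimately show ?thesis by (simp only:) (simp add: algebra_simps)
    qed
    finally have "support_fun Q a = support_fun L a + e * (\<bar>a$1\<bar> + \<bar>a$2\<bar>)" .
    moreover have "e * norm a \<le> e * (\<bar>a$1\<bar> + \<bar>a$2\<bar>)"
      using e norm_le_l1_cart[of a] by (intro mult_left_mono) (auto simp: sum_2)
    ultimately show ?thesis using le[of a] by simp
  qed
  then have "K \<subseteq> Q" by (rule subset_if_support_fun_le[OF K Q])
  then have "measure lebesgue K \<le> measure lebesgue Q"
    using K Q by (intro measure_mono_fmeasurable) (auto simp: lmeasurable_compact fmeasurableD)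
  also have "measure lebesgue Q = measure lebesgue L + (\<Sum>u\<leftarrow>us. width L u) + measure lebesgue (zonotope us)"
    unfolding Q_def by (simp add: measure_translation area_add_zonotope[OF L])
  also have "measure lebesgue (zonotope us) = 4 * e\<^sup>2"
  proof -
    have "measure lebesgue (closed_segment 0 u) = 0" for u :: "real^2"
      using area_add_segment[of "{0}" u] minkowski_sum_0[of "closed_segment 0 u"]
        minkowski_sum_commute[of "closed_segment 0 u" "{0}"] by (simp add: width_singleton_0)
    then show ?thesis using e
      by (simp add: us_def minkowski_sum_0 area_add_segment width_segment det2_def axis_def power2_eq_square)
  qed
  also have "(\<Sum>u\<leftarrow>us. width L u) \<le> 8 * e * M"
  proof -
    have M0: "0 \<le> M" using L(3) M norm_ge_zero order_trans by blast
    have h: "support_fun L a \<le> M * norm a" for a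
    proof -
      obtain x where x: "x \<in> L" "support_fun L a = a \<bullet> x" using support_fun_attained L by metis
      then have "support_fun L a \<le> norm a * norm x" using norm_cauchy_schwarz by metis
      also have "\<dots> \<le> norm a * M" using M[OF x(1)] by (intro mult_left_mono) auto
      finally show ?thesis by (simp add: mult.commute)
    qed
    have norm_axis_real: "norm (axis i x :: real^2) = \<bar>x\<bar>" for i x
      by (simp add: norm_eq_sqrt_inner inner_axis_axis)
    have r: "norm (rot90 u) = norm u" for u
      by (simp add: rot90_def norm_eq_sqrt_inner inner_vec_def sum_2 add.commute)
    have "width L u \<le> 2 * M * norm u" for u
      using h[of "rot90 u"] h[of "- rot90 u"] by (simp add: width_def r)
    from this[of "axis 1 (2*e)"] this[of "axis 2 (2*e)"] show ?thesis
      using e by (simp add: us_def norm_axis_real mult.commute mult.left_commute)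
  qed
  finally show ?thesis by simp
qed

section \<open>Approximation of planar zonoids by zonotopes\<close>

lemma sum_shift_periodic:
  fixes F :: "real \<Rightarrow> real"
  assumes "F (real n) = F 0"
  shows "(\<Sum>k<n. F (real k + 1)) = (\<Sum>k<n. F (real k))"
proof -
  have "(\<Sum>k<Suc n. F (real k)) = F 0 + (\<Sum>k<n. F (real (Suc k)))"
    by (subst sum.lessThan_Suc_shift) simp
  then show ?thesis using assms by (simp add: add.commute)
qed

text \<open>For \<open>k \<noteq> j\<close> the three arguments lie between two consecutive zeros of
  the sine, so all signs agree and the addition theorem gives zero. At \<open>k = j\<close> the kink
  of the absolute value remains.\<close>

lemma abs_sin_second_difference:
  fixes n :: nat and j k :: nat
  assumes n: "2 \<le> n" and jk: "j < n" "k < n"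
  defines "d \<equiv> pi / real n"
  shows "\<bar>sin ((real k + 1 - real j) * d)\<bar> + \<bar>sin ((real k - 1 - real j) * d)\<bar>
     - 2 * cos d * \<bar>sin ((real k - real j) * d)\<bar> = (if k = j then 2 * sin d else 0)"
proof -
  have d: "0 < d" "real n * d = pi" using n by (auto simp: d_def)
  have d2: "d < pi" using n d_def by (simp add: divide_less_eq)
  have sd: "0 < sin d" using d d2 by (rule_tac sin_gt_zero) auto
  define m where "m = real k - real j"
  have e1: "(real k + 1 - real j) * d = m * d + d" "(real k - 1 - real j) * d = m * d - d"
    "(real k - real j) * d = m * d"
    by (simp_all add: m_def algebra_simps)
  have add: "sin (m * d + d) + sin (m * d - d) = 2 * cos d * sin (m * d)"
    by (simp add: sin_add sin_diff)
  consider "k = j" | "k > j" | "k < j" by linarith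
  then show ?thesis
  proof cases
    case 1
    then show ?thesis using sd by (simp add: e1 m_def)
  next
    case 2
    have m: "1 \<le> m" "m + 1 \<le> real n" using 2 jk by (auto simp: m_def)
    have "(m + 1) * d \<le> real n * d" using m d by (intro mult_right_mono) auto
    then have "m * d + d \<le> pi" using d by (simp add: algebra_simps)
    moreover have "d \<le> m * d" using m d by simp
    ultimately have "0 \<le> sin (m * d + d)" "0 \<le> sin (m * d - d)" "0 \<le> sin (m * d)"
      using d by (auto intro!: sin_ge_zero)
    then show ?thesis using add 2 by (simp add: e1)
  next
    case 3
    have m: "1 \<le> - m" "- m + 1 \<le> real n" using 3 jk by (auto simp: m_def)
    have "(- m + 1) * d \<le> real n * d" using m d by (intro mult_right_mono) auto
    then have "- (m * d) + d \<le> pi" using d by (simp add: algebra_simps)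
    moreover have "d \<le> - (m * d)" using mult_right_mono[OF m(1), of d] d by simp
    ultimately have "0 \<le> - (m * d + d)" "- (m * d + d) \<le> pi" "0 \<le> - (m * d - d)" "- (m * d - d) \<le> pi"
      "0 \<le> - (m * d)" "- (m * d) \<le> pi"
      using d by linarith+
    then have "0 \<le> sin (- (m * d + d))" "0 \<le> sin (- (m * d - d))" "0 \<le> sin (- (m * d))"
      by (blast intro: sin_ge_zero)+
    then have "sin (m * d + d) \<le> 0" "sin (m * d - d) \<le> 0" "sin (m * d) \<le> 0"
      unfolding sin_minus by simp_all
    then show ?thesis using add 3 by (simp add: e1)
  qed
qed

definition circ :: "real \<Rightarrow> real^2" where
  "circ x = vector [cos x, sin x]"

lemma circ_simps: "circ x $ 1 = cos x" "circ x $ 2 = sin x"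
  by (simp_all add: circ_def)

lemma norm_circ: "norm (circ x) = 1"
  by (simp add: norm_eq_sqrt_inner inner_vec_def sum_2 circ_simps flip: power2_eq_square)

lemma circ_plus_pi: "circ (x + pi) = - circ x"
  by (simp add: vec_eq_iff forall_2 circ_simps)

lemma norm_circ_diff: "norm (circ x - circ y) \<le> 2 * \<bar>x - y\<bar>"
proof -
  have s: "\<bar>sin ((x - y) / 2)\<bar> \<le> \<bar>x - y\<bar> / 2" using abs_sin_x_le_abs_x[of "(x-y)/2"] by simp
  have "\<bar>sin x - sin y\<bar> \<le> \<bar>x - y\<bar>"
  proof -
    have "\<bar>sin x - sin y\<bar> = 2 * (\<bar>sin ((x - y) / 2)\<bar> * \<bar>cos ((x + y) / 2)\<bar>)"
      by (simp add: sin_diff_sin abs_mult)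
    also have "\<dots> \<le> 2 * (\<bar>sin ((x - y) / 2)\<bar> * 1)" by (intro mult_left_mono) auto
    finally show ?thesis using s by simp
  qed
  moreover have "\<bar>cos x - cos y\<bar> \<le> \<bar>x - y\<bar>"
  proof -
    have "\<bar>cos x - cos y\<bar> = 2 * (\<bar>sin ((y - x) / 2)\<bar> * \<bar>sin ((x + y) / 2)\<bar>)"
      by (simp add: cos_diff_cos abs_mult)
    also have "\<dots> \<le> 2 * (\<bar>sin ((y - x) / 2)\<bar> * 1)" by (intro mult_left_mono) auto
    also have "\<bar>sin ((y - x) / 2)\<bar> = \<bar>sin ((x - y) / 2)\<bar>"
      by (metis abs_minus_cancel minus_diff_eq minus_divide_left sin_minus)
    finally show ?thesis using s by simp
  qed
  ultimately show ?thesis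
    using norm_le_l1_cart[of "circ x - circ y"] by (simp add: sum_2 circ_simps)
qed

lemma polar_form: "\<exists>t. 0 \<le> t \<and> t < 2 * pi \<and> a = norm a *\<^sub>R circ t"
proof (cases "a = 0")
  case True
  then show ?thesis by (intro exI[of _ 0]) auto
next
  case False
  have n: "norm a \<noteq> 0" "(norm a)\<^sup>2 = (a$1)\<^sup>2 + (a$2)\<^sup>2"
    using False
    by (simp_all add: power2_norm_eq_inner inner_vec_def sum_2) (simp add: power2_eq_square)
  then have "(a$1 / norm a)\<^sup>2 + (a$2 / norm a)\<^sup>2 = 1"
    by (metis add_divide_distrib divide_self_if power_divide power_not_zero)
  then obtain t where t: "0 \<le> t" "t < 2*pi" "a$1 / norm a = cos t" "a$2 / norm a = sin t"
    using sincos_total_2pi by metis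
  have "a$1 = norm a * cos t" "a$2 = norm a * sin t"
    unfolding t(3,4)[symmetric] using n(1) by simp_all
  then have "a = norm a *\<^sub>R circ t" by (simp add: vec_eq_iff forall_2 circ_simps)
  then show ?thesis using t(1,2) by blast
qed

text \<open>Centring replaces each \<open>max 0 x\<close> by \<open>max 0 x - x / 2\<close>, which
  is half the absolute value of x.\<close>

lemma centered_zonotope_support:
  "support_fun ((+) ((- 1/2) *\<^sub>R sum_list us) ` zonotope us) a = (\<Sum>u\<leftarrow>us. \<bar>a \<bullet> u\<bar>) / 2"
proof -
  have "a \<bullet> sum_list us = (\<Sum>u\<leftarrow>us. a \<bullet> u)" by (induction us) (auto simp: inner_add_right)
  then have "support_fun ((+) ((- 1/2) *\<^sub>R sum_list us) ` zonotope us) a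
     = (\<Sum>u\<leftarrow>us. max 0 (a \<bullet> u)) - (\<Sum>u\<leftarrow>us. a \<bullet> u) / 2"
    using zonotope_body[of us] support_fun_translation[of "zonotope us" "(- 1/2) *\<^sub>R sum_list us" a]
    by (simp add: support_fun_zonotope)
  also have "\<dots> = (\<Sum>u\<leftarrow>us. \<bar>a \<bullet> u\<bar>) / 2"
    by (induction us) (auto simp: max_def field_simps)
  finally show ?thesis .
qed

text \<open>The edge lengths are the second differences of the support function along the circle; the
  discrete Green function of that difference operator is the absolute sine, so the zonotope has
  the same support values as the body in all n directions.\<close>

lemma zonotope_interpolation:
  fixes n :: nat
  assumes K: "compact K" "K \<noteq> {}" and sym: "\<And>x. x \<in> K \<Longrightarrow> - x \<in> K" and n: "2 \<le> n"
  shows "\<exists>us. \<forall>j<n. (\<Sum>u\<leftarrow>us. \<bar>circ (real j * (pi / n)) \<bullet> u\<bar>) / 2 = support_fun K (circ (real j * (pi / n)))"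
proof -
  define d where "d = pi / real n"
  have d: "0 < d" "d < pi" "real n * d = pi" "d \<le> pi / 2"
    using n by (auto simp: d_def field_simps)
  have sd: "0 < sin d" using d by (rule_tac sin_gt_zero) auto
  have cd: "0 \<le> cos d" using d by (intro cos_ge_zero) auto
  have even: "support_fun K (- a) = support_fun K a" for a by (rule support_fun_minus[OF K sym])
  define A where "A x = support_fun K (circ (x * d))" for x
  have perA: "A (x + real n) = A x" for x
    using d(3) by (simp add: A_def distrib_right circ_plus_pi even)
  \<comment> \<open>The Green function has second difference \<open>2 * sin d\<close> at its node,
    and a centred zonotope carries a factor 1/2; dividing by \<open>sin d\<close> compensates for
    both.\<close>
  define l where "l k = (A (k - 1) + A (k + 1) - 2 * cos d * A k) / sin d" for k
  have l0: "0 \<le> l k" for k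
  proof -
    \<comment> \<open>The two neighbouring directions add up to \<open>2 * cos d\<close> times the
      middle one. Sublinearity of the support function then makes the second difference nonnegative;
      positive homogeneity needs \<open>0 \<le> cos d\<close>, which is where
      \<open>2 \<le> n\<close> enters.\<close>
    have "circ ((k - 1) * d) + circ ((k + 1) * d) = (2 * cos d) *\<^sub>R circ (k * d)"
      by (simp add: vec_eq_iff forall_2 circ_simps cos_add cos_diff sin_add sin_diff algebra_simps)
    then have "2 * cos d * A k \<le> A (k - 1) + A (k + 1)"
      using support_fun_add_le[OF K, of "circ ((k - 1) * d)" "circ ((k + 1) * d)"]
        support_fun_scaleR[OF K, of "2 * cos d" "circ (k * d)"] cd by (simp add: A_def)
    then show ?thesis using sd by (simp add: l_def)
  qed
  define us where "us = map (\<lambda>k. l (real k) *\<^sub>R rot90 (circ (real k * d))) [0..<n]"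
  have "(\<Sum>u\<leftarrow>us. \<bar>circ (real j * d) \<bullet> u\<bar>) / 2 = A (real j)" if j: "j < n" for j
  proof -
    define S where "S x = \<bar>sin ((x - real j) * d)\<bar>" for x
    have perS: "S (x + real n) = S x" for x
    proof -
      have "(x + real n - real j) * d = (x - real j) * d + pi"
        using d(3) by (simp add: algebra_simps)
      then show ?thesis unfolding S_def by simp
    qed
    have trm: "\<bar>circ (real j * d) \<bullet> (l (real k) *\<^sub>R rot90 (circ (real k * d)))\<bar> = l (real k) * S (real k)" for k
    proof -
      have "circ (real j * d) \<bullet> rot90 (circ (real k * d)) = - sin ((real k - real j) * d)"
        by (simp add: inner_commute[of "circ _"] inner_rot90 det2_def circ_simps left_diff_distrib sin_diff)
      then show ?thesis using l0[of "real k"] by (simp add: S_def abs_mult)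
    qed
    \<comment> \<open>Summation by parts: as A and S have period n, cyclic shifts move the second
      difference from A to S.\<close>
    have sh1: "(\<Sum>k<n. A (real k - 1) * S (real k)) = (\<Sum>k<n. A (real k) * S (real k + 1))"
      using sum_shift_periodic[of "\<lambda>x. A (x - 1) * S x" n] perA[of "-1"] perS[of 0]
      by (simp add: add.commute)
    have sh2: "(\<Sum>k<n. A (real k + 1) * S (real k)) = (\<Sum>k<n. A (real k) * S (real k - 1))"
      using sum_shift_periodic[of "\<lambda>x. A x * S (x - 1)" n] perA[of 0] perS[of "-1"]
      by (simp add: add.commute)
    have "(\<Sum>u\<leftarrow>us. \<bar>circ (real j * d) \<bullet> u\<bar>) = (\<Sum>k<n. l (real k) * S (real k))"
      unfolding us_def map_map comp_def trm
      by (simp add: interv_sum_list_conv_sum_set_nat atLeast0LessThan)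
    also have "\<dots> = ((\<Sum>k<n. A (real k - 1) * S (real k)) + (\<Sum>k<n. A (real k + 1) * S (real k))
         - (\<Sum>k<n. 2 * cos d * A (real k) * S (real k))) / sin d"
      by (simp add: l_def sum_divide_distrib sum.distrib sum_subtractf algebra_simps
          add_divide_distrib diff_divide_distrib)
    also have "\<dots> = (\<Sum>k<n. A (real k) * (S (real k + 1) + S (real k - 1) - 2 * cos d * S (real k))) / sin d"
      unfolding sh1 sh2 by (simp add: sum.distrib sum_subtractf algebra_simps)
    also have "(\<Sum>k<n. A (real k) * (S (real k + 1) + S (real k - 1) - 2 * cos d * S (real k)))
       = (\<Sum>k<n. A (real k) * (if k = j then 2 * sin d else 0))"
      using abs_sin_second_difference[OF n j] by (intro sum.cong) (auto simp: S_def d_def)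
    also have "\<dots> = A (real j) * (2 * sin d)" using j by (simp add: if_distrib cong: if_cong)
    finally show ?thesis using sd by simp
  qed
  then show ?thesis unfolding A_def d_def by blast
qed

text \<open>The interpolating zonotope agrees with K in \<open>2 * n\<close> directions around the
  whole circle; in between, both support functions are Lipschitz, with constants R and
  \<open>2 * R\<close>.\<close>

lemma centered_zonoid_approx:
  assumes K: "compact K" "K \<noteq> {}" and sym: "\<And>x. x \<in> K \<Longrightarrow> - x \<in> K" and e: "0 < e"
  shows "\<exists>c us. \<forall>a. \<bar>support_fun K a - support_fun ((+) c ` zonotope us) a\<bar> \<le> e * norm a"
proof -
  obtain R where R: "0 < R" "\<And>x. x \<in> K \<Longrightarrow> norm x \<le> R"
    using K(1) compact_imp_bounded bounded_pos by metis
  obtain m :: nat where m: "6 * R * pi / e < real m" using reals_Archimedean2 by blast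
  \<comment> \<open>An even n puts the vertical direction among the nodes. Agreement in the two
    coordinate directions then bounds Z by \<open>2 * R\<close>, independently of n.\<close>
  define n where "n = 2 * (m + 1)"
  have n: "2 \<le> n" by (simp add: n_def)
  define d where "d = pi / real n"
  have d: "0 < d" "real n * d = pi" using n by (auto simp: d_def)
  have "6 * R * pi / e < real n" using m by (simp add: n_def)
  \<comment> \<open>The nearest earlier node is at distance at most \<open>2 * d\<close> on the
    circle, so the two Lipschitz errors are \<open>R * (2 * d)\<close> and
    \<open>2 * R * (2 * d)\<close>.\<close>
  then have dR: "6 * R * d \<le> e" using e n by (simp add: d_def field_simps)
  obtain us where us: "\<And>j. j < n \<Longrightarrow> (\<Sum>u\<leftarrow>us. \<bar>circ (real j * d) \<bullet> u\<bar>) / 2 = support_fun K (circ (real j * d))"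
    using zonotope_interpolation[OF K sym n] unfolding d_def by metis
  define c where "c = (- 1/2) *\<^sub>R sum_list us"
  define Z where "Z = (+) c ` zonotope us"
  have hZ: "support_fun Z a = (\<Sum>u\<leftarrow>us. \<bar>a \<bullet> u\<bar>) / 2" for a
    unfolding Z_def c_def by (rule centered_zonotope_support)
  have Z: "compact Z" "Z \<noteq> {}" unfolding Z_def using zonotope_body[of us]
    by (auto intro!: compact_translation)
  have even: "support_fun K (- a) = support_fun K a" for a by (rule support_fun_minus[OF K sym])
  have evenZ: "support_fun Z (- a) = support_fun Z a" for a by (simp add: hZ)
  have agree: "support_fun Z (circ (real j * d)) = support_fun K (circ (real j * d))" if "j < 2 * n" for j
  proof (cases "j < n")
    case True
    then show ?thesis using us by (simp add: hZ)
  next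
    case False
    have "real j * d = real (j - n) * d + pi" using False d by (simp add: of_nat_diff algebra_simps)
    moreover have "j - n < n" using that False by simp
    ultimately show ?thesis
      using us[of "j - n"] by (simp add: circ_plus_pi even evenZ) (simp add: hZ)
  qed
  have hK: "support_fun K a \<le> R" if "norm a = 1" for a
  proof -
    obtain x where x: "x \<in> K" "support_fun K a = a \<bullet> x" using support_fun_attained[OF K] by metis
    then show ?thesis using norm_cauchy_schwarz[of a x] R(2)[OF x(1)] that by simp
  qed
  have bZ: "norm x \<le> 2 * R" if x: "x \<in> Z" for x
  proof -
    have *: "\<bar>circ (real j * d) \<bullet> x\<bar> \<le> R" if "j < n" for j
    proof -
      have "circ (real j * d) \<bullet> x \<le> R" "- circ (real j * d) \<bullet> x \<le> R"
        using support_fun_upper[OF Z(1) x, of "circ (real j * d)"] support_fun_upper[OF Z(1) x, of "- circ (real j * d)"]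
          agree[of j] that hK[of "circ (real j * d)"] by (auto simp: norm_circ evenZ)
      then show ?thesis by simp
    qed
    have q: "real (m + 1) * d = pi / 2" by (simp add: d_def n_def field_simps)
    have "\<bar>circ (pi / 2) \<bullet> x\<bar> \<le> R" using *[of "m + 1"] unfolding q n_def by simp
    then have "\<bar>x$2\<bar> \<le> R"
      by (simp add: inner_vec_def sum_2 circ_simps)
    moreover have "\<bar>x$1\<bar> \<le> R" using *[of 0] n by (simp add: inner_vec_def sum_2 circ_simps)
    ultimately show ?thesis using norm_le_l1_cart[of x] by (simp add: sum_2)
  qed
  have "\<bar>support_fun K a - support_fun Z a\<bar> \<le> e * norm a" for a
  proof -
    obtain t where t: "0 \<le> t" "t < 2 * pi" "a = norm a *\<^sub>R circ t" using polar_form by metis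
    define j where "j = nat \<lfloor>t / d\<rfloor>"
    have td: "0 \<le> t / d" using t d by simp
    have "real j \<le> t / d" "t / d < real j + 1"
      unfolding j_def using td by linarith+
    then have jt: "real j * d \<le> t" "t < real j * d + d" using d by (auto simp: field_simps)
    have "real j * d < 2 * (real n * d)" using jt(1) t(2) unfolding d(2) by linarith
    then have "real j * d < real (2 * n) * d" by (simp add: mult.assoc)
    then have j: "j < 2 * n" using d(1) by (simp only: mult_less_cancel_right_pos of_nat_less_iff)
    have nd: "norm (circ t - circ (real j * d)) \<le> 2 * d"
      using norm_circ_diff[of t "real j * d"] jt by simp
    have "\<bar>support_fun K (circ t) - support_fun K (circ (real j * d))\<bar> \<le> R * (2 * d)"
      using support_fun_diff_le[OF K R(2), of "circ t" "circ (real j * d)"] mult_left_mono[OF nd, of R] R(1)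
      by linarith
    moreover have "\<bar>support_fun Z (circ t) - support_fun Z (circ (real j * d))\<bar> \<le> 2 * R * (2 * d)"
      using support_fun_diff_le[OF Z bZ, of "circ t" "circ (real j * d)"] mult_left_mono[OF nd, of "2 * R"] R(1)
      by linarith
    ultimately have "\<bar>support_fun K (circ t) - support_fun Z (circ t)\<bar> \<le> e"
      using agree[OF j] dR by linarith
    then have "norm a * \<bar>support_fun K (circ t) - support_fun Z (circ t)\<bar> \<le> norm a * e"
      by (intro mult_left_mono) auto
    moreover have "support_fun K a = norm a * support_fun K (circ t)" "support_fun Z a = norm a * support_fun Z (circ t)"
      using support_fun_scaleR[OF K, of "norm a" "circ t"] support_fun_scaleR[OF Z, of "norm a" "circ t"] t(3)
      by auto
    ultimately show ?thesis by (simp add: abs_mult mult.commute flip: right_diff_distrib)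
  qed
  then show ?thesis unfolding Z_def by blast
qed

lemma zonoid_approx:
  assumes "zonoid2 K" and e: "0 < e"
  shows "\<exists>c us. \<forall>a. \<bar>support_fun K a - support_fun ((+) c ` zonotope us) a\<bar> \<le> e * norm a"
proof -
  obtain z where z: "\<And>x. x \<in> K \<Longrightarrow> 2 *\<^sub>R z - x \<in> K" using assms by (auto simp: zonoid2_def)
  have K: "compact K" "K \<noteq> {}" using assms by (auto simp: zonoid2_def)
  define K0 where "K0 = (+) (- z) ` K"
  have K0: "compact K0" "K0 \<noteq> {}" unfolding K0_def using K compact_translation[of K "- z"] by auto
  have sym: "- x \<in> K0" if x: "x \<in> K0" for x
  proof -
    obtain y where "y \<in> K" "x = - z + y" using x by (auto simp: K0_def)
    then show ?thesis unfolding K0_def using z[of y]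
      by (intro image_eqI[of _ _ "2 *\<^sub>R z - y"]) (auto simp: scaleR_2)
  qed
  obtain c us where cu: "\<And>a. \<bar>support_fun K0 a - support_fun ((+) c ` zonotope us) a\<bar> \<le> e * norm a"
    using centered_zonoid_approx[OF K0 sym e] by blast
  have "support_fun K a - support_fun ((+) (z + c) ` zonotope us) a = support_fun K0 a - support_fun ((+) c ` zonotope us) a" for a
    unfolding K0_def support_fun_translation[OF K] using zonotope_body[of us]
    by (simp add: support_fun_translation inner_add_right)
  then show ?thesis using cu by (intro exI[of _ "z + c"] exI[of _ us]) simp
qed

lemma area_diff_le_if_support_fun_diff_le:
  assumes K: "compact K" "convex K" "K \<noteq> {}" and L: "compact L" "convex L" "L \<noteq> {}"
    and le: "\<And>a. \<bar>support_fun K a - support_fun L a\<bar> \<le> e * norm a" and e: "0 \<le> e"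
    and M: "\<And>x. x \<in> K \<Longrightarrow> norm x \<le> M"
  shows "\<bar>measure lebesgue K - measure lebesgue L\<bar> \<le> 8 * e * (M + e) + 4 * e\<^sup>2"
proof -
  \<comment> \<open>The support function of L is tested in the direction x of the point itself:
    \<open>x \<bullet> x\<close> is at most its value there, which is at most
    \<open>(M + e) * norm x\<close>.\<close>
  have M': "norm x \<le> M + e" if x: "x \<in> L" for x
  proof (cases "x = 0")
    case True
    obtain y where "y \<in> K" using K by auto
    then have "0 \<le> M" using M[of y] norm_ge_zero[of y] by linarith
    then show ?thesis using True e by simp
  next
    case False
    obtain y where y: "y \<in> K" "support_fun K x = x \<bullet> y" using support_fun_attained K by metis
    have "x \<bullet> x \<le> support_fun L x" by (rule support_fun_upper[OF L(1) x])
    also have "\<dots> \<le> x \<bullet> y + e * norm x" using le[of x] y by linarith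
    also have "x \<bullet> y \<le> norm x * norm y" by (rule norm_cauchy_schwarz)
    also have "\<dots> \<le> norm x * M" using M[OF y(1)] by (intro mult_left_mono) auto
    finally have "norm x * norm x \<le> norm x * (M + e)"
      by (simp add: algebra_simps power2_norm_eq_inner flip: power2_eq_square)
    then show ?thesis using False by simp
  qed
  have M1: "norm x \<le> M + e" if "x \<in> K" for x using M[OF that] e by simp
  have "support_fun K a \<le> support_fun L a + e * norm a" "support_fun L a \<le> support_fun K a + e * norm a" for a
    using le[of a] by linarith+
  then show ?thesis
    using area_le_if_support_fun_le[OF K(1) L _ e M'] area_le_if_support_fun_le[OF L(1) K _ e M1]
    by (simp add: abs_le_iff)
qed

lemma zonoids_approx:
  assumes zon: "\<And>i. i \<in> I \<Longrightarrow> zonoid2 (Z i)" and I: "finite I" and e: "0 < e"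
  shows "\<exists>us. \<forall>i\<in>I. \<forall>j\<in>I.
    \<bar>mixed_area (Z i) (Z j) - mixed_area (zonotope (us i)) (zonotope (us j))\<bar> < e"
proof -
  have body: "compact (Z i)" "convex (Z i)" "Z i \<noteq> {}" if "i \<in> I" for i
    using zon[OF that] by (auto simp: zonoid2_def)
  have "compact (\<Union>i\<in>I. Z i)" using body I by (intro compact_UN) auto
  then obtain M where M: "0 < M" "\<And>i x. i \<in> I \<Longrightarrow> x \<in> Z i \<Longrightarrow> norm x \<le> M"
    using compact_imp_bounded bounded_pos by (metis UN_I)
  \<comment> \<open>The errors of the three areas combine to at most
    \<open>24 * (r * M) + 36 * r\<^sup>2\<close>. With \<open>r \<le> 1\<close> this is strictly
    below \<open>r * (32 * M + 64)\<close>.\<close>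
  define r where "r = min 1 (e / (32 * M + 64))"
  have r: "0 < r" "r \<le> 1" using e M by (auto simp: r_def)
  have re: "r * (32 * M + 64) \<le> e"
  proof -
    have "r \<le> e / (32 * M + 64)" by (simp add: r_def)
    then show ?thesis using M by (simp add: pos_le_divide_eq)
  qed
  have "\<forall>i\<in>I. \<exists>p. \<forall>a. \<bar>support_fun (Z i) a - support_fun ((+) (fst p) ` zonotope (snd p)) a\<bar> \<le> r * norm a"
    using zonoid_approx[OF zon r(1)] by (metis fst_conv snd_conv)
  then obtain p where p: "\<And>i a. i \<in> I \<Longrightarrow>
      \<bar>support_fun (Z i) a - support_fun ((+) (fst (p i)) ` zonotope (snd (p i))) a\<bar> \<le> r * norm a"
    by metis
  define Y where "Y i = (+) (fst (p i)) ` zonotope (snd (p i))" for i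
  have Y: "compact (Y i)" "convex (Y i)" "Y i \<noteq> {}" for i
    unfolding Y_def using zonotope_body[of "snd (p i)"]
    by (auto intro!: compact_translation convex_translation)
  have r2: "r\<^sup>2 \<le> r" using r by (simp add: power2_eq_square)
  have 1: "\<bar>measure lebesgue (Z i) - measure lebesgue (Y i)\<bar> \<le> 8 * r * (M + r) + 4 * r\<^sup>2" if "i \<in> I" for i
    using that p M(2) r body Y by (intro area_diff_le_if_support_fun_diff_le) (auto simp: Y_def)
  have 2: "\<bar>measure lebesgue (minkowski_sum (Z i) (Z j)) - measure lebesgue (minkowski_sum (Y i) (Y j))\<bar>
     \<le> 8 * (2 * r) * (2 * M + 2 * r) + 4 * (2 * r)\<^sup>2" if ij: "i \<in> I" "j \<in> I" for i j
  proof (rule area_diff_le_if_support_fun_diff_le)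
    show "\<bar>support_fun (minkowski_sum (Z i) (Z j)) a - support_fun (minkowski_sum (Y i) (Y j)) a\<bar> \<le> 2 * r * norm a" for a
      using p[OF ij(1), of a] p[OF ij(2), of a] body ij Y
      by (simp add: support_fun_minkowski_sum Y_def[symmetric])
    show "norm x \<le> 2 * M" if "x \<in> minkowski_sum (Z i) (Z j)" for x
    proof -
      obtain y z where "y \<in> Z i" "z \<in> Z j" "x = y + z" using \<open>x \<in> _\<close> minkowski_sum_iff by metis
      then show ?thesis
        using M(2)[OF ij(1), of y] M(2)[OF ij(2), of z] norm_triangle_ineq[of y z] by simp
    qed
  qed (use r body ij Y in \<open>auto simp: compact_minkowski_sum convex_minkowski_sum minkowski_sum_nonempty\<close>)
  have "\<bar>mixed_area (Z i) (Z j) - mixed_area (zonotope (snd (p i))) (zonotope (snd (p j)))\<bar> < e"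
    if ij: "i \<in> I" "j \<in> I" for i j
  proof -
    have half_diff: "\<bar>x - x'\<bar> \<le> a \<Longrightarrow> \<bar>y - y'\<bar> \<le> b \<Longrightarrow> \<bar>z - z'\<bar> \<le> b
        \<Longrightarrow> \<bar>(x - y - z) / 2 - (x' - y' - z') / 2\<bar> \<le> (a + 2 * b) / 2"
      for a b x y z x' y' z' :: real by (auto simp: abs_le_iff field_simps)
    \<comment> \<open>The approximating zonotopes are translated, but translations do not change
      mixed areas.\<close>
    have eq: "mixed_area (zonotope (snd (p i))) (zonotope (snd (p j))) = mixed_area (Y i) (Y j)"
      by (simp add: Y_def mixed_area_translation)
    have "\<bar>mixed_area (Z i) (Z j) - mixed_area (Y i) (Y j)\<bar>
       \<le> (8 * (2 * r) * (2 * M + 2 * r) + 4 * (2 * r)\<^sup>2 + 2 * (8 * r * (M + r) + 4 * r\<^sup>2)) / 2"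
      unfolding mixed_area_def by (rule half_diff[OF 2[OF ij] 1[OF ij(1)] 1[OF ij(2)]])
    also have "\<dots> = 24 * (r * M) + 36 * r\<^sup>2" by (simp add: algebra_simps power2_eq_square)
    also have "\<dots> \<le> 24 * (r * M) + 36 * r" using r2 by simp
    also have "\<dots> < 32 * (r * M) + 64 * r" using r M mult_pos_pos[OF r(1) M(1)] by linarith
    also have "\<dots> = r * (32 * M + 64)" by (simp add: algebra_simps)
    finally show ?thesis using re eq by linarith
  qed
  then show ?thesis by (intro exI[of _ "\<lambda>i. snd (p i)"]) simp
qed

section \<open>Multilinearity\<close>

text \<open>The type \<open>15\<close> is the binary numeral \<open>bit1\<close> over
  \<open>7\<close>, whence the representing set \<open>{0..<1 + 2 * 7}\<close>.\<close>

lemma idx_bij: "bij_betw idx (UNIV :: 15 set) {1..15}"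
proof -
  interpret td: type_definition "Rep_bit1 :: 15 \<Rightarrow> int" Abs_bit1 "{0..<1 + 2 * int CARD(7)}"
    by (rule type_definition_bit1)
  have r: "bij_betw Rep_bit1 (UNIV :: 15 set) {0..<15}"
    using td.Rep_range by (auto simp: bij_betw_def inj_on_def td.Rep_inject)
  have n: "bij_betw (\<lambda>k. nat k + 1) {0..<15} {1..15::nat}"
    by (rule bij_betwI[where g = "\<lambda>k. int k - 1"]) auto
  show ?thesis using bij_betw_trans[OF r n] by (simp add: comp_def idx_def[abs_def])
qed

lemma idx_range: "idx i \<in> {1..15}"
  using idx_bij by (auto simp: bij_betw_def)

lemma pair_partitions_pairs:
  assumes "((a,b),(c,d),(e,f)) \<in> set pair_partitions"
  shows "a < b" "c < d" "e < f" "distinct [a,b,c,d,e,f]" "{a,b,c,d,e,f} = {1..6}"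
proof -
  have "{1..6::nat} = {1,2,3,4,5,6}" by auto
  then show "a < b" "c < d" "e < f" "distinct [a,b,c,d,e,f]" "{a,b,c,d,e,f} = {1..6}"
    using assms by (auto simp: pair_partitions_def)
qed

lemma part_pairs:
  assumes "k \<in> {1..15}"
  obtains a b c d e f where "part k = {{a,b},{c,d},{e,f}}" "a < b" "c < d" "e < f"
    "distinct [a,b,c,d,e,f]" "{a,b,c,d,e,f} = {1..6}"
proof -
  obtain a b c d e f where p: "pair_partitions ! (k - 1) = ((a,b),(c,d),(e,f))"
    by (metis surj_pair)
  have "length pair_partitions = 15" by (simp add: pair_partitions_def)
  then have "k - 1 < length pair_partitions" using assms by auto
  then have "((a,b),(c,d),(e,f)) \<in> set pair_partitions" using p nth_mem by metis
  from pair_partitions_pairs[OF this] p show ?thesis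
    by (intro that[of a b c d e f]) (auto simp: part_def)
qed

text \<open>The entries form an arbitrary matrix, so that multilinearity and the group action can be
  treated apart from bodies, and the same lemmas serve mixed areas and determinants.\<close>

definition phi_of :: "(nat \<Rightarrow> nat \<Rightarrow> real) \<Rightarrow> real^15" where
  "phi_of M = (\<chi> i. \<Prod>I\<in>part (idx i). M (Min I) (Max I))"

lemma Phi_eq_phi_of: "Phi Z = phi_of (\<lambda>i j. mixed_area (Z i) (Z j))"
  by (simp add: Phi_def phi_of_def)

lemma phi_of_nth:
  obtains a b c d e f where "a < b" "c < d" "e < f" "distinct [a,b,c,d,e,f]"
    "{a,b,c,d,e,f} = {1..6}" "part (idx i) = {{a,b},{c,d},{e,f}}"
    "\<And>M. phi_of M $ i = M a b * M c d * M e f"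
proof -
  obtain a b c d e f where *: "part (idx i) = {{a,b},{c,d},{e,f}}" "a < b" "c < d" "e < f"
    "distinct [a,b,c,d,e,f]" "{a,b,c,d,e,f} = {1..6}"
    using part_pairs[OF idx_range[of i]] by metis
  have "{a,b} \<noteq> {c,d}" "{a,b} \<noteq> {e,f}" "{c,d} \<noteq> {e,f}" using *(5) by (auto simp: doubleton_eq_iff)
  then have "phi_of M $ i = M a b * M c d * M e f" for M
    using *(2,3,4) by (simp add: phi_of_def *(1) min_def max_def)
  then show ?thesis using that * by blast
qed

text \<open>A pair partition contains k in exactly one pair, so each coordinate has exactly one
  factor involving k and is linear in row and column k. The diagonal entry never occurs.\<close>

lemma phi_of_multilinear:
  assumes k: "k \<in> {1..6}"
    and sm: "\<And>i. i \<noteq> k \<Longrightarrow> M i k = (\<Sum>x\<leftarrow>xs. N x i k)" "\<And>j. j \<noteq> k \<Longrightarrow> M k j = (\<Sum>x\<leftarrow>xs. N x k j)"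
    and eq: "\<And>x i j. i \<noteq> k \<Longrightarrow> j \<noteq> k \<Longrightarrow> x \<in> set xs \<Longrightarrow> N x i j = M i j"
  shows "phi_of M = (\<Sum>x\<leftarrow>xs. phi_of (N x))"
proof (subst vec_eq_iff, intro allI)
  fix i :: 15
  obtain a b c d e f where o: "a < b" "c < d" "e < f" "distinct [a,b,c,d,e,f]"
    "{a,b,c,d,e,f} = {1..6}" "\<And>M. phi_of M $ i = M a b * M c d * M e f"
    using phi_of_nth[of i] by metis
  have nth: "(\<Sum>x\<leftarrow>xs. phi_of (N x)) $ i = (\<Sum>x\<leftarrow>xs. phi_of (N x) $ i)"
    by (induction xs) auto
  have c1: "(\<Sum>x\<leftarrow>xs. N x a' b' * N x c' d' * N x e' f') = (\<Sum>x\<leftarrow>xs. N x a' b' * (M c' d' * M e' f'))"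
    if "c' \<noteq> k" "d' \<noteq> k" "e' \<noteq> k" "f' \<noteq> k" for a' b' c' d' e' f'
    using eq that by (intro arg_cong[where f = sum_list] map_cong) auto
  have key: "M a' b' * M c' d' * M e' f' = (\<Sum>x\<leftarrow>xs. N x a' b' * N x c' d' * N x e' f')"
    if "c' \<noteq> k" "d' \<noteq> k" "e' \<noteq> k" "f' \<noteq> k" "(a' = k \<and> b' \<noteq> k) \<or> (b' = k \<and> a' \<noteq> k)" for a' b' c' d' e' f'
    unfolding c1[OF that(1-4)] using sm that(5) by (auto simp: sum_list_mult_const mult.assoc)
  have "k \<in> {a,b,c,d,e,f}" using k o(5) by simp
  then consider "k = a \<or> k = b" | "k = c \<or> k = d" | "k = e \<or> k = f" by auto
  then show "phi_of M $ i = (\<Sum>x\<leftarrow>xs. phi_of (N x)) $ i"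
  proof cases
    case 1
    then show ?thesis unfolding nth o(6) using o(4) by (intro key) auto
  next
    case 2
    have "M c d * M a b * M e f = (\<Sum>x\<leftarrow>xs. N x c d * N x a b * N x e f)"
      using 2 o(4) by (intro key) auto
    then show ?thesis unfolding nth o(6) by (simp add: mult.commute)
  next
    case 3
    have "M e f * M a b * M c d = (\<Sum>x\<leftarrow>xs. N x e f * N x a b * N x c d)"
      using 3 o(4) by (intro key) auto
    then show ?thesis unfolding nth o(6) by (simp add: mult_ac)
  qed
qed

lemma zonotope_singleton: "zonotope [u] = closed_segment 0 u"
  by (simp add: minkowski_sum_0)

lemma mixed_area_zonotope_sum:
  "mixed_area K (zonotope us) = (\<Sum>u\<leftarrow>us. mixed_area K (zonotope [u]))"
  if "compact K" "convex K" "K \<noteq> {}"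
proof -
  have "mixed_area K (zonotope [u]) = width K u / 2" for u
    using mixed_area_zonotope_right[OF that, of "[u]"] by simp
  then show ?thesis by (simp only: mixed_area_zonotope_right[OF that])
    (induction us; simp add: add_divide_distrib)
qed

lemma sum_list_in_convex_cone:
  "convex_cone K \<Longrightarrow> (\<And>x. x \<in> set xs \<Longrightarrow> f x \<in> K) \<Longrightarrow> (\<Sum>x\<leftarrow>xs. f x) \<in> K"
  by (induction xs) (auto simp: convex_cone_contains_0 convex_cone_add)

text \<open>Induction on the set S of positions that may still hold an arbitrary zonotope:
  multilinearity expands one position at a time into segments.\<close>

lemma Phi_zonotopes_in_cone:
  assumes K: "convex_cone K" and seg: "\<And>u. PhiU u \<in> K"
  shows "Phi (\<lambda>i. zonotope (X i)) \<in> K"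
proof -
  have "\<forall>X. (\<forall>i\<in>{1..6} - S. length (X i) = 1) \<longrightarrow> Phi (\<lambda>i. zonotope (X i)) \<in> K"
    if "finite S" "S \<subseteq> {1..6}" for S
    using that
  proof (induction S)
    case empty
    show ?case
    proof (intro allI impI)
      fix X :: "nat \<Rightarrow> (real^2) list" assume X: "\<forall>i\<in>{1..6} - {}. length (X i) = 1"
      have s: "zonotope (X i) = closed_segment 0 (hd (X i))" if "i \<in> {1..6}" for i
      proof -
        have "length (X i) = 1" using X that by blast
        then have "X i = [hd (X i)]" by (cases "X i") auto
        then show ?thesis using zonotope_singleton by metis
      qed
      have "Phi (\<lambda>i. zonotope (X i)) = PhiU (\<lambda>i. hd (X i))"
        unfolding PhiU_def
      proof (subst vec_eq_iff, intro allI)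
        fix i :: 15
        obtain a b c d e f where o: "{a,b,c,d,e,f} = {1..6}" "\<And>M. phi_of M $ i = M a b * M c d * M e f"
          using phi_of_nth[of i] by metis
        have "a \<in> {1..6}" "b \<in> {1..6}" "c \<in> {1..6}" "d \<in> {1..6}" "e \<in> {1..6}" "f \<in> {1..6}"
          using o(1) by auto
        then show "Phi (\<lambda>i. zonotope (X i)) $ i = Phi (\<lambda>i. closed_segment 0 (hd (X i))) $ i"
          unfolding Phi_eq_phi_of o(2) by (simp only: s)
      qed
      then show "Phi (\<lambda>i. zonotope (X i)) \<in> K" using seg by simp
    qed
  next
    case (insert k S)
    show ?case
    proof (intro allI impI)
      fix X :: "nat \<Rightarrow> (real^2) list" assume X: "\<forall>i\<in>{1..6} - insert k S. length (X i) = 1"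
      have "Phi (\<lambda>i. zonotope (X i)) = (\<Sum>u\<leftarrow>X k. Phi (\<lambda>i. zonotope ((X(k := [u])) i)))"
        unfolding Phi_eq_phi_of
      proof (rule phi_of_multilinear)
        show "k \<in> {1..6}" using insert.prems by simp
        show "mixed_area (zonotope (X i)) (zonotope (X k))
          = (\<Sum>u\<leftarrow>X k. mixed_area (zonotope ((X(k := [u])) i)) (zonotope ((X(k := [u])) k)))" if "i \<noteq> k" for i
          using that mixed_area_zonotope_sum[of "zonotope (X i)" "X k"] zonotope_body[of "X i"]
          by simp
        then show "mixed_area (zonotope (X k)) (zonotope (X j))
          = (\<Sum>u\<leftarrow>X k. mixed_area (zonotope ((X(k := [u])) k)) (zonotope ((X(k := [u])) j)))" if "j \<noteq> k" for j
          using that by (subst (1 2) mixed_area_commute) blast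
      qed auto
      also have "\<dots> \<in> K"
      proof (rule sum_list_in_convex_cone[OF K])
        fix u assume "u \<in> set (X k)"
        have "\<forall>i\<in>{1..6} - S. length ((X(k := [u])) i) = 1" using X by auto
        then show "Phi (\<lambda>i. zonotope ((X(k := [u])) i)) \<in> K" using insert.IH insert.prems by blast
      qed
      finally show "Phi (\<lambda>i. zonotope (X i)) \<in> K" .
    qed
  qed
  from this[of "{1..6}"] show ?thesis by simp
qed

text \<open>The coordinates are polynomials in the mixed areas, so approximation of the mixed areas
  gives convergence. The closed cone K will be the hull of the 25 rays.\<close>

lemma Phi_zonoids_in_closed_cone:
  assumes K: "convex_cone K" "closed K" and seg: "\<And>u. PhiU u \<in> K"
    and Z: "\<And>i. i \<in> {1..6} \<Longrightarrow> zonoid2 (Z i)"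
  shows "Phi Z \<in> K"
proof -
  have "\<exists>us. \<forall>i\<in>{1..6}. \<forall>j\<in>{1..6}.
    \<bar>mixed_area (Z i) (Z j) - mixed_area (zonotope (us i)) (zonotope (us j))\<bar> < inverse (real (Suc n))" for n
    using Z by (intro zonoids_approx) auto
  then obtain X where X: "\<And>n i j. i \<in> {1..6} \<Longrightarrow> j \<in> {1..6} \<Longrightarrow>
    \<bar>mixed_area (Z i) (Z j) - mixed_area (zonotope (X n i)) (zonotope (X n j))\<bar> < inverse (real (Suc n))"
    by metis
  have lim: "(\<lambda>n. mixed_area (zonotope (X n i)) (zonotope (X n j))) \<longlonglongrightarrow> mixed_area (Z i) (Z j)"
    if "i \<in> {1..6}" "j \<in> {1..6}" for i j
  proof (rule LIMSEQ_I)
    fix r :: real assume "0 < r"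
    then obtain m where m: "inverse (real (Suc m)) < r" using reals_Archimedean by blast
    show "\<exists>no. \<forall>n\<ge>no. norm (mixed_area (zonotope (X n i)) (zonotope (X n j)) - mixed_area (Z i) (Z j)) < r"
    proof (intro exI allI impI)
      fix n assume "m \<le> n"
      then have "inverse (real (Suc n)) \<le> inverse (real (Suc m))" by (intro le_imp_inverse_le) auto
      then show "norm (mixed_area (zonotope (X n i)) (zonotope (X n j)) - mixed_area (Z i) (Z j)) < r"
        using X[OF that, of n] m
        unfolding real_norm_def abs_minus_commute[of "mixed_area (zonotope _) _"]
        by linarith
    qed
  qed
  have lim2: "(\<lambda>n. Phi (\<lambda>i. zonotope (X n i))) \<longlonglongrightarrow> Phi Z"
  proof (rule vec_tendstoI)
    fix i :: 15
    obtain a b c d e f where o: "{a,b,c,d,e,f} = {1..6}" "\<And>M. phi_of M $ i = M a b * M c d * M e f"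
      using phi_of_nth[of i] by metis
    have "a \<in> {1..6}" "b \<in> {1..6}" "c \<in> {1..6}" "d \<in> {1..6}" "e \<in> {1..6}" "f \<in> {1..6}"
      using o(1) by auto
    then show "(\<lambda>n. Phi (\<lambda>i. zonotope (X n i)) $ i) \<longlonglongrightarrow> Phi Z $ i"
      unfolding Phi_eq_phi_of o(2) by (intro tendsto_mult lim)
  qed
  show ?thesis
    by (rule closed_sequentially[OF K(2) _ lim2]) (rule Phi_zonotopes_in_cone[OF K(1) seg])
qed

section \<open>Reduction to few directions of segments\<close>

lemma PhiU_eq_phi_of: "PhiU u = phi_of (\<lambda>i j. \<bar>det2 (u i) (u j)\<bar> / 2)"
  by (simp add: PhiU_def Phi_eq_phi_of mixed_area_segments)

lemma det2_swap: "det2 u v = - det2 v u"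
  by (simp add: det2_def)

lemma abs_det2_commute: "\<bar>det2 u v\<bar> = \<bar>det2 v u\<bar>"
  by (subst det2_swap) simp

lemma det2_self: "det2 u u = 0"
  by (simp add: det2_def)

lemma det2_scaleR: "det2 (c *\<^sub>R u) v = c * det2 u v" "det2 u (c *\<^sub>R v) = c * det2 u v"
  by (simp_all add: det2_def algebra_simps)

lemma det2_eq_0_multiple:
  assumes "det2 u v = 0" "u \<noteq> 0"
  obtains c where "v = c *\<^sub>R u"
proof -
  have e: "u$1 * v$2 = u$2 * v$1" using assms(1) by (simp add: det2_def)
  have nz: "u$1 \<noteq> 0 \<or> u$2 \<noteq> 0" using assms(2) by (auto simp: vec_eq_iff forall_2)
  show ?thesis
  proof (cases "u$1 = 0")
    case False
    then have "v = (v$1 / u$1) *\<^sub>R u" using e by (simp add: vec_eq_iff forall_2 field_simps)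
    then show ?thesis by (rule that)
  next
    case True
    then have "v = (v$2 / u$2) *\<^sub>R u" using e nz by (simp add: vec_eq_iff forall_2 field_simps)
    then show ?thesis by (rule that)
  qed
qed

lemma par2_iff_det2: "par2 u v \<longleftrightarrow> det2 u v = 0"
proof
  assume "par2 u v"
  then consider "u = 0" | "v = 0" | c where "v = c *\<^sub>R u"
    unfolding par2_def collinear_lemma by blast
  then show "det2 u v = 0" by cases (auto simp: det2_def)
next
  assume d: "det2 u v = 0"
  show "par2 u v"
  proof (cases "u = 0")
    case False
    then show ?thesis using det2_eq_0_multiple[OF d] unfolding par2_def collinear_lemma by metis
  qed (simp add: par2_def collinear_lemma)
qed

lemma det2_eq_0_trans:
  assumes "det2 u v = 0" "det2 v w = 0" "v \<noteq> 0"
  shows "det2 u w = 0"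
proof -
  have "det2 v u = 0" using assms(1) det2_swap[of v u] by simp
  then obtain c where "u = c *\<^sub>R v" using assms(3) det2_eq_0_multiple by metis
  then show ?thesis using assms(2) by (simp add: det2_scaleR)
qed

text \<open>At most two indices lie outside S, so one of the three pairs of any partition lies
  inside S and its factor vanishes.\<close>

lemma PhiU_eq_0:
  assumes "S \<subseteq> {1..6}" "4 \<le> card S" "\<And>i j. i \<in> S \<Longrightarrow> j \<in> S \<Longrightarrow> det2 (u i) (u j) = 0"
  shows "PhiU u = 0"
proof (subst vec_eq_iff, intro allI)
  fix i :: 15
  obtain a b c d e f where o: "distinct [a,b,c,d,e,f]" "{a,b,c,d,e,f} = {1..6}"
    "\<And>M. phi_of M $ i = M a b * M c d * M e f"
    using phi_of_nth[of i] by metis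
  have "{a,b} \<subseteq> S \<or> {c,d} \<subseteq> S \<or> {e,f} \<subseteq> S"
  proof (rule ccontr)
    assume "\<not> ?thesis"
    then obtain x y z where xyz: "x \<in> {a,b} - S" "y \<in> {c,d} - S" "z \<in> {e,f} - S" by blast
    then have "S \<subseteq> {1..6} - {x,y,z}" using assms(1) by auto
    then have "card S \<le> card ({1..6} - {x,y,z})" by (intro card_mono) auto
    also have "\<dots> = card {1..6::nat} - card {x,y,z}"
      using xyz o(2) by (intro card_Diff_subset) auto
    also have "card {x,y,z} = 3" using xyz o(1) by auto
    finally show False using assms(2) by simp
  qed
  then show "PhiU u $ i = 0 $ i" unfolding PhiU_eq_phi_of o(3) using assms(3) by auto
qed

lemma PhiU_eq_0_if_zero:
  assumes "i \<in> {1..6}" "u i = 0"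
  shows "PhiU u = 0"
proof (subst vec_eq_iff, intro allI)
  fix k :: 15
  obtain a b c d e f where o: "{a,b,c,d,e,f} = {1..6}" "\<And>M. phi_of M $ k = M a b * M c d * M e f"
    using phi_of_nth[of k] by metis
  have "i \<in> {a,b,c,d,e,f}" using assms o by simp
  then show "PhiU u $ k = 0 $ k"
    unfolding PhiU_eq_phi_of o(2) using assms(2) by (auto simp: det2_def)
qed

text \<open>For nonzero u this is \<open>det2 a b\<close> computed from the coordinates of a and b
  in the orthogonal basis \<open>u\<close>, \<open>rot90 u\<close>.\<close>

lemma inner_det2_identity: "(u \<bullet> u) * det2 a b = (u \<bullet> a) * det2 u b - (u \<bullet> b) * det2 u a"
  by (simp add: inner_vec_def sum_2 det2_def algebra_simps)

text \<open>Here \<open>l\<close> and \<open>m\<close> are the two neighbours of \<open>u\<close> in the cyclic order of the lines spanned by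
  the vectors: \<open>u = p + q\<close> is a sum of multiples of them, and no line of the family separates \<open>p\<close> from \<open>q\<close>.\<close>

lemma split_between_neighbours:
  fixes v :: "nat \<Rightarrow> real^2"
  assumes S: "finite S" and j: "j1 \<in> S" "j2 \<in> S" "det2 (v j1) (v j2) \<noteq> 0"
    and ui: "\<And>j. j \<in> S \<Longrightarrow> det2 u (v j) \<noteq> 0"
  obtains p q l m where "l \<in> S" "m \<in> S" "det2 p (v l) = 0" "det2 q (v m) = 0"
    "\<And>j. j \<in> S \<Longrightarrow> \<bar>det2 u (v j)\<bar> = \<bar>det2 p (v j)\<bar> + \<bar>det2 q (v j)\<bar>"
proof -
  \<comment> \<open>This is the cotangent of the angle from u to \<open>v j\<close>. It does not
    change when \<open>v j\<close> is rescaled, so it orders lines; by \<open>tt\<close> below,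
    determinants are governed by differences of cotangents.\<close>
  define t where "t j = (u \<bullet> v j) / det2 u (v j)" for j
  define s where "s = u \<bullet> u"
  have s: "0 < s" using ui[OF j(1)] by (auto simp: s_def det2_def)
  have tt: "det2 (v a) (v b) = det2 u (v a) * det2 u (v b) * (t a - t b) / s" if "a \<in> S" "b \<in> S" for a b
  proof -
    have "u \<bullet> v a = t a * det2 u (v a)" "u \<bullet> v b = t b * det2 u (v b)"
      using ui[OF that(1)] ui[OF that(2)] by (simp_all add: t_def)
    then have "s * det2 (v a) (v b) = det2 u (v a) * det2 u (v b) * (t a - t b)"
      using inner_det2_identity[of u "v a" "v b"] by (simp add: s_def algebra_simps)
    then show ?thesis using s by (simp add: field_simps)
  qed
  have ne: "S \<noteq> {}" using j by auto
  obtain l where l: "l \<in> S" "\<And>j. j \<in> S \<Longrightarrow> t j \<le> t l"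
  proof -
    have "Max (t ` S) \<in> t ` S" using S ne by simp
    then obtain l where "l \<in> S" "t l = Max (t ` S)" by auto
    then show ?thesis using that S by (metis Max_ge finite_imageI imageI)
  qed
  obtain m where m: "m \<in> S" "\<And>j. j \<in> S \<Longrightarrow> t m \<le> t j"
  proof -
    have "Min (t ` S) \<in> t ` S" using S ne by simp
    then obtain m where "m \<in> S" "t m = Min (t ` S)" by auto
    then show ?thesis using that S by (metis Min_le finite_imageI imageI)
  qed
  have "t j1 \<noteq> t j2" using tt[OF j(1,2)] j(3) by auto
  then have lm: "t m < t l"
    using l(2)[OF j(1)] l(2)[OF j(2)] m(2)[OF j(1)] m(2)[OF j(2)] by linarith
  \<comment> \<open>With this scale, \<open>det2 p (v j)\<close> and \<open>det2 q (v j)\<close> are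
    nonnegative multiples of \<open>det2 u (v j)\<close> whose factors add up to 1.\<close>
  define g where "g = s / (t l - t m)"
  have g: "0 < g" "g * (t l - t m) = s" using s lm by (auto simp: g_def)
  define p where "p = (g / det2 u (v l)) *\<^sub>R v l"
  define q where "q = (- g / det2 u (v m)) *\<^sub>R v m"
  have "\<bar>det2 u (v j)\<bar> = \<bar>det2 p (v j)\<bar> + \<bar>det2 q (v j)\<bar>" if jS: "j \<in> S" for j
  proof -
    have "det2 p (v j) = det2 u (v j) * (g * (t l - t j) / s)"
      using ui[OF l(1)] s by (simp add: p_def det2_scaleR tt[OF l(1) jS])
    moreover have "det2 q (v j) = det2 u (v j) * (g * (t j - t m) / s)"
      unfolding q_def det2_scaleR tt[OF m(1) jS] using ui[OF m(1)] s by (simp add: field_simps)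
    moreover have "0 \<le> g * (t l - t j) / s" "0 \<le> g * (t j - t m) / s"
      using g s l(2)[OF jS] m(2)[OF jS] by simp_all
    ultimately have "\<bar>det2 p (v j)\<bar> + \<bar>det2 q (v j)\<bar>
       = \<bar>det2 u (v j)\<bar> * (g * (t l - t j) / s + g * (t j - t m) / s)"
      by (simp only: abs_mult[of "det2 u (v j)"] abs_of_nonneg distrib_left)
    also have "g * (t l - t j) / s + g * (t j - t m) / s = g * (t l - t m) / s"
      by (simp add: algebra_simps flip: add_divide_distrib)
    also have "\<dots> = 1" using g s by simp
    finally show ?thesis by simp
  qed
  moreover have "det2 p (v l) = 0" "det2 q (v m) = 0"
    unfolding p_def q_def det2_scaleR det2_self by simp_all
  ultimately show ?thesis using that l(1) m(1) by metis
qed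

text \<open>The number of these indices is the induction measure for the splitting.\<close>

definition lonely :: "(nat \<Rightarrow> real^2) \<Rightarrow> nat set" where
  "lonely u = {i \<in> {1..6}. \<forall>j\<in>{1..6} - {i}. det2 (u i) (u j) \<noteq> 0}"

text \<open>The index i stops being lonely because p is parallel to \<open>u l\<close>. No other
  index becomes lonely: since i was lonely, no other vector was parallel to \<open>u i\<close>
  before the change.\<close>

lemma lonely_upd:
  assumes i: "i \<in> lonely u" and l: "l \<in> {1..6} - {i}" "det2 p (u l) = 0"
  shows "lonely (u(i := p)) \<subset> lonely u"
proof (rule psubsetI)
  show "lonely (u(i := p)) \<subseteq> lonely u"
  proof
    fix k assume k: "k \<in> lonely (u(i := p))"
    have ki: "k \<noteq> i" using k l by (auto simp: lonely_def)
    show "k \<in> lonely u"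
      unfolding lonely_def
    proof (intro CollectI conjI ballI)
      show "k \<in> {1..6}" using k by (auto simp: lonely_def)
      fix j assume j: "j \<in> {1..6} - {k}"
      show "det2 (u k) (u j) \<noteq> 0"
      proof (cases "j = i")
        case True
        have "det2 (u i) (u k) \<noteq> 0" using i k ki by (auto simp: lonely_def)
        then show ?thesis using True det2_swap[of "u k" "u i"] by simp
      next
        case False
        have "det2 ((u(i := p)) k) ((u(i := p)) j) \<noteq> 0" using k j unfolding lonely_def by blast
        then show ?thesis using False ki by simp
      qed
    qed
  qed
  show "lonely (u(i := p)) \<noteq> lonely u"
  proof
    assume "lonely (u(i := p)) = lonely u"
    then have "i \<in> lonely (u(i := p))" using i by auto
    then show False using l by (auto simp: lonely_def)
  qed
qed

text \<open>Parallelism is an equivalence relation on nonzero vectors. Its classes have at least two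
  elements, as no index is lonely, and at most three unless \<open>PhiU u\<close> vanishes; six
  indices then split as 3+3 or 2+2+2.\<close>

lemma PhiU_terminal:
  assumes nz: "\<And>i. i \<in> {1..6} \<Longrightarrow> u i \<noteq> 0" and nl: "lonely u = {}"
  shows "PhiU u = 0 \<or> type33 u \<or> type222 u"
proof (cases "PhiU u = 0")
  case False
  define cl where "cl i = {j \<in> {1..6}. det2 (u i) (u j) = 0}" for i
  have fin: "finite (cl i)" for i by (simp add: cl_def)
  have sub: "cl i \<subseteq> {1..6}" for i by (auto simp: cl_def)
  have self: "i \<in> cl i" if "i \<in> {1..6}" for i using that by (simp add: cl_def det2_self)
  have sym: "j \<in> cl i \<Longrightarrow> i \<in> {1..6} \<Longrightarrow> i \<in> cl j" for i j
    using det2_swap[of "u j" "u i"] by (auto simp: cl_def)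
  have pw: "det2 (u a) (u b) = 0" if "a \<in> cl i" "b \<in> cl i" "i \<in> {1..6}" for a b i
    using that det2_eq_0_trans[of "u a" "u i" "u b"] nz[of i] det2_swap[of "u a" "u i"]
    by (auto simp: cl_def)
  have disj: "cl i \<inter> cl j = {}" if "i \<in> {1..6}" "j \<in> {1..6}" "j \<notin> cl i" for i j
  proof (rule ccontr)
    assume "cl i \<inter> cl j \<noteq> {}"
    then obtain k where k: "k \<in> cl i" "k \<in> cl j" by auto
    have "det2 (u i) (u k) = 0" "det2 (u k) (u j) = 0" "u k \<noteq> 0"
      using k det2_swap[of "u k" "u j"] nz by (auto simp: cl_def)
    then have "det2 (u i) (u j) = 0" by (rule det2_eq_0_trans)
    then show False using that by (simp add: cl_def)
  qed
  have ge2: "2 \<le> card (cl i)" if i: "i \<in> {1..6}" for i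
  proof -
    have "i \<notin> lonely u" using nl by simp
    then obtain j where "j \<in> {1..6} - {i}" "det2 (u i) (u j) = 0"
      using i unfolding lonely_def by blast
    then have "{i, j} \<subseteq> cl i" "i \<noteq> j" using self[OF i] by (auto simp: cl_def)
    then show ?thesis using card_mono[OF fin, of "{i,j}" i] by simp
  qed
  have le3: "card (cl i) \<le> 3" if i: "i \<in> {1..6}" for i
  proof (rule ccontr)
    assume "\<not> card (cl i) \<le> 3"
    then have "PhiU u = 0" using pw i sub by (intro PhiU_eq_0[of "cl i"]) auto
    then show False using False by simp
  qed
  have npw: "det2 (u a) (u b) \<noteq> 0" if "a \<in> cl i" "b \<in> {1..6} - cl i" "i \<in> {1..6}" for a b i
  proof
    assume "det2 (u a) (u b) = 0"
    moreover have "det2 (u i) (u a) = 0" "u a \<noteq> 0" using that nz by (auto simp: cl_def)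
    ultimately have "det2 (u i) (u b) = 0" by (metis det2_eq_0_trans)
    then show False using that unfolding cl_def by blast
  qed
  show ?thesis
  proof (cases "\<exists>i\<in>{1..6}. card (cl i) = 3")
    case True
    then obtain i where i: "i \<in> {1..6}" "card (cl i) = 3" by auto
    define J2 where "J2 = {1..6} - cl i"
    have cJ2: "card J2 = 3" using i sub[of i] fin by (simp add: J2_def card_Diff_subset)
    then obtain j where j: "j \<in> J2" by (metis card.empty ex_in_conv zero_neq_numeral)
    have clsub: "cl k \<subseteq> J2" if "k \<in> J2" for k
      using that disj[OF i(1), of k] sub[of k] by (auto simp: J2_def)
    \<comment> \<open>Two disjoint classes of at least two elements do not fit into the three
      remaining indices.\<close>
    have "cl j = J2"
    proof (rule ccontr)
      assume ne: "cl j \<noteq> J2"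
      then obtain k where k: "k \<in> J2" "k \<notin> cl j" using clsub[OF j] by auto
      have jk: "j \<in> {1..6}" "k \<in> {1..6}" using j k by (auto simp: J2_def)
      have "card (cl j \<union> cl k) = card (cl j) + card (cl k)"
        using disj[OF jk k(2)] fin by (intro card_Un_disjoint) auto
      moreover have "card (cl j \<union> cl k) \<le> card J2"
        using clsub[OF j] clsub[OF k(1)] by (intro card_mono) (auto simp: J2_def)
      ultimately show False using ge2[OF jk(1)] ge2[OF jk(2)] cJ2 by simp
    qed
    then have "type33 u"
      unfolding type33_def par2_iff_det2
      using nz i cJ2 sub[of i] pw[OF _ _ i(1)] pw[of _ j] j npw[OF _ _ i(1)]
      by (intro conjI exI[of _ "cl i"] exI[of _ J2]) (auto simp: J2_def)
    then show ?thesis by simp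
  next
    case False
    have c2: "card (cl i) = 2" if "i \<in> {1..6}" for i
      using ge2[OF that] le3[OF that] False that
      by (metis One_nat_def Suc_1 le_SucE le_antisym numeral_3_eq_3)
    have one: "1 \<in> {1..6::nat}" by simp
    define I1 where "I1 = cl 1"
    have cI1: "card ({1..6} - I1) = 4"
      unfolding I1_def using c2[OF one] sub[of 1] fin by (simp add: card_Diff_subset)
    then obtain j where j: "j \<in> {1..6} - I1" by (metis card.empty ex_in_conv zero_neq_numeral)
    define I2 where "I2 = cl j"
    have j6: "j \<in> {1..6}" "j \<notin> cl 1" using j by (auto simp: I1_def)
    have d12: "I1 \<inter> I2 = {}" unfolding I1_def I2_def by (rule disj[OF one j6])
    define I3 where "I3 = {1..6} - (I1 \<union> I2)"
    have "card (I1 \<union> I2) = 4"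
      using d12 c2[OF one] c2[OF j6(1)] fin unfolding I1_def I2_def by (simp add: card_Un_disjoint)
    moreover have "I1 \<union> I2 \<subseteq> {1..6}" using sub unfolding I1_def I2_def by auto
    ultimately have cI3: "card I3 = 2"
      using fin by (simp add: I3_def card_Diff_subset I1_def I2_def)
    then obtain k where k: "k \<in> I3" by (metis card.empty ex_in_conv zero_neq_numeral)
    have k6: "k \<in> {1..6}" "k \<notin> cl 1" "k \<notin> cl j" using k by (auto simp: I3_def I1_def I2_def)
    have "cl k \<subseteq> I3"
      using disj[OF one k6(1,2)] disj[OF j6(1) k6(1,3)] sub[of k]
      by (auto simp: I3_def I1_def I2_def)
    then have I3: "I3 = cl k"
      using c2[OF k6(1)] cI3 by (metis card_subset_eq I3_def finite_Diff finite_atLeastAtMost)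
    have I2n: "a \<in> I2 \<Longrightarrow> a \<in> {1..6} - cl 1" "a \<in> I3 \<Longrightarrow> a \<in> {1..6} - cl 1" "a \<in> I3 \<Longrightarrow> a \<in> {1..6} - cl j" for a
      using d12 sub[of j] by (auto simp: I3_def I1_def I2_def)
    have n12: "det2 (u a) (u b) \<noteq> 0" if "a \<in> I1" "b \<in> I2" for a b
      using npw[of a 1 b] I2n(1)[of b] that one by (simp add: I1_def)
    have n13: "det2 (u a) (u b) \<noteq> 0" if "a \<in> I1" "b \<in> I3" for a b
      using npw[of a 1 b] I2n(2)[of b] that one by (simp add: I1_def)
    have n23: "det2 (u a) (u b) \<noteq> 0" if "a \<in> I2" "b \<in> I3" for a b
      using npw[of a j b] I2n(3)[of b] that j6 by (simp add: I2_def)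
    have sw: "det2 (u a) (u b) \<noteq> 0 \<longleftrightarrow> det2 (u b) (u a) \<noteq> 0" for a b
      using det2_swap[of "u a" "u b"] by simp
    have nonpar: "\<forall>r\<in>{I1,I2,I3}. \<forall>s\<in>{I1,I2,I3}. r \<noteq> s \<longrightarrow> (\<forall>i\<in>r. \<forall>j\<in>s. det2 (u i) (u j) \<noteq> 0)"
      using n12 n13 n23 sw by blast
    have par: "\<forall>r\<in>{I1,I2,I3}. \<forall>i\<in>r. \<forall>j\<in>r. det2 (u i) (u j) = 0"
      using pw[OF _ _ one] pw[OF _ _ j6(1)] pw[OF _ _ k6(1)]
      unfolding I3 by (auto simp: I1_def I2_def)
    have un: "I1 \<union> I2 \<union> I3 = {1..6}" "I1 \<inter> I3 = {}" "I2 \<inter> I3 = {}"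
      using sub[of 1] sub[of j] by (auto simp: I3_def I1_def I2_def)
    have cc: "card I1 = 2" "card I2 = 2"
      using c2[OF one] c2[OF j6(1)] by (simp_all add: I1_def I2_def)
    have nz': "\<forall>i\<in>{1..6}. u i \<noteq> 0" using nz by blast
    have "type222 u"
      unfolding type222_def par2_iff_det2
      by (intro conjI exI[of _ I1] exI[of _ I2] exI[of _ I3]; fact)
    then show ?thesis by simp
  qed
qed simp

text \<open>If all vectors other than a lonely one are parallel, five of them are and
  \<open>PhiU u\<close> vanishes. Otherwise the lonely vector is split between its neighbours, and
  both summands have fewer lonely indices.\<close>

lemma PhiU_in_cone_of_rays: "PhiU u \<in> convex_cone hull (\<Union> (rays33 \<union> rays222))" (is "_ \<in> ?K")
proof (induction "card (lonely u)" arbitrary: u rule: less_induct)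
  case less
  have K: "convex_cone ?K" by (rule convex_cone_convex_cone_hull)
  have z: "0 \<in> ?K" by (rule convex_cone_hull_contains_0)
  have finl: "finite (lonely w)" for w by (simp add: lonely_def)
  show ?case
  proof (cases "\<exists>i\<in>{1..6}. u i = 0")
    case True
    then show ?thesis using PhiU_eq_0_if_zero z by metis
  next
    case nz: False
    show ?thesis
    proof (cases "lonely u = {}")
      case True
      consider "PhiU u = 0" | "type33 u" | "type222 u" using PhiU_terminal[of u] nz True by blast
      then show ?thesis
      proof cases
        case 1
        then show ?thesis using z by simp
      next
        case 2
        then have "ray_of (PhiU u) \<in> rays33 \<union> rays222" by (auto simp: rays33_def)
        moreover have "PhiU u \<in> ray_of (PhiU u)"
          unfolding ray_of_def by (intro CollectI exI[of _ 1]) simp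
        ultimately show ?thesis by (intro hull_inc) blast
      next
        case 3
        then have "ray_of (PhiU u) \<in> rays33 \<union> rays222" by (auto simp: rays222_def)
        moreover have "PhiU u \<in> ray_of (PhiU u)"
          unfolding ray_of_def by (intro CollectI exI[of _ 1]) simp
        ultimately show ?thesis by (intro hull_inc) blast
      qed
    next
      case False
      then obtain i where i: "i \<in> lonely u" by auto
      define S where "S = {1..6} - {i}"
      have i6: "i \<in> {1..6}" using i by (simp add: lonely_def)
      show ?thesis
      proof (cases "\<exists>j\<in>S. \<exists>k\<in>S. det2 (u j) (u k) \<noteq> 0")
        case False
        have "card S = 5" using i6 by (simp add: S_def)
        then have "PhiU u = 0" using False by (intro PhiU_eq_0[of S]) (auto simp: S_def)
        then show ?thesis using z by simp
      next
        case True
        then obtain j1 j2 where js: "j1 \<in> S" "j2 \<in> S" "det2 (u j1) (u j2) \<noteq> 0" by auto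
        have ui: "det2 (u i) (u j) \<noteq> 0" if "j \<in> S" for j
          using i that unfolding lonely_def S_def by blast
        have finS: "finite S" by (simp add: S_def)
        obtain p q l m where pq: "l \<in> S" "m \<in> S" "det2 p (u l) = 0" "det2 q (u m) = 0"
          "\<And>j. j \<in> S \<Longrightarrow> \<bar>det2 (u i) (u j)\<bar> = \<bar>det2 p (u j)\<bar> + \<bar>det2 q (u j)\<bar>"
          using split_between_neighbours[OF finS js ui, of thesis] by metis
        \<comment> \<open>The matrix is cut off outside \<open>{1..6}\<close> because
          \<open>phi_of_multilinear\<close> quantifies over all indices, while the splitting
          identity holds only for the vectors of the family.\<close>
        have "phi_of (\<lambda>a b. if a \<in> {1..6} \<and> b \<in> {1..6} then \<bar>det2 (u a) (u b)\<bar> / 2 else 0)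
          = (\<Sum>x\<leftarrow>[p,q]. phi_of (\<lambda>a b. if a \<in> {1..6} \<and> b \<in> {1..6}
               then \<bar>det2 ((u(i := x)) a) ((u(i := x)) b)\<bar> / 2 else 0))"
        proof (rule phi_of_multilinear[OF i6])
          fix j assume "j \<noteq> i"
          then show "(if i \<in> {1..6} \<and> j \<in> {1..6} then \<bar>det2 (u i) (u j)\<bar> / 2 else 0)
            = (\<Sum>x\<leftarrow>[p,q]. if i \<in> {1..6} \<and> j \<in> {1..6}
               then \<bar>det2 ((u(i := x)) i) ((u(i := x)) j)\<bar> / 2 else 0)"
            using pq(5)[of j] by (auto simp: S_def)
        next
          fix j assume "j \<noteq> i"
          then show "(if j \<in> {1..6} \<and> i \<in> {1..6} then \<bar>det2 (u j) (u i)\<bar> / 2 else 0)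
            = (\<Sum>x\<leftarrow>[p,q]. if j \<in> {1..6} \<and> i \<in> {1..6}
               then \<bar>det2 ((u(i := x)) j) ((u(i := x)) i)\<bar> / 2 else 0)"
            using pq(5)[of j] by (auto simp: S_def abs_det2_commute[of "u j"])
        qed auto
        moreover have "phi_of (\<lambda>a b. if a \<in> {1..6} \<and> b \<in> {1..6} then \<bar>det2 (w a) (w b)\<bar> / 2 else 0) = PhiU w" for w
        proof (subst vec_eq_iff, intro allI)
          fix k :: 15
          obtain a b c d e f where o: "{a,b,c,d,e,f} = {1..6}" "\<And>M. phi_of M $ k = M a b * M c d * M e f"
            using phi_of_nth[of k] by metis
          have "a \<in> {1..6}" "b \<in> {1..6}" "c \<in> {1..6}" "d \<in> {1..6}" "e \<in> {1..6}" "f \<in> {1..6}"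
            using o(1) by auto
          then show "phi_of (\<lambda>a b. if a \<in> {1..6} \<and> b \<in> {1..6} then \<bar>det2 (w a) (w b)\<bar> / 2 else 0) $ k = PhiU w $ k"
            unfolding PhiU_eq_phi_of o(2) by simp
        qed
        ultimately have "PhiU u = PhiU (u(i := p)) + PhiU (u(i := q))" by (simp add: fun_upd_def)
        moreover have "PhiU (u(i := p)) \<in> ?K"
          using lonely_upd[OF i _ pq(3)] pq(1) psubset_card_mono[OF finl] less.hyps
          unfolding S_def by metis
        moreover have "PhiU (u(i := q)) \<in> ?K"
          using lonely_upd[OF i _ pq(4)] pq(2) psubset_card_mono[OF finl] less.hyps
          unfolding S_def by metis
        ultimately show ?thesis using convex_cone_add[OF K] by simp
      qed
    qed
  qed
qed

section \<open>The action of the symmetric group\<close>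

text \<open>Coordinates numbered by naturals from 0 connect \<open>real^15\<close> with lists, on
  which the checks can be evaluated.\<close>

definition vecf :: "(nat \<Rightarrow> real) \<Rightarrow> real^15" where
  "vecf f = (\<chi> i. f (idx i - 1))"

lemma ex_idx: "n < 15 \<Longrightarrow> \<exists>i. idx i - 1 = n"
proof -
  assume "n < 15"
  then have "n + 1 \<in> idx ` UNIV" using idx_bij by (auto simp: bij_betw_def)
  then obtain i where "idx i = n + 1" by (metis imageE)
  then show ?thesis by (intro exI[of _ i]) simp
qed

lemma idx_minus_1_less: "idx i - 1 < 15"
  using idx_range[of i] by auto

lemma idx_inject: "idx i = idx j \<longleftrightarrow> i = j"
  using idx_bij by (auto simp: bij_betw_def inj_on_def)

lemma idx_minus_1_inject: "idx i - 1 = idx j - 1 \<longleftrightarrow> i = j"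
proof -
  have "1 \<le> idx i" "1 \<le> idx j" using idx_range[of i] idx_range[of j] by auto
  then have "idx i - 1 = idx j - 1 \<longleftrightarrow> idx i = idx j" by linarith
  then show ?thesis by (simp add: idx_inject)
qed

lemma idx_minus_1_bij: "bij_betw (\<lambda>i. idx i - 1) (UNIV :: 15 set) {..<15}"
  unfolding bij_betw_def inj_on_def
  using idx_minus_1_less ex_idx
  by (auto simp: idx_minus_1_inject[unfolded One_nat_def]) (metis One_nat_def rangeI)

lemma vecf_eq_iff: "vecf f = vecf g \<longleftrightarrow> (\<forall>n<15. f n = g n)"
  unfolding vecf_def vec_eq_iff vec_lambda_beta using ex_idx idx_minus_1_less by metis

lemma vecf_surj: "\<exists>f. x = vecf f"
proof -
  define f where "f n = x $ (THE i. idx i - 1 = n)" for n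
  have "(THE j. idx j - 1 = idx i - 1) = i" for i
    by (rule the_equality) (simp_all only: idx_minus_1_inject)
  then have "x = vecf f" by (simp add: vecf_def f_def vec_eq_iff)
  then show ?thesis by blast
qed

lemma inner_vecf: "vecf f \<bullet> vecf g = (\<Sum>n<15. f n * g n)"
proof -
  have "vecf f \<bullet> vecf g = (\<Sum>i\<in>UNIV. f (idx i - 1) * g (idx i - 1))"
    by (simp add: vecf_def inner_vec_def)
  also have "\<dots> = (\<Sum>n<15. f n * g n)"
    by (rule sum.reindex_bij_betw[OF idx_minus_1_bij])
  finally show ?thesis .
qed

definition part_list :: "nat \<Rightarrow> (nat \<times> nat) list" where
  "part_list n = (case pair_partitions ! n of (p, q, r) \<Rightarrow> [p, q, r])"

definition part0 :: "nat \<Rightarrow> nat set set" where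
  "part0 n = (\<lambda>(x,y). {x,y}) ` set (part_list n)"

lemma part_idx: "part (idx i) = part0 (idx i - 1)"
  by (auto simp: part_def part0_def part_list_def split: prod.split)

text \<open>Sylvester's name for the pairs in a six-element set; here each one stands for a
  transposition. As constructors they select a coordinate permutation by pattern matching
  alone.\<close>

datatype duad = D12 | D13 | D14 | D15 | D16 | D23 | D24 | D25 | D26 | D34 | D35 | D36 | D45 | D46 | D56

definition duads :: "duad list" where
  "duads = [D12, D13, D14, D15, D16, D23, D24, D25, D26, D34, D35, D36, D45, D46, D56]"

fun duad_pair :: "duad \<Rightarrow> nat \<times> nat" where
  "duad_pair D12 = (1,2)"
| "duad_pair D13 = (1,3)"
| "duad_pair D14 = (1,4)"
| "duad_pair D15 = (1,5)"
| "duad_pair D16 = (1,6)"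
| "duad_pair D23 = (2,3)"
| "duad_pair D24 = (2,4)"
| "duad_pair D25 = (2,5)"
| "duad_pair D26 = (2,6)"
| "duad_pair D34 = (3,4)"
| "duad_pair D35 = (3,5)"
| "duad_pair D36 = (3,6)"
| "duad_pair D45 = (4,5)"
| "duad_pair D46 = (4,6)"
| "duad_pair D56 = (5,6)"

text \<open>The action of each transposition on the 15 pair partitions, written out as a permutation
  of list entries. \<open>swaps_check\<close> verifies these tables against the partitions.\<close>

definition apply_duad :: "duad \<Rightarrow> 'a list \<Rightarrow> 'a list" where
  "apply_duad d xs = (case xs of [a,b,c,d',e,f,g,h,i,j,k,l,m,n,p'] \<Rightarrow> (case d of
      D12 \<Rightarrow> [a,m,f,e,d',c,h,g,l,k,j,i,b,n,p']
    | D13 \<Rightarrow> [d',n,p',a,e,f,j,i,h,g,l,k,m,b,c]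
    | D14 \<Rightarrow> [e,c,b,d',a,j,g,n,p',f,m,l,k,h,i]
    | D15 \<Rightarrow> [j,d',c,b,i,p',n,h,e,a,k,m,l,g,f]
    | D16 \<Rightarrow> [k,b,d',c,h,g,f,e,i,j,a,p',n,m,l]
    | D23 \<Rightarrow> [e,b,c,d',a,p',l,k,j,i,h,g,n,m,f]
    | D24 \<Rightarrow> [d',j,k,a,e,m,n,h,i,b,c,p',f,g,l]
    | D25 \<Rightarrow> [k,i,p',l,m,f,g,n,b,j,a,d',e,h,c]
    | D26 \<Rightarrow> [j,n,h,g,f,e,d',c,p',a,k,l,m,b,i]
    | D34 \<Rightarrow> [a,i,h,e,d',g,f,c,b,j,k,m,l,p',n]
    | D35 \<Rightarrow> [n,j,f,g,h,c,d',e,i,b,m,l,k,a,p']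
    | D36 \<Rightarrow> [p',m,k,l,i,j,g,h,e,f,c,d',b,n,a]
    | D45 \<Rightarrow> [p',b,d',c,f,e,h,g,j,i,l,k,m,n,a]
    | D46 \<Rightarrow> [n,d',c,b,m,f,j,k,l,g,h,i,e,a,p']
    | D56 \<Rightarrow> [a,c,b,d',e,m,l,i,h,k,j,g,f,p',n]) | _ \<Rightarrow> xs)"

lemma apply_duad_code [code]:
  "apply_duad D12 [a,b,c,d',e,f,g,h,i,j,k,l,m,n,p'] = [a,m,f,e,d',c,h,g,l,k,j,i,b,n,p']"
  "apply_duad D13 [a,b,c,d',e,f,g,h,i,j,k,l,m,n,p'] = [d',n,p',a,e,f,j,i,h,g,l,k,m,b,c]"
  "apply_duad D14 [a,b,c,d',e,f,g,h,i,j,k,l,m,n,p'] = [e,c,b,d',a,j,g,n,p',f,m,l,k,h,i]"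
  "apply_duad D15 [a,b,c,d',e,f,g,h,i,j,k,l,m,n,p'] = [j,d',c,b,i,p',n,h,e,a,k,m,l,g,f]"
  "apply_duad D16 [a,b,c,d',e,f,g,h,i,j,k,l,m,n,p'] = [k,b,d',c,h,g,f,e,i,j,a,p',n,m,l]"
  "apply_duad D23 [a,b,c,d',e,f,g,h,i,j,k,l,m,n,p'] = [e,b,c,d',a,p',l,k,j,i,h,g,n,m,f]"
  "apply_duad D24 [a,b,c,d',e,f,g,h,i,j,k,l,m,n,p'] = [d',j,k,a,e,m,n,h,i,b,c,p',f,g,l]"
  "apply_duad D25 [a,b,c,d',e,f,g,h,i,j,k,l,m,n,p'] = [k,i,p',l,m,f,g,n,b,j,a,d',e,h,c]"
  "apply_duad D26 [a,b,c,d',e,f,g,h,i,j,k,l,m,n,p'] = [j,n,h,g,f,e,d',c,p',a,k,l,m,b,i]"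
  "apply_duad D34 [a,b,c,d',e,f,g,h,i,j,k,l,m,n,p'] = [a,i,h,e,d',g,f,c,b,j,k,m,l,p',n]"
  "apply_duad D35 [a,b,c,d',e,f,g,h,i,j,k,l,m,n,p'] = [n,j,f,g,h,c,d',e,i,b,m,l,k,a,p']"
  "apply_duad D36 [a,b,c,d',e,f,g,h,i,j,k,l,m,n,p'] = [p',m,k,l,i,j,g,h,e,f,c,d',b,n,a]"
  "apply_duad D45 [a,b,c,d',e,f,g,h,i,j,k,l,m,n,p'] = [p',b,d',c,f,e,h,g,j,i,l,k,m,n,a]"
  "apply_duad D46 [a,b,c,d',e,f,g,h,i,j,k,l,m,n,p'] = [n,d',c,b,m,f,j,k,l,g,h,i,e,a,p']"
  "apply_duad D56 [a,b,c,d',e,f,g,h,i,j,k,l,m,n,p'] = [a,c,b,d',e,m,l,i,h,k,j,g,f,p',n]"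
  by (simp_all add: apply_duad_def)

text \<open>Applied to the list of positions, \<open>apply_duad\<close> reveals its own index
  table.\<close>

definition swaps :: "((nat \<times> nat) \<times> nat list) list" where
  "swaps = map (\<lambda>d. (duad_pair d, apply_duad d [0..<15])) duads"

lemma swaps_check:
  "list_all (\<lambda>((a,b),l). length l = 15 \<and> list_all (\<lambda>k. l ! k < 15 \<and>
     part0 (l ! k) = (\<lambda>I. Transposition.transpose a b ` I) ` part0 k) [0..<15]) swaps"
  by code_simp

lemma swaps_all: "list_all (\<lambda>a. list_all (\<lambda>b. a \<noteq> b \<longrightarrow> (a,b) \<in> fst ` set swaps \<or> (b,a) \<in> fst ` set swaps) [1..<7]) [1..<7]"
  by code_simp

lemma part0_inj_check:
  "list_all (\<lambda>i. list_all (\<lambda>j. part0 i = part0 j \<longrightarrow> i = j) [0..<15]) [0..<15]"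
  by code_simp

lemma part0_inj: "i < 15 \<Longrightarrow> j < 15 \<Longrightarrow> part0 i = part0 j \<longleftrightarrow> i = j"
  using part0_inj_check by (auto simp: list_all_iff)

lemma swaps_part0:
  assumes "((a,b),l) \<in> set swaps" "k < 15"
  shows "l ! k < 15" "part0 (l ! k) = (\<lambda>I. Transposition.transpose a b ` I) ` part0 k"
proof -
  have "list_all (\<lambda>k. l ! k < 15 \<and> part0 (l ! k) = (\<lambda>I. Transposition.transpose a b ` I) ` part0 k) [0..<15]"
    using swaps_check assms(1) unfolding list_all_iff by fastforce
  then show "l ! k < 15" "part0 (l ! k) = (\<lambda>I. Transposition.transpose a b ` I) ` part0 k"
    using assms(2) by (simp_all add: list_all_iff)
qed

lemma swaps_cover:
  assumes "a \<in> {1..6}" "b \<in> {1..6}" "a \<noteq> b"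
  shows "\<exists>l. ((a,b),l) \<in> set swaps \<or> ((b,a),l) \<in> set swaps"
proof -
  have "a \<in> set [1..<7]" "b \<in> set [1..<7]" using assms by auto
  then have "(a,b) \<in> fst ` set swaps \<or> (b,a) \<in> fst ` set swaps"
    using swaps_all assms(3) unfolding list_all_iff by blast
  then show ?thesis by force
qed

lemma part0_image:
  assumes "\<sigma> permutes {1..6}" "k < 15"
  shows "\<exists>j<15. part0 j = (\<lambda>I. \<sigma> ` I) ` part0 k"
  using assms(1) finite_atLeastAtMost
proof (induction rule: permutes_induct)
  case id
  show ?case using assms(2) by (intro exI[of _ k]) simp
next
  case (swap a b p)
  obtain j where j: "j < 15" "part0 j = (\<lambda>I. p ` I) ` part0 k" using swap by blast
  obtain l where "((a,b),l) \<in> set swaps \<or> ((b,a),l) \<in> set swaps" using swaps_cover swap by metis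
  then have "l ! j < 15" "part0 (l ! j) = (\<lambda>I. Transposition.transpose a b ` I) ` part0 j"
    using swaps_part0[OF _ j(1)] by (metis transpose_commute)+
  then show ?case using j by (intro exI[of _ "l ! j"]) (simp add: image_image image_comp)
qed

lemma S6_ex:
  assumes "\<sigma> permutes {1..6}"
  shows "\<exists>j. part (idx j) = (\<lambda>I. \<sigma> ` I) ` part (idx i)"
  using part0_image[OF assms idx_minus_1_less[of i]] ex_idx unfolding part_idx by metis

lemma part_idx_inject: "part (idx i) = part (idx j) \<longleftrightarrow> i = j"
  unfolding part_idx part0_inj[OF idx_minus_1_less idx_minus_1_less] by (rule idx_minus_1_inject)

lemma S6_act_nth:
  assumes "part (idx j) = (\<lambda>I. \<sigma> ` I) ` part (idx i)"
  shows "S6_act \<sigma> x $ i = x $ j"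
proof -
  have "(THE j. part (idx j) = (\<lambda>I. \<sigma> ` I) ` part (idx i)) = j"
    using assms by (intro the_equality) (auto simp flip: part_idx_inject)
  then show ?thesis by (simp add: S6_act_def)
qed

text \<open>Coordinates are pulled back along the permutation, so this is a right action and the
  order of composition is reversed.\<close>

lemma S6_act_comp:
  assumes "\<sigma> permutes {1..6}" "\<tau> permutes {1..6}"
  shows "S6_act \<sigma> (S6_act \<tau> x) = S6_act (\<tau> \<circ> \<sigma>) x"
proof (subst vec_eq_iff, intro allI)
  fix i
  obtain j where j: "part (idx j) = (\<lambda>I. \<sigma> ` I) ` part (idx i)" using S6_ex[OF assms(1)] by metis
  obtain k where k: "part (idx k) = (\<lambda>I. \<tau> ` I) ` part (idx j)" using S6_ex[OF assms(2)] by metis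
  have "part (idx k) = (\<lambda>I. (\<tau> \<circ> \<sigma>) ` I) ` part (idx i)"
    unfolding k j by (simp add: image_image image_comp)
  then show "S6_act \<sigma> (S6_act \<tau> x) $ i = S6_act (\<tau> \<circ> \<sigma>) x $ i"
    by (simp add: S6_act_nth[OF j] S6_act_nth[OF k] S6_act_nth)
qed

lemma S6_act_id: "S6_act id x = x"
proof (subst vec_eq_iff, intro allI)
  fix i show "S6_act id x $ i = x $ i" by (rule S6_act_nth) simp
qed

lemma S6_act_inv:
  assumes "\<sigma> permutes {1..6}"
  shows "S6_act \<sigma> (S6_act (inv \<sigma>) x) = x" "S6_act (inv \<sigma>) (S6_act \<sigma> x) = x"
  using assms by (simp_all add: S6_act_comp permutes_inv permutes_inv_o S6_act_id)

lemma linear_S6_act: "linear (S6_act \<sigma>)"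
  by (rule linearI) (simp_all add: S6_act_def vec_eq_iff)

lemma inner_S6_act:
  assumes "\<sigma> permutes {1..6}"
  shows "S6_act \<sigma> x \<bullet> S6_act \<sigma> y = x \<bullet> y"
proof -
  obtain h where h: "\<And>i. part (idx (h i)) = (\<lambda>I. \<sigma> ` I) ` part (idx i)"
    using S6_ex[OF assms] by metis
  have "inj h"
  proof (rule injI)
    fix i j assume "h i = h j"
    then have "(\<lambda>I. \<sigma> ` I) ` part (idx i) = (\<lambda>I. \<sigma> ` I) ` part (idx j)" using h by metis
    moreover have "inj (\<lambda>I. \<sigma> ` I)"
      using permutes_inj[OF assms] by (simp add: inj_image_eq_iff inj_def)
    ultimately have "part (idx i) = part (idx j)" by (simp add: inj_image_eq_iff)
    then show "i = j" by (simp add: part_idx_inject)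
  qed
  then have bij: "bij h" by (simp add: bij_def finite_UNIV_inj_surj)
  have "S6_act \<sigma> x \<bullet> S6_act \<sigma> y = (\<Sum>i\<in>UNIV. x $ h i \<bullet> y $ h i)"
    by (simp add: inner_vec_def S6_act_nth[OF h])
  also have "\<dots> = (\<Sum>i\<in>UNIV. x $ i \<bullet> y $ i)" by (rule sum.reindex_bij_betw[OF bij])
  finally show ?thesis by (simp add: inner_vec_def)
qed

lemma inner_S6_act_left:
  assumes "\<sigma> permutes {1..6}"
  shows "S6_act \<sigma> x \<bullet> y = x \<bullet> S6_act (inv \<sigma>) y"
  using inner_S6_act[OF permutes_inv[OF assms], of "S6_act \<sigma> x" y]
  by (simp add: S6_act_inv[OF assms])

text \<open>Symmetry of M is required because \<sigma> may reverse the order inside a pair, which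
  exchanges \<open>Min\<close> and \<open>Max\<close>.\<close>

lemma S6_act_phi_of:
  assumes \<sigma>: "\<sigma> permutes {1..6}" and M: "\<And>i j. M i j = M j i"
  shows "S6_act \<sigma> (phi_of M) = phi_of (\<lambda>i j. M (\<sigma> i) (\<sigma> j))"
proof (subst vec_eq_iff, intro allI)
  fix i
  obtain j where j: "part (idx j) = (\<lambda>I. \<sigma> ` I) ` part (idx i)" using S6_ex[OF \<sigma>] by metis
  have inj: "inj \<sigma>" using permutes_inj[OF \<sigma>] .
  have "phi_of M $ j = (\<Prod>I\<in>(\<lambda>I. \<sigma> ` I) ` part (idx i). M (Min I) (Max I))"
    by (simp add: phi_of_def j)
  also have "\<dots> = (\<Prod>I\<in>part (idx i). M (Min (\<sigma> ` I)) (Max (\<sigma> ` I)))"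
  proof (subst prod.reindex)
    show "inj_on (\<lambda>I. \<sigma> ` I) (part (idx i))" using inj by (simp add: inj_on_def inj_image_eq_iff)
  qed simp
  also have "\<dots> = (\<Prod>I\<in>part (idx i). M (\<sigma> (Min I)) (\<sigma> (Max I)))"
  proof (rule prod.cong[OF refl])
    fix I assume I: "I \<in> part (idx i)"
    obtain a b where ab: "I = {a,b}" "a < b"
      using part_pairs[OF idx_range[of i]] I by (metis (no_types, lifting) insert_iff singletonD)
    show "M (Min (\<sigma> ` I)) (Max (\<sigma> ` I)) = M (\<sigma> (Min I)) (\<sigma> (Max I))"
      using ab M[of "\<sigma> a" "\<sigma> b"] by (simp add: min_def max_def)
  qed
  finally show "S6_act \<sigma> (phi_of M) $ i = phi_of (\<lambda>i j. M (\<sigma> i) (\<sigma> j)) $ i"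
    by (simp add: S6_act_nth[OF j] phi_of_def)
qed

lemma S6_act_Phi: "\<sigma> permutes {1..6} \<Longrightarrow> S6_act \<sigma> (Phi Z) = Phi (Z \<circ> \<sigma>)"
  unfolding Phi_eq_phi_of by (subst S6_act_phi_of) (auto intro: mixed_area_commute)

lemma S6_act_PhiU: "\<sigma> permutes {1..6} \<Longrightarrow> S6_act \<sigma> (PhiU u) = PhiU (u \<circ> \<sigma>)"
  unfolding PhiU_def by (subst S6_act_Phi) (auto simp: comp_def)

lemma S6_act_C62:
  assumes "\<sigma> permutes {1..6}"
  shows "S6_act \<sigma> ` C62 = C62"
proof -
  have sub: "S6_act \<tau> ` C62 \<subseteq> C62" if \<tau>: "\<tau> permutes {1..6}" for \<tau>
  proof -
    have "S6_act \<tau> ` C62 = convex_cone hull (S6_act \<tau> ` Phi ` {Z. \<forall>i\<in>{1..6}. zonoid2 (Z i)})"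
      unfolding C62_def by (rule convex_cone_hull_linear_image[OF linear_S6_act, symmetric])
    also have "S6_act \<tau> ` Phi ` {Z. \<forall>i\<in>{1..6}. zonoid2 (Z i)} \<subseteq> Phi ` {Z. \<forall>i\<in>{1..6}. zonoid2 (Z i)}"
      using permutes_in_image[OF \<tau>] by (auto simp: image_iff S6_act_Phi[OF \<tau>])
    finally show ?thesis unfolding C62_def by (simp add: hull_mono subset_trans)
  qed
  have "C62 = S6_act \<sigma> ` S6_act (inv \<sigma>) ` C62" by (simp add: image_image S6_act_inv[OF assms])
  then show ?thesis
    using sub[OF assms] sub[OF permutes_inv[OF assms]] by (metis image_mono subset_antisym)
qed

lemma S6_act_swap:
  assumes "((a,b),l) \<in> set swaps"
  shows "S6_act (Transposition.transpose a b) (vecf f) = vecf (\<lambda>n. f (l ! n))"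
proof (subst vec_eq_iff, intro allI)
  fix i
  note sw = swaps_part0[OF assms idx_minus_1_less[of i]]
  obtain j where j: "idx j - 1 = l ! (idx i - 1)" using ex_idx[OF sw(1)] by blast
  have "part (idx j) = (\<lambda>I. Transposition.transpose a b ` I) ` part (idx i)"
    unfolding part_idx j by (rule sw(2))
  then show "S6_act (Transposition.transpose a b) (vecf f) $ i = vecf (\<lambda>n. f (l ! n)) $ i"
    using j by (simp add: S6_act_nth vecf_def)
qed

lemma length_15E:
  assumes "length xs = 15"
  obtains a b c d' e f g h i j k l m n p' where "xs = [a,b,c,d',e,f,g,h,i,j,k,l,m,n,p']"
  using assms by (auto simp: numeral_eq_Suc length_Suc_conv)

lemma length_apply_duad: "length xs = 15 \<Longrightarrow> length (apply_duad d xs) = 15"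
  by (erule length_15E, cases d) (simp_all add: apply_duad_code)

lemma apply_duad_map: "length xs = 15 \<Longrightarrow> apply_duad d (map f xs) = map f (apply_duad d xs)"
  by (erule length_15E, cases d) (simp_all add: apply_duad_code)

lemma duad_in_duads: "d \<in> set duads"
  by (cases d) (simp_all add: duads_def)

lemma duad_pair_range: "duad_pair d = (a, b) \<Longrightarrow> a \<in> {1..6} \<and> b \<in> {1..6}"
  by (cases d) auto

lemma S6_act_duad:
  assumes "length xs = 15" "duad_pair d = (a, b)"
  shows "S6_act (Transposition.transpose a b) (vecf (\<lambda>n. f (xs ! n))) = vecf (\<lambda>n. f (apply_duad d xs ! n))"
proof -
  have "((a,b), apply_duad d [0..<15]) \<in> set swaps"
    using assms(2) duad_in_duads[of d] by (force simp: swaps_def)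
  note sw = S6_act_swap[OF this]
  have "xs = map ((!) xs) [0..<15]" using assms(1) map_nth[of xs] by simp
  then have "apply_duad d xs = map ((!) xs) (apply_duad d [0..<15])"
    using apply_duad_map[of "[0..<15]" d "(!) xs"] by simp
  moreover have "length (apply_duad d [0..<15]) = 15" by (simp add: length_apply_duad)
  ultimately have "apply_duad d xs ! n = xs ! (apply_duad d [0..<15] ! n)" if "n < 15" for n
    using that by simp
  then show ?thesis unfolding sw by (simp add: vecf_eq_iff)
qed

section \<open>The generating rays\<close>

text \<open>Rows 0 to 14 are the rays of type (2,2,2), where row k has the k-th pair partition as
  its parallel pairs; rows 15 to 24 are those of type (3,3), in the order of \<open>triples\<close>.
  Up to a positive factor all of them are 0/1 vectors.\<close>

definition gens :: "int list list" where
  "gens = [[0,1,1,0,0,1,1,1,1,0,0,1,1,0,0],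
     [1,0,0,0,1,1,1,1,0,0,1,1,0,0,1],
     [1,0,0,0,1,0,1,0,1,1,0,1,1,1,0],
     [0,0,0,0,0,1,0,1,1,1,1,0,1,1,1],
     [0,1,1,0,0,0,1,0,0,1,1,1,0,1,1],
     [1,1,0,1,0,0,0,1,1,0,1,1,0,1,0],
     [1,1,1,0,1,0,0,0,1,0,1,0,1,0,1],
     [1,1,0,1,0,1,0,0,0,1,0,1,1,0,1],
     [1,0,1,1,0,1,1,0,0,0,1,0,1,1,0],
     [0,0,1,1,1,0,0,1,0,0,0,1,1,1,1],
     [0,1,0,1,1,1,1,0,1,0,0,0,0,1,1],
     [1,1,1,0,1,1,0,1,0,1,0,0,0,1,0],
     [1,0,1,1,0,0,1,1,1,1,0,0,0,0,1],
     [0,0,1,1,1,1,0,0,1,1,1,1,0,0,0],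
     [0,1,0,1,1,0,1,1,0,1,1,0,1,0,0],
     [0,0,0,0,0,0,1,1,1,1,1,1,0,0,0],
     [0,1,1,0,0,1,0,0,0,1,1,0,1,0,0],
     [0,1,0,1,1,0,0,0,1,0,0,1,1,0,0],
     [0,0,1,1,1,1,1,1,0,0,0,0,0,0,0],
     [0,1,1,0,0,0,0,1,1,0,0,0,0,1,1],
     [1,1,0,1,0,0,1,0,0,1,0,0,0,1,0],
     [1,0,1,1,0,0,0,0,0,0,1,1,0,0,1],
     [1,0,0,0,1,1,0,0,1,1,0,0,0,0,1],
     [1,0,0,0,1,0,0,1,0,0,1,0,1,1,0],
     [0,0,0,0,0,1,1,0,0,0,0,1,1,1,1]]"

text \<open>Only triples containing 1 are listed, so that each splitting into two triples occurs
  once.\<close>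

definition triples :: "nat list list" where
  "triples = [[1,2,3],[1,2,4],[1,2,5],[1,2,6],[1,3,4],[1,3,5],[1,3,6],[1,4,5],[1,4,6],[1,5,6]]"

definition lvec :: "int list \<Rightarrow> real^15" where
  "lvec xs = vecf (\<lambda>n. real_of_int (xs ! n))"

text \<open>A partition that avoids all parallel pairs must join each two of the three classes
  exactly once. For parallel copies of three vectors all nonzero coordinates are therefore
  equal.\<close>

definition w222 :: "nat set set \<Rightarrow> real^15" where
  "w222 P = (\<chi> i. if part (idx i) \<inter> P = {} then 1 else 0)"

text \<open>A coordinate survives if every pair joins the two classes; for parallel copies of two
  vectors it is the cube of a single mixed area.\<close>

definition w33 :: "nat set \<Rightarrow> real^15" where
  "w33 J = (\<chi> i. if \<forall>I\<in>part (idx i). I \<inter> J \<noteq> {} \<and> \<not> I \<subseteq> J then 1 else 0)"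

lemma gens_length: "length gens = 25" "\<And>g. g \<in> set gens \<Longrightarrow> length g = 15"
  by (auto simp: gens_def)

lemma gens_222_check:
  "list_all (\<lambda>k. list_all (\<lambda>n. gens ! k ! n = (if part0 n \<inter> part0 k = {} then 1 else 0)) [0..<15]) [0..<15]"
  by code_simp

lemma gens_33_check:
  "list_all (\<lambda>k. list_all (\<lambda>n. gens ! (15 + k) ! n =
     (if \<forall>I\<in>part0 n. I \<inter> set (triples ! k) \<noteq> {} \<and> \<not> I \<subseteq> set (triples ! k) then 1 else 0)) [0..<15]) [0..<10]"
  by code_simp

lemma w222_part0: "k < 15 \<Longrightarrow> w222 (part0 k) = lvec (gens ! k)"
  using gens_222_check idx_minus_1_less
  by (simp add: w222_def lvec_def vecf_def vec_eq_iff part_idx list_all_iff)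

lemma w33_triple: "k < 10 \<Longrightarrow> w33 (set (triples ! k)) = lvec (gens ! (15 + k))"
  using gens_33_check idx_minus_1_less
  by (simp add: w33_def lvec_def vecf_def vec_eq_iff part_idx list_all_iff)

lemma S6_act_w222:
  assumes "\<sigma> permutes {1..6}"
  shows "S6_act (inv \<sigma>) (w222 P) = w222 ((\<lambda>I. \<sigma> ` I) ` P)"
proof (subst vec_eq_iff, intro allI)
  fix i
  obtain j where j: "part (idx j) = (\<lambda>I. inv \<sigma> ` I) ` part (idx i)"
    using S6_ex[OF permutes_inv[OF assms]] by metis
  have "\<sigma> ` inv \<sigma> ` I = I" for I using permutes_surj[OF assms] by (simp add: image_f_inv_f)
  then have "part (idx i) = (\<lambda>I. \<sigma> ` I) ` part (idx j)" unfolding j by (simp add: image_image)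
  moreover have "inj (\<lambda>I. \<sigma> ` I)"
    using permutes_inj[OF assms] by (simp add: inj_image_eq_iff inj_def)
  ultimately have "part (idx i) \<inter> (\<lambda>I. \<sigma> ` I) ` P = {} \<longleftrightarrow> part (idx j) \<inter> P = {}"
    by (simp flip: image_Int)
  then show "S6_act (inv \<sigma>) (w222 P) $ i = w222 ((\<lambda>I. \<sigma> ` I) ` P) $ i"
    by (simp add: S6_act_nth[OF j] w222_def)
qed

lemma S6_act_w33:
  assumes "\<sigma> permutes {1..6}"
  shows "S6_act (inv \<sigma>) (w33 J) = w33 (\<sigma> ` J)"
proof (subst vec_eq_iff, intro allI)
  fix i
  obtain j where j: "part (idx j) = (\<lambda>I. inv \<sigma> ` I) ` part (idx i)"
    using S6_ex[OF permutes_inv[OF assms]] by metis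
  have inj: "inj \<sigma>" using permutes_inj[OF assms] .
  have "\<sigma> ` inv \<sigma> ` I = I" for I using permutes_surj[OF assms] by (simp add: image_f_inv_f)
  then have "part (idx i) = (\<lambda>I. \<sigma> ` I) ` part (idx j)" unfolding j by (simp add: image_image)
  moreover have "\<sigma> ` I \<inter> \<sigma> ` J = {} \<longleftrightarrow> I \<inter> J = {}" "\<sigma> ` I \<subseteq> \<sigma> ` J \<longleftrightarrow> I \<subseteq> J" for I
    using inj by (simp_all add: inj_image_subset_iff flip: image_Int)
  ultimately show "S6_act (inv \<sigma>) (w33 J) $ i = w33 (\<sigma> ` J) $ i"
    by (simp add: S6_act_nth[OF j] w33_def)
qed

lemma phi_of_vecf:
  "phi_of M = vecf (\<lambda>n. case pair_partitions ! n of ((a,b),(c,d),(e,f)) \<Rightarrow> M a b * M c d * M e f)"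
proof (subst vec_eq_iff, intro allI)
  fix i
  obtain a b c d e f where p: "pair_partitions ! (idx i - 1) = ((a,b),(c,d),(e,f))"
    by (metis surj_pair)
  have "idx i - 1 < length pair_partitions"
    using idx_minus_1_less[of i] by (simp add: pair_partitions_def)
  then have "((a,b),(c,d),(e,f)) \<in> set pair_partitions" using p nth_mem by metis
  note pp = pair_partitions_pairs[OF this]
  have "{a,b} \<noteq> {c,d}" "{a,b} \<noteq> {e,f}" "{c,d} \<noteq> {e,f}" using pp(4) by (auto simp: doubleton_eq_iff)
  then show "phi_of M $ i = vecf (\<lambda>n. case pair_partitions ! n of ((a,b),(c,d),(e,f)) \<Rightarrow> M a b * M c d * M e f) $ i"
    using pp p by (simp add: phi_of_def vecf_def part_def min_def max_def)
qed

lemma all_less_15: "(\<forall>n<15. P n) \<longleftrightarrow> P 0 \<and> P 1 \<and> P 2 \<and> P 3 \<and> P 4 \<and> P 5 \<and> P 6 \<and> P 7 \<and> P 8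
    \<and> P 9 \<and> P 10 \<and> P 11 \<and> P 12 \<and> P 13 \<and> P (14::nat)"
  by (auto simp: eval_nat_numeral All_less_Suc)

lemma scaleR_vecf: "c *\<^sub>R vecf f = vecf (\<lambda>n. c * f n)"
  by (simp add: vecf_def vec_eq_iff)

text \<open>The divisor 8 collects the three factors 1/2 of the mixed areas of segments.\<close>

lemma PhiU_standard_222:
  assumes "u 2 = s2 *\<^sub>R u 1" "u 4 = s4 *\<^sub>R u 3" "u 6 = s6 *\<^sub>R u 5"
  shows "PhiU u = (\<bar>s2\<bar> * \<bar>s4\<bar> * \<bar>s6\<bar> * \<bar>det2 (u 1) (u 3)\<bar> * \<bar>det2 (u 1) (u 5)\<bar> * \<bar>det2 (u 3) (u 5)\<bar> / 8)
     *\<^sub>R w222 (part0 0)"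
  unfolding PhiU_eq_phi_of phi_of_vecf w222_part0[of 0, simplified] lvec_def scaleR_vecf vecf_eq_iff all_less_15
  using assms by (simp add: pair_partitions_def gens_def det2_scaleR det2_self abs_mult)

lemma PhiU_standard_33:
  assumes "u 2 = s2 *\<^sub>R u 1" "u 3 = s3 *\<^sub>R u 1" "u 5 = s5 *\<^sub>R u 4" "u 6 = s6 *\<^sub>R u 4"
  shows "PhiU u = (\<bar>s2\<bar> * \<bar>s3\<bar> * \<bar>s5\<bar> * \<bar>s6\<bar> * \<bar>det2 (u 1) (u 4)\<bar> ^ 3 / 8) *\<^sub>R w33 {1,2,3}"
proof -
  have "w33 {1,2,3} = lvec (gens ! 15)" using w33_triple[of 0] by (simp add: triples_def)
  then show ?thesis
    unfolding PhiU_eq_phi_of phi_of_vecf lvec_def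
    using assms
    by (simp only: scaleR_vecf vecf_eq_iff all_less_15)
      (simp add: pair_partitions_def gens_def det2_scaleR det2_self abs_mult power3_eq_cube)
qed

lemma ex_permutation:
  assumes "distinct [a,b,c,d,e,f]" "{a,b,c,d,e,f} = {1..6::nat}"
  obtains \<sigma> where "\<sigma> permutes {1..6}" "\<sigma> 1 = a" "\<sigma> 2 = b" "\<sigma> 3 = c" "\<sigma> 4 = d" "\<sigma> 5 = e" "\<sigma> 6 = f"
proof -
  define \<sigma> where "\<sigma> n = (if n = 1 then a else if n = 2 then b else if n = 3 then c else if n = 4 then d
    else if n = 5 then e else if n = 6 then f else n)" for n
  have 6: "{1..6::nat} = {1,2,3,4,5,6}" by auto
  have "\<sigma> ` {1,2,3,4,5,6} = {a,b,c,d,e,f}" by (auto simp: \<sigma>_def)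
  then have im: "\<sigma> ` {1..6} = {1..6}" unfolding 6[symmetric] assms(2) .
  then have "inj_on \<sigma> {1..6}" by (intro eq_card_imp_inj_on) auto
  then have "\<sigma> permutes {1..6}"
    using im by (intro bij_imp_permutes) (auto simp: bij_betw_def \<sigma>_def)
  then show ?thesis using that by (simp add: \<sigma>_def)
qed

text \<open>A permutation brings the pairs into the standard position 12, 34, 56, where the
  coordinates are computed outright; equivariance of \<open>w222\<close> carries the result
  back.\<close>

lemma PhiU_222:
  assumes abc: "distinct [a,b,c,d,e,f]" "{a,b,c,d,e,f} = {1..6::nat}"
    and nz: "\<And>i. i \<in> {1..6} \<Longrightarrow> u i \<noteq> 0"
    and par: "det2 (u a) (u b) = 0" "det2 (u c) (u d) = 0" "det2 (u e) (u f) = 0"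
    and npar: "det2 (u a) (u c) \<noteq> 0" "det2 (u a) (u e) \<noteq> 0" "det2 (u c) (u e) \<noteq> 0"
  shows "\<exists>r>0. PhiU u = r *\<^sub>R w222 {{a,b},{c,d},{e,f}}"
proof -
  obtain \<sigma> where \<sigma>: "\<sigma> permutes {1..6}" "\<sigma> 1 = a" "\<sigma> 2 = b" "\<sigma> 3 = c" "\<sigma> 4 = d" "\<sigma> 5 = e" "\<sigma> 6 = f"
    using ex_permutation[OF abc] by metis
  have nz6: "u a \<noteq> 0" "u b \<noteq> 0" "u c \<noteq> 0" "u d \<noteq> 0" "u e \<noteq> 0" "u f \<noteq> 0"
    using nz abc(2) by blast+
  obtain s2 s4 s6 where s: "u b = s2 *\<^sub>R u a" "u d = s4 *\<^sub>R u c" "u f = s6 *\<^sub>R u e"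
    using det2_eq_0_multiple[OF par(1) nz6(1)] det2_eq_0_multiple[OF par(2) nz6(3)]
      det2_eq_0_multiple[OF par(3) nz6(5)] by metis
  have s0: "s2 \<noteq> 0" "s4 \<noteq> 0" "s6 \<noteq> 0" using s nz6 by auto
  define r where "r = \<bar>s2\<bar> * \<bar>s4\<bar> * \<bar>s6\<bar> * \<bar>det2 (u a) (u c)\<bar> * \<bar>det2 (u a) (u e)\<bar> * \<bar>det2 (u c) (u e)\<bar> / 8"
  have r: "0 < r" using s0 npar by (simp add: r_def)
  have "PhiU (u \<circ> \<sigma>) = r *\<^sub>R w222 (part0 0)"
    using PhiU_standard_222[of "u \<circ> \<sigma>" s2 s4 s6] s unfolding r_def comp_apply \<sigma>(2-7) by blast
  then have "S6_act (inv \<sigma>) (S6_act \<sigma> (PhiU u)) = S6_act (inv \<sigma>) (r *\<^sub>R w222 (part0 0))"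
    by (simp add: S6_act_PhiU[OF \<sigma>(1)])
  then have "PhiU u = r *\<^sub>R w222 ((\<lambda>I. \<sigma> ` I) ` part0 0)"
    by (simp add: S6_act_inv[OF \<sigma>(1)] linear_cmul[OF linear_S6_act] S6_act_w222[OF \<sigma>(1)])
  moreover have "(\<lambda>I. \<sigma> ` I) ` part0 0 = {{a,b},{c,d},{e,f}}"
    using \<sigma> \<sigma>(2)[unfolded One_nat_def] by (simp add: part0_def part_list_def pair_partitions_def)
  ultimately show ?thesis using r by auto
qed

lemma PhiU_33:
  assumes abc: "distinct [a,b,c,d,e,f]" "{a,b,c,d,e,f} = {1..6::nat}"
    and nz: "\<And>i. i \<in> {1..6} \<Longrightarrow> u i \<noteq> 0"
    and par: "det2 (u a) (u b) = 0" "det2 (u a) (u c) = 0" "det2 (u d) (u e) = 0" "det2 (u d) (u f) = 0"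
    and npar: "det2 (u a) (u d) \<noteq> 0"
  shows "\<exists>r>0. PhiU u = r *\<^sub>R w33 {a,b,c}"
proof -
  obtain \<sigma> where \<sigma>: "\<sigma> permutes {1..6}" "\<sigma> 1 = a" "\<sigma> 2 = b" "\<sigma> 3 = c" "\<sigma> 4 = d" "\<sigma> 5 = e" "\<sigma> 6 = f"
    using ex_permutation[OF abc] by metis
  have nz6: "u a \<noteq> 0" "u b \<noteq> 0" "u c \<noteq> 0" "u d \<noteq> 0" "u e \<noteq> 0" "u f \<noteq> 0"
    using nz abc(2) by blast+
  obtain s2 s3 s5 s6 where s: "u b = s2 *\<^sub>R u a" "u c = s3 *\<^sub>R u a" "u e = s5 *\<^sub>R u d" "u f = s6 *\<^sub>R u d"
    using det2_eq_0_multiple[OF par(1) nz6(1)] det2_eq_0_multiple[OF par(2) nz6(1)]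
      det2_eq_0_multiple[OF par(3) nz6(4)] det2_eq_0_multiple[OF par(4) nz6(4)] by metis
  have s0: "s2 \<noteq> 0" "s3 \<noteq> 0" "s5 \<noteq> 0" "s6 \<noteq> 0" using s nz6 by auto
  define r where "r = \<bar>s2\<bar> * \<bar>s3\<bar> * \<bar>s5\<bar> * \<bar>s6\<bar> * \<bar>det2 (u a) (u d)\<bar> ^ 3 / 8"
  have r: "0 < r" using s0 npar by (simp add: r_def)
  have "PhiU (u \<circ> \<sigma>) = r *\<^sub>R w33 {1,2,3}"
    using PhiU_standard_33[of "u \<circ> \<sigma>" s2 s3 s5 s6] s unfolding r_def comp_apply \<sigma>(2-7) by blast
  then have "S6_act (inv \<sigma>) (S6_act \<sigma> (PhiU u)) = S6_act (inv \<sigma>) (r *\<^sub>R w33 {1,2,3})"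
    by (simp add: S6_act_PhiU[OF \<sigma>(1)])
  then have "PhiU u = r *\<^sub>R w33 (\<sigma> ` {1,2,3})"
    by (simp add: S6_act_inv[OF \<sigma>(1)] linear_cmul[OF linear_S6_act] S6_act_w33[OF \<sigma>(1)])
  moreover have "\<sigma> ` {1,2,3} = {a,b,c}" unfolding image_insert image_empty \<sigma>(2-7) ..
  ultimately show ?thesis using r by auto
qed

lemma ray_of_scale: "0 < r \<Longrightarrow> ray_of (r *\<^sub>R v) = ray_of v"
proof -
  assume r: "0 < r"
  have "\<exists>c'. c *\<^sub>R v = c' *\<^sub>R (r *\<^sub>R v) \<and> 0 \<le> c'" if "0 \<le> c" for c
    using r that by (intro exI[of _ "c / r"]) simp
  moreover have "\<exists>c'. c *\<^sub>R (r *\<^sub>R v) = c' *\<^sub>R v \<and> 0 \<le> c'" if "0 \<le> c" for c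
    using r that by (intro exI[of _ "c * r"]) simp
  ultimately show ?thesis unfolding ray_of_def by blast
qed

lemma pair_partition_index:
  assumes "distinct [a,b,c,d,e,f]" "{a,b,c,d,e,f} = {1..6::nat}"
  shows "\<exists>k<15. {{a,b},{c,d},{e,f}} = part0 k"
proof -
  obtain \<sigma> where \<sigma>: "\<sigma> permutes {1..6}" "\<sigma> 1 = a" "\<sigma> 2 = b" "\<sigma> 3 = c" "\<sigma> 4 = d" "\<sigma> 5 = e" "\<sigma> 6 = f"
    using ex_permutation[OF assms] by metis
  have "(\<lambda>I. \<sigma> ` I) ` part0 0 = {{a,b},{c,d},{e,f}}"
    using \<sigma> \<sigma>(2)[unfolded One_nat_def] by (simp add: part0_def part_list_def pair_partitions_def)
  then show ?thesis using part0_image[OF \<sigma>(1), of 0] by auto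
qed

lemma rays222_eq: "rays222 = (\<lambda>k. ray_of (lvec (gens ! k))) ` {..<15}"
proof (intro set_eqI iffI)
  fix R assume "R \<in> rays222"
  then obtain u where u: "R = ray_of (PhiU u)" "type222 u" by (auto simp: rays222_def)
  then obtain I1 I2 I3 where I: "I1 \<union> I2 \<union> I3 = {1..6}" "I1 \<inter> I2 = {}" "I1 \<inter> I3 = {}" "I2 \<inter> I3 = {}"
    "card I1 = 2" "card I2 = 2" "card I3 = 2"
    "\<forall>r\<in>{I1,I2,I3}. \<forall>i\<in>r. \<forall>j\<in>r. det2 (u i) (u j) = 0"
    "\<forall>r\<in>{I1,I2,I3}. \<forall>s\<in>{I1,I2,I3}. r \<noteq> s \<longrightarrow> (\<forall>i\<in>r. \<forall>j\<in>s. det2 (u i) (u j) \<noteq> 0)"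
    and nz: "\<forall>i\<in>{1..6}. u i \<noteq> 0"
    unfolding type222_def par2_iff_det2 by (elim conjE exE) (rule that)
  obtain a b c d e f where ab: "I1 = {a,b}" "a \<noteq> b" "I2 = {c,d}" "c \<noteq> d" "I3 = {e,f}" "e \<noteq> f"
    using I(5-7) unfolding card_2_iff by metis
  have dis: "distinct [a,b,c,d,e,f]" using ab I(2-4) by auto
  have un: "{a,b,c,d,e,f} = {1..6}"
    using I(1) unfolding ab(1,3,5) by (simp only: Un_insert_left Un_empty_left)
  have par: "det2 (u a) (u b) = 0" "det2 (u c) (u d) = 0" "det2 (u e) (u f) = 0"
    using I(8) ab by auto
  have ne: "I1 \<noteq> I2" "I1 \<noteq> I3" "I2 \<noteq> I3" using I(2-4) ab by auto
  have npar: "det2 (u a) (u c) \<noteq> 0" "det2 (u a) (u e) \<noteq> 0" "det2 (u c) (u e) \<noteq> 0"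
    using I(9) ne ab by auto
  obtain r where r: "0 < r" "PhiU u = r *\<^sub>R w222 {{a,b},{c,d},{e,f}}"
    using PhiU_222[OF dis un _ par npar] nz by blast
  obtain k where "k < 15" "{{a,b},{c,d},{e,f}} = part0 k"
    using pair_partition_index[OF dis un] by blast
  then show "R \<in> (\<lambda>k. ray_of (lvec (gens ! k))) ` {..<15}"
    using u(1) r w222_part0[of k] by (auto simp: ray_of_scale)
next
  fix R assume "R \<in> (\<lambda>k. ray_of (lvec (gens ! k))) ` {..<15}"
  then obtain k where k: "k < 15" "R = ray_of (lvec (gens ! k))" by auto
  obtain a b c d e f where p: "part (k + 1) = {{a,b},{c,d},{e,f}}"
    "distinct [a,b,c,d,e,f]" "{a,b,c,d,e,f} = {1..6}"
    using part_pairs[of "k + 1"] k(1)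
    by (metis Suc_eq_plus1 Suc_leI add_leD2 atLeastAtMost_iff le_add2)
  have pk: "part0 k = {{a,b},{c,d},{e,f}}"
  proof -
    have "part (k + 1) = part0 k"
      by (auto simp: part_def part0_def part_list_def split: prod.split)
    then show ?thesis using p(1) by simp
  qed
  define u :: "nat \<Rightarrow> real^2" where
    "u n = (if n \<in> {a,b} then vector [1,0] else if n \<in> {c,d} then vector [0,1] else vector [1,1])" for n
  have v: "u a = vector [1,0]" "u b = vector [1,0]" "u c = vector [0,1]" "u d = vector [0,1]"
    "u e = vector [1,1]" "u f = vector [1,1]" using p(2) by (auto simp: u_def)
  have nz: "u i \<noteq> 0" for i by (auto simp: u_def vec_eq_iff forall_2)
  have "type222 u"
    unfolding type222_def par2_iff_det2
  proof (rule conjI, use nz in blast, rule exI[of _ "{a,b}"], rule exI[of _ "{c,d}"], rule exI[of _ "{e,f}"], intro conjI)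
    show "{a,b} \<union> {c,d} \<union> {e,f} = {1..6}" using p(3) by auto
  qed (use p(2) v in \<open>auto simp: det2_def\<close>)
  moreover obtain r where "0 < r" "PhiU u = r *\<^sub>R w222 {{a,b},{c,d},{e,f}}"
    using PhiU_222[OF p(2,3), of u] nz by (auto simp: v det2_def)
  ultimately show "R \<in> rays222"
    unfolding rays222_def using k w222_part0[OF k(1)] pk
    by (intro CollectI exI[of _ u]) (simp add: ray_of_scale)
qed

lemma triples_check:
  "list_all (\<lambda>x. list_all (\<lambda>y. x \<noteq> y \<longrightarrow> (\<exists>k\<in>set [0..<10]. set (triples ! k) = {1,x,y})) [2..<7]) [2..<7]"
  by code_simp

lemma triple_index:
  assumes "J \<subseteq> {1..6}" "1 \<in> J" "card J = 3"
  shows "\<exists>k<10. J = set (triples ! k)"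
proof -
  have "card (J - {1}) = 2" using assms by simp
  then obtain x y where xy: "J - {1} = {x,y}" "x \<noteq> y" unfolding card_2_iff by auto
  have J: "J = {1,x,y}" using xy assms(2) by auto
  have "x \<in> {1..6} - {1}" "y \<in> {1..6} - {1}" using xy assms(1) by auto
  then have "x \<in> set [2..<7]" "y \<in> set [2..<7]" by auto
  then have "\<exists>k\<in>set [0..<10]. set (triples ! k) = {1,x,y}"
    using triples_check xy(2) unfolding list_all_iff by blast
  then show ?thesis unfolding J by (metis atLeastLessThan_iff atLeastLessThan_upt)
qed

lemma type33_split:
  assumes "type33 u"
  obtains J1 J2 where "J1 \<union> J2 = {1..6}" "J1 \<inter> J2 = {}" "card J1 = 3" "card J2 = 3" "1 \<in> J1"
    "\<forall>i\<in>J1. \<forall>j\<in>J1. det2 (u i) (u j) = 0" "\<forall>i\<in>J2. \<forall>j\<in>J2. det2 (u i) (u j) = 0"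
    "\<forall>i\<in>J1. \<forall>j\<in>J2. det2 (u i) (u j) \<noteq> 0"
proof -
  obtain J1 J2 where J: "J1 \<union> J2 = {1..6}" "J1 \<inter> J2 = {}" "card J1 = 3" "card J2 = 3"
    "\<forall>i\<in>J1. \<forall>j\<in>J1. det2 (u i) (u j) = 0" "\<forall>i\<in>J2. \<forall>j\<in>J2. det2 (u i) (u j) = 0"
    "\<forall>i\<in>J1. \<forall>j\<in>J2. det2 (u i) (u j) \<noteq> 0"
    using assms unfolding type33_def par2_iff_det2 by (elim conjE exE) (rule that)
  show ?thesis
  proof (cases "1 \<in> J1")
    case True
    then show ?thesis using J by (intro that[of J1 J2]) auto
  next
    case False
    have "1 \<in> J1 \<union> J2" unfolding J(1) by simp
    then have "1 \<in> J2" using False by blast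
    moreover have "\<forall>i\<in>J2. \<forall>j\<in>J1. det2 (u i) (u j) \<noteq> 0"
      using J(7) by (metis det2_swap neg_equal_0_iff_equal)
    moreover have "J2 \<union> J1 = {1..6}" "J2 \<inter> J1 = {}" using J(1,2) by auto
    ultimately show ?thesis using J(3-6) by (intro that[of J2 J1]) auto
  qed
qed

lemma rays33_eq: "rays33 = (\<lambda>k. ray_of (lvec (gens ! (15 + k)))) ` {..<10}"
proof (intro set_eqI iffI)
  fix R assume "R \<in> rays33"
  then obtain u where u: "R = ray_of (PhiU u)" "type33 u" by (auto simp: rays33_def)
  obtain J1 J2 where J: "J1 \<union> J2 = {1..6}" "J1 \<inter> J2 = {}" "card J1 = 3" "card J2 = 3" "1 \<in> J1"
    "\<forall>i\<in>J1. \<forall>j\<in>J1. det2 (u i) (u j) = 0" "\<forall>i\<in>J2. \<forall>j\<in>J2. det2 (u i) (u j) = 0"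
    "\<forall>i\<in>J1. \<forall>j\<in>J2. det2 (u i) (u j) \<noteq> 0"
    by (rule type33_split[OF u(2)])
  have nz: "\<forall>i\<in>{1..6}. u i \<noteq> 0" using u(2) by (simp add: type33_def)
  obtain a b c where abc: "J1 = {a,b,c}" "a \<noteq> b" "a \<noteq> c" "b \<noteq> c"
    using J(3) unfolding card_3_iff by metis
  obtain d e f where def: "J2 = {d,e,f}" "d \<noteq> e" "d \<noteq> f" "e \<noteq> f"
    using J(4) unfolding card_3_iff by metis
  have dis: "distinct [a,b,c,d,e,f]" using abc def J(2) by auto
  have un: "{a,b,c,d,e,f} = {1..6}"
    using J(1) unfolding abc(1) def(1) by (simp only: Un_insert_left Un_empty_left)
  have par: "det2 (u a) (u b) = 0" "det2 (u a) (u c) = 0" "det2 (u d) (u e) = 0" "det2 (u d) (u f) = 0"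
    and npar: "det2 (u a) (u d) \<noteq> 0"
    using J(6-8) abc(1) def(1) by auto
  obtain r where r: "0 < r" "PhiU u = r *\<^sub>R w33 {a,b,c}"
    using PhiU_33[OF dis un _ par npar] nz by blast
  obtain k where k: "k < 10" "J1 = set (triples ! k)" using triple_index[OF _ J(5,3)] J(1) by blast
  have "PhiU u = r *\<^sub>R lvec (gens ! (15 + k))" using r(2) w33_triple[OF k(1)] k(2) abc(1) by simp
  then show "R \<in> (\<lambda>k. ray_of (lvec (gens ! (15 + k)))) ` {..<10}"
    using u(1) r(1) k(1) by (auto simp: ray_of_scale)
next
  fix R assume "R \<in> (\<lambda>k. ray_of (lvec (gens ! (15 + k)))) ` {..<10}"
  then obtain k where k: "k < 10" "R = ray_of (lvec (gens ! (15 + k)))" by auto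
  define J where "J = set (triples ! k)"
  have "length triples = 10" by (simp add: triples_def)
  then have "triples ! k \<in> set triples" using k(1) by simp
  then have "card J = 3 \<and> J \<subseteq> {1..6}" unfolding J_def triples_def by auto
  then have J: "card J = 3" "J \<subseteq> {1..6}" by auto
  have J2: "card ({1..6} - J) = 3" using J by (simp add: card_Diff_subset finite_subset)
  obtain a b c where abc: "J = {a,b,c}" "a \<noteq> b" "a \<noteq> c" "b \<noteq> c"
    using J(1) unfolding card_3_iff by metis
  obtain d e f where def: "{1..6} - J = {d,e,f}" "d \<noteq> e" "d \<noteq> f" "e \<noteq> f"
    using J2 unfolding card_3_iff by metis
  have "J \<inter> {d,e,f} = {}" unfolding def(1)[symmetric] by blast
  then have dis: "distinct [a,b,c,d,e,f]" using abc def(2-4) by auto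
  have "J \<union> {d,e,f} = {1..6}" using J(2) unfolding def(1)[symmetric] by blast
  then have un: "{a,b,c,d,e,f} = {1..6}"
    unfolding abc(1) by (simp only: Un_insert_left Un_empty_left)
  define u :: "nat \<Rightarrow> real^2" where "u n = (if n \<in> J then vector [1,0] else vector [0,1])" for n
  have nz: "u i \<noteq> 0" for i by (auto simp: u_def vec_eq_iff forall_2)
  have v: "u a = vector [1,0]" "u b = vector [1,0]" "u c = vector [1,0]"
    "u d = vector [0,1]" "u e = vector [0,1]" "u f = vector [0,1]"
      using abc(1) dis by (auto simp: u_def)
  have "type33 u"
    unfolding type33_def par2_iff_det2
  proof (rule conjI, use nz in blast, rule exI[of _ J], rule exI[of _ "{1..6} - J"], intro conjI)
    show "J \<union> ({1..6} - J) = {1..6}" using J by auto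
  qed (use J J2 in \<open>auto simp: det2_def u_def\<close>)
  moreover obtain r where "0 < r" "PhiU u = r *\<^sub>R w33 {a,b,c}"
    using PhiU_33[OF dis un, of u] nz by (auto simp: v det2_def)
  ultimately show "R \<in> rays33"
    unfolding rays33_def using k w33_triple[OF k(1)] abc(1) J_def
    by (intro CollectI exI[of _ u]) (simp add: ray_of_scale)
qed

lemma gens_01_check: "list_all (\<lambda>g. list_all (\<lambda>x. x = 0 \<or> x = 1) g \<and> 1 \<in> set g) gens" "distinct gens"
  by code_simp+

lemma lvec_inject: "length xs = 15 \<Longrightarrow> length ys = 15 \<Longrightarrow> lvec xs = lvec ys \<longleftrightarrow> xs = ys"
  by (auto simp: lvec_def vecf_eq_iff list_eq_iff_nth_eq)

text \<open>Nonzero 0/1 vectors on the same ray coincide: a coordinate equal to 1 forces the factor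
  to be 1.\<close>

lemma ray_of_gens_inj: "inj_on (\<lambda>g. ray_of (lvec g)) (set gens)"
proof (rule inj_onI)
  fix g h assume gh: "g \<in> set gens" "h \<in> set gens" "ray_of (lvec g) = ray_of (lvec h)"
  have len: "length g = 15" "length h = 15" using gens_length gh by auto
  have "lvec g \<in> ray_of (lvec g)" unfolding ray_of_def by (intro CollectI exI[of _ 1]) simp
  then obtain c where c: "lvec g = c *\<^sub>R lvec h" unfolding gh(3) by (auto simp: ray_of_def)
  have "1 \<in> set g" using gens_01_check(1) gh(1) by (simp add: list_all_iff)
  then obtain n where n: "n < 15" "g ! n = 1" using len by (metis in_set_conv_nth)
  have cn: "real_of_int (g ! m) = c * real_of_int (h ! m)" if "m < 15" for m
    using c that unfolding lvec_def scaleR_vecf vecf_eq_iff by blast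
  have "h ! n = 0 \<or> h ! n = 1" using gens_01_check(1) gh(2) n(1) len(2) by (simp add: list_all_iff)
  then have "c = 1" using cn[OF n(1)] n(2) by auto
  then show "g = h" using c lvec_inject[OF len] by simp
qed

lemma card_rays: "card rays222 = 15" "card rays33 = 10"
proof -
  have nth: "inj_on ((!) gens) {..<25}"
    using gens_01_check(2) gens_length(1) by (simp add: inj_on_nth)
  have i: "inj_on (\<lambda>k. ray_of (lvec (gens ! k))) {..<25}"
  proof -
    have "(!) gens ` {..<25} \<subseteq> set gens" using gens_length(1) by auto
    then show ?thesis
      using comp_inj_on[OF nth inj_on_subset[OF ray_of_gens_inj]] by (simp add: comp_def)
  qed
  show "card rays222 = 15" unfolding rays222_eq
    using card_image[OF inj_on_subset[OF i, of "{..<15}"]] by simp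
  have "(\<lambda>k. ray_of (lvec (gens ! (15 + k)))) ` {..<10} = (\<lambda>k. ray_of (lvec (gens ! k))) ` {15..<25}"
  proof -
    have "{15..<25} = (+) 15 ` {..<10::nat}" by (simp flip: atLeast0LessThan)
    then show ?thesis by (simp add: image_image)
  qed
  moreover have "inj_on (\<lambda>k. ray_of (lvec (gens ! k))) {15..<25}" by (rule inj_on_subset[OF i]) auto
  ultimately show "card rays33 = 10" unfolding rays33_eq using card_image by fastforce
qed

lemma ray_of_subset_cone: "v \<in> K \<Longrightarrow> convex_cone K \<Longrightarrow> ray_of v \<subseteq> K"
  unfolding ray_of_def using convex_cone_scaleR by auto

lemma rays_eq: "rays33 \<union> rays222 = (\<lambda>g. ray_of (lvec g)) ` set gens"
proof -
  have "set gens = (!) gens ` {..<25}" using gens_length(1) by (auto simp: in_set_conv_nth)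
  also have "{..<25::nat} = (+) 15 ` {..<10} \<union> {..<15}"
    by (simp flip: atLeast0LessThan) auto
  finally have "set gens = (!) gens ` ((+) 15 ` {..<10} \<union> {..<15})" .
  then show ?thesis unfolding rays33_eq rays222_eq by (simp add: image_Un image_image)
qed

lemma hull_rays: "convex_cone hull (\<Union> (rays33 \<union> rays222)) = convex_cone hull (lvec ` set gens)"
  (is "?K = ?L")
proof
  show "?K \<subseteq> ?L"
  proof (rule hull_minimal)
    have "ray_of (lvec g) \<subseteq> ?L" if "g \<in> set gens" for g
      by (rule ray_of_subset_cone[OF hull_inc[OF imageI[OF that]] convex_cone_convex_cone_hull])
    then show "\<Union> (rays33 \<union> rays222) \<subseteq> ?L" unfolding rays_eq by blast
  qed (rule convex_cone_convex_cone_hull)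
  have "lvec g \<in> ray_of (lvec g)" for g unfolding ray_of_def by (intro CollectI exI[of _ 1]) simp
  then have "lvec ` set gens \<subseteq> \<Union> (rays33 \<union> rays222)" unfolding rays_eq by blast
  then show "?L \<subseteq> ?K" by (rule hull_mono)
qed

lemma zonoid2_segment: "zonoid2 (closed_segment 0 u)"
  unfolding zonoid2_def
proof (intro conjI exI[of _ "(1/2) *\<^sub>R u"] ballI)
  fix x assume "x \<in> closed_segment 0 u"
  then obtain t where "0 \<le> t" "t \<le> 1" "x = t *\<^sub>R u" by (auto simp: in_segment)
  then show "2 *\<^sub>R (1/2) *\<^sub>R u - x \<in> closed_segment 0 u"
    unfolding in_segment by (intro exI[of _ "1 - t"]) (auto simp: algebra_simps)
qed auto

lemma C62_eq: "C62 = convex_cone hull (lvec ` set gens)"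
proof
  show "C62 \<subseteq> convex_cone hull (lvec ` set gens)"
    unfolding C62_def
  proof (rule hull_minimal)
    show "Phi ` {Z. \<forall>i\<in>{1..6}. zonoid2 (Z i)} \<subseteq> convex_cone hull (lvec ` set gens)"
      using PhiU_in_cone_of_rays unfolding hull_rays
      by (auto intro!: Phi_zonoids_in_closed_cone convex_cone_convex_cone_hull closed_convex_cone_hull)
  qed (rule convex_cone_convex_cone_hull)
  have "PhiU u \<in> C62" for u
    unfolding PhiU_def C62_def by (intro hull_inc imageI CollectI ballI) (rule zonoid2_segment)
  then have "R \<subseteq> C62" if "R \<in> rays33 \<union> rays222" for R
    using that ray_of_subset_cone[of _ C62] convex_cone_convex_cone_hull
    by (auto simp: rays33_def rays222_def C62_def)
  then show "convex_cone hull (lvec ` set gens) \<subseteq> C62"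
    unfolding hull_rays[symmetric]
    by (intro hull_minimal) (auto simp: C62_def convex_cone_convex_cone_hull)
qed

section \<open>Double description by supports\<close>

definition lin :: "nat \<Rightarrow> (nat \<Rightarrow> real) \<Rightarrow> (nat \<Rightarrow> real) \<Rightarrow> real" where
  "lin m e y = (\<Sum>i<m. e i * y i)"

definition sol :: "nat \<Rightarrow> int list list \<Rightarrow> (nat \<Rightarrow> real) \<Rightarrow> bool" where
  "sol m E y \<longleftrightarrow> (\<forall>i<m. 0 \<le> y i) \<and> (\<forall>e\<in>set E. lin m (\<lambda>i. real_of_int (e ! i)) y = 0)"

definition rows :: "nat \<Rightarrow> int list list \<Rightarrow> int list set \<Rightarrow> bool" where
  "rows m E R \<longleftrightarrow> (\<forall>r\<in>R. length r = m \<and> (\<exists>i<m. r ! i \<noteq> 0) \<and> sol m E (\<lambda>i. real_of_int (r ! i)))"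

text \<open>Below every nonzero solution, in the order of supports, there is a row. When the rows
  are solutions themselves, repeated subtraction turns this into generation of the solution cone,
  yet it can be tested on supports alone.\<close>

definition covers :: "nat \<Rightarrow> int list list \<Rightarrow> int list set \<Rightarrow> bool" where
  "covers m E R \<longleftrightarrow> (\<forall>y. sol m E y \<longrightarrow> (\<exists>i<m. y i \<noteq> 0) \<longrightarrow>
     (\<exists>r\<in>R. (\<exists>i<m. r ! i \<noteq> 0) \<and> (\<forall>i<m. r ! i \<noteq> 0 \<longrightarrow> y i \<noteq> 0)))"

lemma lin_diff: "lin m e (\<lambda>i. y i - t * r i) = lin m e y - t * lin m e r"
  by (simp add: lin_def sum_subtractf sum_distrib_left algebra_simps)

text \<open>The ratio test of the simplex method: the smallest quotient is the largest multiple that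
  keeps all entries nonnegative, and it makes one entry vanish. No new nonzero entry appears since
  the support of r lies in that of y.\<close>

lemma subtract_until_zero:
  fixes y r :: "nat \<Rightarrow> real"
  assumes y: "\<And>i. i < m \<Longrightarrow> 0 \<le> y i" and r: "\<And>i. i < m \<Longrightarrow> 0 \<le> r i" and nz: "\<exists>i<m. r i \<noteq> 0"
    and sub: "\<And>i. i < m \<Longrightarrow> r i \<noteq> 0 \<Longrightarrow> y i \<noteq> 0"
  obtains t where "0 < t" "\<forall>i<m. 0 \<le> y i - t * r i"
    "{i. i < m \<and> y i - t * r i \<noteq> 0} \<subset> {i. i < m \<and> y i \<noteq> 0}"
proof -
  define S where "S = {i. i < m \<and> r i \<noteq> 0}"
  have S: "finite S" "S \<noteq> {}" using nz by (auto simp: S_def)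
  define t where "t = Min ((\<lambda>i. y i / r i) ` S)"
  have "t \<in> (\<lambda>i. y i / r i) ` S" unfolding t_def using S by (intro Min_in) auto
  then obtain j where j: "j \<in> S" "t = y j / r j" by auto
  have le: "t \<le> y i / r i" if "i \<in> S" for i unfolding t_def using S that by (intro Min_le) auto
  have pos: "0 < r i" "0 < y i" if "i \<in> S" for i
    using that y[of i] r[of i] sub[of i] by (auto simp: S_def)
  have t: "0 < t" using j pos[OF j(1)] by simp
  have "0 \<le> y i - t * r i" if "i < m" for i
  proof (cases "i \<in> S")
    case True
    then show ?thesis using le[OF True] pos[OF True] by (simp add: field_simps)
  next
    case False
    then show ?thesis using that y by (simp add: S_def)
  qed
  moreover have "{i. i < m \<and> y i - t * r i \<noteq> 0} \<subset> {i. i < m \<and> y i \<noteq> 0}"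
  proof (rule psubsetI)
    show "{i. i < m \<and> y i - t * r i \<noteq> 0} \<subseteq> {i. i < m \<and> y i \<noteq> 0}" using sub by force
    have "j \<in> {i. i < m \<and> y i \<noteq> 0}" "j \<notin> {i. i < m \<and> y i - t * r i \<noteq> 0}"
      using j pos[OF j(1)] by (auto simp: S_def)
    then show "{i. i < m \<and> y i - t * r i \<noteq> 0} \<noteq> {i. i < m \<and> y i \<noteq> 0}" by blast
  qed
  ultimately show ?thesis by (intro that[OF t]) auto
qed

lemma covers_subtract:
  assumes cov: "covers m E R" and rows: "rows m E R" and y: "sol m E y" "\<exists>i<m. y i \<noteq> 0"
  obtains r t where "r \<in> R" "\<forall>i<m. r ! i \<noteq> 0 \<longrightarrow> y i \<noteq> 0" "0 < t"
    "sol m E (\<lambda>i. y i - t * real_of_int (r ! i))"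
    "{i. i < m \<and> y i - t * real_of_int (r ! i) \<noteq> 0} \<subset> {i. i < m \<and> y i \<noteq> 0}"
proof -
  obtain r where r: "r \<in> R" "\<exists>i<m. r ! i \<noteq> 0" "\<forall>i<m. r ! i \<noteq> 0 \<longrightarrow> y i \<noteq> 0"
    using cov y unfolding covers_def by blast
  have sr: "sol m E (\<lambda>i. real_of_int (r ! i))" using rows r(1) by (simp add: rows_def)
  have y0: "0 \<le> y i" and r0: "0 \<le> real_of_int (r ! i)" if "i < m" for i
    using y(1) sr that by (auto simp: sol_def)
  have rnz: "\<exists>i<m. real_of_int (r ! i) \<noteq> 0" using r(2) by simp
  have rs: "y i \<noteq> 0" if "i < m" "real_of_int (r ! i) \<noteq> 0" for i using r(3) that by simp
  obtain t where t: "0 < t" "\<forall>i<m. 0 \<le> y i - t * real_of_int (r ! i)"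
    "{i. i < m \<and> y i - t * real_of_int (r ! i) \<noteq> 0} \<subset> {i. i < m \<and> y i \<noteq> 0}"
    by (rule subtract_until_zero[OF y0 r0 rnz rs])
  have "sol m E (\<lambda>i. y i - t * real_of_int (r ! i))"
    using t(2) y(1) sr by (simp add: sol_def lin_diff)
  then show ?thesis by (rule that[OF r(1,3) t(1) _ t(3)])
qed

text \<open>Subtracting a row on which e is nonnegative keeps the value at y negative and shrinks
  the support. As the zero vector has value 0, a row with negative value must be met on the
  way.\<close>

lemma covers_negative:
  assumes cov: "covers m E R" and rows: "rows m E R"
  shows "sol m E y \<Longrightarrow> lin m e y < 0 \<Longrightarrow>
    \<exists>r\<in>R. lin m e (\<lambda>i. real_of_int (r ! i)) < 0 \<and> (\<forall>i<m. r ! i \<noteq> 0 \<longrightarrow> y i \<noteq> 0)"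
proof (induction "card {i. i < m \<and> y i \<noteq> 0}" arbitrary: y rule: less_induct)
  case less
  have nz: "\<exists>i<m. y i \<noteq> 0"
  proof (rule ccontr)
    assume "\<not> ?thesis"
    then have "lin m e y = 0" by (simp add: lin_def)
    then show False using less.prems by simp
  qed
  obtain r t where r: "r \<in> R" "\<forall>i<m. r ! i \<noteq> 0 \<longrightarrow> y i \<noteq> 0" "0 < t"
    "sol m E (\<lambda>i. y i - t * real_of_int (r ! i))"
    "{i. i < m \<and> y i - t * real_of_int (r ! i) \<noteq> 0} \<subset> {i. i < m \<and> y i \<noteq> 0}"
    by (rule covers_subtract[OF cov rows less.prems(1) nz])
  show ?case
  proof (cases "lin m e (\<lambda>i. real_of_int (r ! i)) < 0")
    case True
    then show ?thesis using r(1,2) by blast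
  next
    case False
    have neg: "lin m e (\<lambda>i. y i - t * real_of_int (r ! i)) < 0"
      unfolding lin_diff using less.prems(2) False r(3) by (smt (verit) mult_nonneg_nonneg)
    have card: "card {i. i < m \<and> y i - t * real_of_int (r ! i) \<noteq> 0} < card {i. i < m \<and> y i \<noteq> 0}"
      using r(5) by (intro psubset_card_mono) auto
    obtain r' where "r' \<in> R" "lin m e (\<lambda>i. real_of_int (r' ! i)) < 0"
      "\<forall>i<m. r' ! i \<noteq> 0 \<longrightarrow> y i - t * real_of_int (r ! i) \<noteq> 0"
      using less.hyps[OF card r(4) neg] by blast
    then show ?thesis using r(2,5) by (intro bexI[of _ r']) auto
  qed
qed

lemma covers_positive:
  assumes "covers m E R" "rows m E R" "sol m E y" "0 < lin m e y"
  shows "\<exists>r\<in>R. 0 < lin m e (\<lambda>i. real_of_int (r ! i)) \<and> (\<forall>i<m. r ! i \<noteq> 0 \<longrightarrow> y i \<noteq> 0)"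
proof -
  have "lin m (\<lambda>i. - e i) y = - lin m e y" for y by (simp add: lin_def sum_negf)
  then show ?thesis using covers_negative[OF assms(1-3), of "\<lambda>i. - e i"] assms(4) by simp
qed

definition dotl :: "int list \<Rightarrow> int list \<Rightarrow> int" where
  "dotl xs ys = sum_list (map2 (*) xs ys)"

lemma dotl_eq_sum:
  assumes "length xs = m" "length ys = m"
  shows "dotl xs ys = (\<Sum>i<m. xs ! i * ys ! i)"
  using assms by (simp add: dotl_def sum_list_sum_nth atLeast0LessThan)

lemma lin_dotl:
  assumes "length e = m" "length r = m"
  shows "lin m (\<lambda>i. real_of_int (e ! i)) (\<lambda>i. real_of_int (r ! i)) = real_of_int (dotl e r)"
  using dotl_eq_sum[OF assms] by (simp add: lin_def)

text \<open>For p on the positive and q on the negative side of the hyperplane of e, both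
  coefficients are positive, and the result lies on the hyperplane.\<close>

definition combine :: "int list \<Rightarrow> int list \<Rightarrow> int list \<Rightarrow> int list" where
  "combine e p q = (let a = dotl e p; b = - dotl e q in map2 (\<lambda>x y. b * x + a * y) p q)"

definition dd_step :: "int list \<Rightarrow> int list set \<Rightarrow> int list set" where
  "dd_step e R = {r \<in> R. dotl e r = 0} \<union>
     {combine e p q | p q. p \<in> R \<and> 0 < dotl e p \<and> q \<in> R \<and> dotl e q < 0}"

text \<open>Simplification takes time proportional to the size of the rewritten term, hence binary trees
  whose rows carry their supports as bit strings. A leaf \<open>Leaf c p q\<close> with nonempty \<open>q\<close> stands for
  the combination of \<open>p\<close> and \<open>q\<close>, which is computed only if it survives.\<close>

datatype bits = BNil | B0 bits | B1 bits

datatype rowtree = Tip | Leaf bits "int list" "int list" | Fork rowtree rowtree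

fun bits_le :: "bits \<Rightarrow> bits \<Rightarrow> bool" where
  "bits_le BNil BNil = True"
| "bits_le (B0 s) (B0 r) = bits_le s r"
| "bits_le (B0 s) (B1 r) = bits_le s r"
| "bits_le (B1 s) (B1 r) = bits_le s r"
| "bits_le s r = False"

fun bits_or :: "bits \<Rightarrow> bits \<Rightarrow> bits" where
  "bits_or (B0 s) (B0 r) = B0 (bits_or s r)"
| "bits_or (B0 s) (B1 r) = B1 (bits_or s r)"
| "bits_or (B1 s) (B0 r) = B1 (bits_or s r)"
| "bits_or (B1 s) (B1 r) = B1 (bits_or s r)"
| "bits_or s r = BNil"

fun support :: "int list \<Rightarrow> bits" where
  "support [] = BNil"
| "support (x # xs) = (if x = 0 then B0 (support xs) else B1 (support xs))"

fun fork :: "rowtree \<Rightarrow> rowtree \<Rightarrow> rowtree" where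
  "fork Tip t = t"
| "fork s Tip = s"
| "fork s t = Fork s t"

fun below :: "rowtree \<Rightarrow> bits \<Rightarrow> bool" where
  "below Tip b = False"
| "below (Leaf c p q) b = bits_le c b"
| "below (Fork s t) b = (below s b \<or> below t b)"

fun remove_above :: "rowtree \<Rightarrow> rowtree \<Rightarrow> rowtree" where
  "remove_above A Tip = Tip"
| "remove_above A (Leaf c p q) = (if below A c then Tip else Leaf c p q)"
| "remove_above A (Fork s t) = fork (remove_above A s) (remove_above A t)"

text \<open>The two halves are filtered one after the other, the second against the first and then
  the first against what is left. Hence one of two rows with equal supports survives.\<close>

fun prune :: "rowtree \<Rightarrow> rowtree" where
  "prune Tip = Tip"
| "prune (Leaf c p q) = Leaf c p q"
| "prune (Fork s t) = (let A = prune s; B = remove_above A (prune t) in fork (remove_above B A) B)"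

fun zeros :: "int list \<Rightarrow> rowtree \<Rightarrow> rowtree" where
  "zeros e Tip = Tip"
| "zeros e (Leaf c p q) = (if dotl e p = 0 then Leaf c p q else Tip)"
| "zeros e (Fork s t) = fork (zeros e s) (zeros e t)"

fun positives :: "int list \<Rightarrow> rowtree \<Rightarrow> rowtree" where
  "positives e Tip = Tip"
| "positives e (Leaf c p q) = (if 0 < dotl e p then Leaf c p q else Tip)"
| "positives e (Fork s t) = fork (positives e s) (positives e t)"

fun negatives :: "int list \<Rightarrow> rowtree \<Rightarrow> rowtree" where
  "negatives e Tip = Tip"
| "negatives e (Leaf c p q) = (if dotl e p < 0 then Leaf c p q else Tip)"
| "negatives e (Fork s t) = fork (negatives e s) (negatives e t)"

fun mix_row :: "bits \<Rightarrow> int list \<Rightarrow> rowtree \<Rightarrow> rowtree" where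
  "mix_row c p Tip = Tip"
| "mix_row c p (Leaf c' p' q') = Leaf (bits_or c c') p p'"
| "mix_row c p (Fork s t) = Fork (mix_row c p s) (mix_row c p t)"

fun mix :: "rowtree \<Rightarrow> rowtree \<Rightarrow> rowtree" where
  "mix Tip N = Tip"
| "mix (Leaf c p q) N = mix_row c p N"
| "mix (Fork s t) N = Fork (mix s N) (mix t N)"

definition candidates :: "int list \<Rightarrow> rowtree \<Rightarrow> rowtree" where
  "candidates e t = fork (zeros e t) (mix (positives e t) (negatives e t))"

definition leaf_row :: "int list \<Rightarrow> int list \<Rightarrow> int list \<Rightarrow> int list" where
  "leaf_row e p q = (case q of [] \<Rightarrow> p | _ # _ \<Rightarrow> combine e p q)"

fun finish :: "int list \<Rightarrow> rowtree \<Rightarrow> rowtree" where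
  "finish e Tip = Tip"
| "finish e (Leaf c p q) = Leaf c (leaf_row e p q) []"
| "finish e (Fork s t) = Fork (finish e s) (finish e t)"

text \<open>Exchanging the subtrees at every insertion keeps the tree balanced, as in Braun
  trees.\<close>

fun insert_row :: "int list \<Rightarrow> rowtree \<Rightarrow> rowtree" where
  "insert_row r Tip = Leaf (support r) r []"
| "insert_row r (Leaf c p q) = Fork (Leaf (support r) r []) (Leaf c p q)"
| "insert_row r (Fork s t) = Fork (insert_row r t) s"

fun tree_of :: "int list list \<Rightarrow> rowtree" where
  "tree_of [] = Tip"
| "tree_of (r # rs) = insert_row r (tree_of rs)"

definition units :: "nat \<Rightarrow> int list list" where
  "units m = map (\<lambda>i. map (\<lambda>j. if i = j then 1 else 0) [0..<m]) [0..<m]"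

fun dd :: "nat \<Rightarrow> int list list \<Rightarrow> rowtree" where
  "dd m [] = tree_of (units m)"
| "dd m (e # E) = finish e (prune (candidates e (dd m E)))"

text \<open>After the last equation the candidates are only compared with given supports, so they
  are neither pruned nor turned into rows.\<close>

fun last_candidates :: "nat \<Rightarrow> int list list \<Rightarrow> rowtree" where
  "last_candidates m [] = tree_of (units m)"
| "last_candidates m (e # E) = candidates e (dd m E)"

fun dominated :: "rowtree \<Rightarrow> rowtree \<Rightarrow> bool" where
  "dominated S Tip = True"
| "dominated S (Leaf c p q) = below S c"
| "dominated S (Fork s t) = (dominated S s \<and> dominated S t)"

fun leaves :: "rowtree \<Rightarrow> (bits \<times> int list \<times> int list) set" where
  "leaves Tip = {}"
| "leaves (Leaf c p q) = {(c, p, q)}"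
| "leaves (Fork s t) = leaves s \<union> leaves t"

section \<open>Correctness of the double description method\<close>

lemma combine_nth:
  assumes "length p = m" "length q = m" "i < m"
  shows "combine e p q ! i = - dotl e q * p ! i + dotl e p * q ! i"
  using assms by (simp add: combine_def Let_def)

lemma length_combine: "length p = m \<Longrightarrow> length q = m \<Longrightarrow> length (combine e p q) = m"
  by (simp add: combine_def Let_def)

text \<open>Positive coefficients and nonnegative entries exclude cancellation. The support of a
  combination is thus the union of the two supports and is known before the row is computed.\<close>

lemma combine_nonzero_iff:
  assumes rows: "rows m E R" and e: "length e = m"
    and p: "p \<in> R" "0 < dotl e p" and q: "q \<in> R" "dotl e q < 0" and i: "i < m"
  shows "combine e p q ! i \<noteq> 0 \<longleftrightarrow> p ! i \<noteq> 0 \<or> q ! i \<noteq> 0" "0 \<le> combine e p q ! i"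
proof -
  have len: "length p = m" "length q = m" using rows p q by (auto simp: rows_def)
  have nn: "0 \<le> p ! i" "0 \<le> q ! i" using rows p(1) q(1) i by (auto simp: rows_def sol_def)
  have t: "0 \<le> - dotl e q * p ! i" "0 \<le> dotl e p * q ! i"
    using nn p(2) q(2) by (simp_all add: mult_nonpos_nonneg)
  show "0 \<le> combine e p q ! i" unfolding combine_nth[OF len i] using t by simp
  have "combine e p q ! i = 0 \<longleftrightarrow> - dotl e q * p ! i = 0 \<and> dotl e p * q ! i = 0"
    unfolding combine_nth[OF len i] using t by (rule add_nonneg_eq_0_iff)
  then show "combine e p q ! i \<noteq> 0 \<longleftrightarrow> p ! i \<noteq> 0 \<or> q ! i \<noteq> 0" using p(2) q(2) by simp
qed

lemma rows_dd_step:
  assumes rows: "rows m E R" and e: "length e = m"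
  shows "rows m (e # E) (dd_step e R)"
  unfolding rows_def
proof
  fix r assume "r \<in> dd_step e R"
  then consider "r \<in> R" "dotl e r = 0"
    | p q where "r = combine e p q" "p \<in> R" "0 < dotl e p" "q \<in> R" "dotl e q < 0"
    by (auto simp: dd_step_def)
  then show "length r = m \<and> (\<exists>i<m. r ! i \<noteq> 0) \<and> sol m (e # E) (\<lambda>i. real_of_int (r ! i))"
  proof cases
    case 1
    then show ?thesis using rows lin_dotl[OF e, of r] by (auto simp: rows_def sol_def)
  next
    case 2
    have len: "length p = m" "length q = m" using rows 2 by (auto simp: rows_def)
    note c = combine_nonzero_iff[OF rows e 2(2-5)]
    have "\<exists>i<m. p ! i \<noteq> 0" using rows 2 by (simp add: rows_def)
    then have nz: "\<exists>i<m. r ! i \<noteq> 0" using c(1) 2(1) by blast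
    have lin: "lin m f (\<lambda>i. real_of_int (r ! i)) = - real_of_int (dotl e q) * lin m f (\<lambda>i. real_of_int (p ! i))
        + real_of_int (dotl e p) * lin m f (\<lambda>i. real_of_int (q ! i))" for f
      unfolding lin_def 2(1)
      by (simp add: combine_nth[OF len] sum_distrib_left sum.distrib sum_negf algebra_simps sum_subtractf)
    have "lin m (\<lambda>i. real_of_int (f ! i)) (\<lambda>i. real_of_int (r ! i)) = 0" if "f \<in> set (e # E)" for f
    proof (cases "f = e")
      case True
      then show ?thesis unfolding lin True lin_dotl[OF e len(1)] lin_dotl[OF e len(2)] by simp
    next
      case False
      then show ?thesis using that rows 2 unfolding lin by (simp add: rows_def sol_def)
    qed
    then show ?thesis using nz c(2) 2(1) length_combine[OF len] by (simp add: sol_def)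
  qed
qed

text \<open>Let r be a row below y. If e vanishes on r, it survives. Otherwise, subtracting a
  multiple of r from y gives e the opposite sign, so another row below y lies on the other side, and
  combining both rows stays below y.\<close>

lemma covers_dd_step:
  assumes cov: "covers m E R" and rows: "rows m E R" and e: "length e = m"
  shows "covers m (e # E) (dd_step e R)"
  unfolding covers_def
proof (intro allI impI)
  fix y assume y: "sol m (e # E) y" and nz: "\<exists>i<m. y i \<noteq> 0"
  let ?e = "\<lambda>i. real_of_int (e ! i)"
  have yE: "sol m E y" and ey: "lin m ?e y = 0" using y by (auto simp: sol_def)
  have ev: "lin m ?e (\<lambda>i. real_of_int (r ! i)) = real_of_int (dotl e r)" if "r \<in> R" for r
    using that rows by (intro lin_dotl[OF e]) (simp add: rows_def)
  have comb: "\<exists>r\<in>dd_step e R. (\<exists>i<m. r ! i \<noteq> 0) \<and> (\<forall>i<m. r ! i \<noteq> 0 \<longrightarrow> y i \<noteq> 0)"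
    if p: "p \<in> R" "0 < dotl e p" "\<forall>i<m. p ! i \<noteq> 0 \<longrightarrow> y i \<noteq> 0"
      and q: "q \<in> R" "dotl e q < 0" "\<forall>i<m. q ! i \<noteq> 0 \<longrightarrow> y i \<noteq> 0" for p q
  proof (intro bexI conjI allI impI)
    show "combine e p q \<in> dd_step e R" using p q by (auto simp: dd_step_def)
    note c = combine_nonzero_iff[OF rows e p(1,2) q(1,2)]
    have "\<exists>i<m. p ! i \<noteq> 0" using rows p(1) by (simp add: rows_def)
    then show "\<exists>i<m. combine e p q ! i \<noteq> 0" using c(1) by blast
    show "y i \<noteq> 0" if "i < m" "combine e p q ! i \<noteq> 0" for i using that c(1) p(3) q(3) by blast
  qed
  obtain r t where r: "r \<in> R" "\<forall>i<m. r ! i \<noteq> 0 \<longrightarrow> y i \<noteq> 0" "0 < t"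
    "sol m E (\<lambda>i. y i - t * real_of_int (r ! i))"
    "{i. i < m \<and> y i - t * real_of_int (r ! i) \<noteq> 0} \<subset> {i. i < m \<and> y i \<noteq> 0}"
    by (rule covers_subtract[OF cov rows yE nz])
  have el: "lin m ?e (\<lambda>i. y i - t * real_of_int (r ! i)) = - t * real_of_int (dotl e r)"
    unfolding lin_diff ey ev[OF r(1)] by simp
  consider "dotl e r = 0" | "0 < dotl e r" | "dotl e r < 0" by linarith
  then show "\<exists>r\<in>dd_step e R. (\<exists>i<m. r ! i \<noteq> 0) \<and> (\<forall>i<m. r ! i \<noteq> 0 \<longrightarrow> y i \<noteq> 0)"
  proof cases
    case 1
    have "\<exists>i<m. r ! i \<noteq> 0" using rows r(1) by (simp add: rows_def)
    then show ?thesis using 1 r(1,2) by (intro bexI[of _ r]) (auto simp: dd_step_def)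
  next
    case 2
    then have "lin m ?e (\<lambda>i. y i - t * real_of_int (r ! i)) < 0" unfolding el using r(3) by simp
    then obtain q where q: "q \<in> R" "lin m ?e (\<lambda>i. real_of_int (q ! i)) < 0"
      "\<forall>i<m. q ! i \<noteq> 0 \<longrightarrow> y i - t * real_of_int (r ! i) \<noteq> 0"
      using covers_negative[OF cov rows r(4)] by blast
    have "dotl e q < 0" using q(2) unfolding ev[OF q(1)] by simp
    moreover have "y i \<noteq> 0" if "i < m" "q ! i \<noteq> 0" for i using q(3) r(5) that by blast
    ultimately show ?thesis using comb[OF r(1) 2 r(2) q(1)] by blast
  next
    case 3
    then have "0 < lin m ?e (\<lambda>i. y i - t * real_of_int (r ! i))" unfolding el using r(3)
      by (simp add: mult_less_0_iff)
    then obtain p where p: "p \<in> R" "0 < lin m ?e (\<lambda>i. real_of_int (p ! i))"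
      "\<forall>i<m. p ! i \<noteq> 0 \<longrightarrow> y i - t * real_of_int (r ! i) \<noteq> 0"
      using covers_positive[OF cov rows r(4)] by blast
    have "0 < dotl e p" using p(2) unfolding ev[OF p(1)] by simp
    moreover have "y i \<noteq> 0" if "i < m" "p ! i \<noteq> 0" for i using p(3) r(5) that by blast
    ultimately show ?thesis using comb[OF p(1) _ _ r(1) 3 r(2)] by blast
  qed
qed

definition supp_le :: "int list \<Rightarrow> int list \<Rightarrow> bool" where
  "supp_le s r \<longleftrightarrow> bits_le (support s) (support r)"

lemma bits_le_refl: "bits_le a a"
  by (induction a) auto

lemma bits_le_trans: "bits_le a b \<Longrightarrow> bits_le b c \<Longrightarrow> bits_le a c"
proof (induction a b arbitrary: c rule: bits_le.induct)
  case (2 s r)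
  then show ?case by (cases c) auto
next
  case (3 s r)
  then show ?case by (cases c) auto
next
  case (4 s r)
  then show ?case by (cases c) auto
qed auto

lemma supp_le_iff: "supp_le s r \<longleftrightarrow> list_all2 (\<lambda>a b. a \<noteq> 0 \<longrightarrow> b \<noteq> 0) s r"
  unfolding supp_le_def
proof (induction s arbitrary: r)
  case Nil
  then show ?case by (cases r) auto
next
  case (Cons x s)
  then show ?case by (cases r) auto
qed

lemma bits_or_support:
  "length p = length q \<Longrightarrow> length r = length p \<Longrightarrow> (\<And>i. i < length p \<Longrightarrow> r ! i \<noteq> 0 \<longleftrightarrow> p ! i \<noteq> 0 \<or> q ! i \<noteq> 0)
    \<Longrightarrow> bits_or (support p) (support q) = support r"
proof (induction p q arbitrary: r rule: list_induct2)
  case Nil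
  then show ?case by simp
next
  case (Cons x p y q)
  obtain z r' where r: "r = z # r'" using Cons.prems(1) by (cases r) auto
  have "bits_or (support p) (support q) = support r'"
    using Cons.prems(1) Cons.prems(2)[of "Suc _"] by (intro Cons.IH) (auto simp: r)
  then show ?case using Cons.prems(2)[of 0] by (auto simp: r)
qed

lemma below_iff: "below t b \<longleftrightarrow> (\<exists>x\<in>leaves t. bits_le (fst x) b)"
  by (induction t) auto

lemma leaves_fork: "leaves (fork s t) = leaves s \<union> leaves t"
  by (cases "(s, t)" rule: fork.cases) auto

lemma leaves_remove_above: "leaves (remove_above A t) = {x \<in> leaves t. \<not> below A (fst x)}"
  by (induction t) (auto simp: leaves_fork)

lemma leaves_prune: "leaves (prune t) \<subseteq> leaves t"
  by (induction t) (auto simp: Let_def leaves_fork leaves_remove_above)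

text \<open>Each removed leaf lies above one that is still present at that moment; transitivity
  carries this through the two filtering steps.\<close>

lemma prune_below: "x \<in> leaves t \<Longrightarrow> below (prune t) (fst x)"
proof (induction t arbitrary: x)
  case (Leaf c p q)
  then show ?case by (simp add: bits_le_refl)
next
  case (Fork s t)
  define A B where "A = prune s" and "B = remove_above A (prune t)"
  have eq: "prune (Fork s t) = fork (remove_above B A) B" by (simp add: A_def B_def Let_def)
  have le: "below (prune (Fork s t)) b" if "y \<in> leaves A \<union> leaves B" "bits_le (fst y) b" for y b
  proof (cases "y \<in> leaves B \<or> \<not> below B (fst y)")
    case True
    then have "y \<in> leaves (prune (Fork s t))"
      unfolding eq leaves_fork leaves_remove_above using that(1) by auto
    then show ?thesis using that(2) unfolding below_iff by blast
  next
    case False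
    then obtain z where "z \<in> leaves B" "bits_le (fst z) (fst y)" unfolding below_iff by blast
    then show ?thesis using bits_le_trans[OF _ that(2)] unfolding eq below_iff leaves_fork by blast
  qed
  show ?case
  proof (cases "x \<in> leaves s")
    case True
    then have "below A (fst x)" using Fork.IH(1) by (simp add: A_def)
    then obtain y where "y \<in> leaves A" "bits_le (fst y) (fst x)" unfolding below_iff by blast
    then show ?thesis using le by blast
  next
    case False
    then have "x \<in> leaves t" using Fork.prems by simp
    then have "below (prune t) (fst x)" by (rule Fork.IH(2))
    then obtain y where y: "y \<in> leaves (prune t)" "bits_le (fst y) (fst x)"
      unfolding below_iff by blast
    show ?thesis
    proof (cases "below A (fst y)")
      case True
      then obtain z where "z \<in> leaves A" "bits_le (fst z) (fst y)" unfolding below_iff by blast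
      then show ?thesis using le bits_le_trans[OF _ y(2)] by blast
    next
      case False
      then have "y \<in> leaves B" using y(1) by (simp add: B_def leaves_remove_above)
      then show ?thesis using le y(2) by blast
    qed
  qed
qed simp

lemma leaves_select:
  "leaves (zeros e t) = {(c,p,q) \<in> leaves t. dotl e p = 0}"
  "leaves (positives e t) = {(c,p,q) \<in> leaves t. 0 < dotl e p}"
  "leaves (negatives e t) = {(c,p,q) \<in> leaves t. dotl e p < 0}"
  by (induction t) (auto simp: leaves_fork)

lemma leaves_mix_row: "leaves (mix_row c p t) = (\<lambda>(c',p',q'). (bits_or c c', p, p')) ` leaves t"
  by (induction t) (simp_all add: image_Un)

lemma leaves_mix: "leaves (mix s t) = {(bits_or c c', p, p') | c p q c' p' q'. (c,p,q) \<in> leaves s \<and> (c',p',q') \<in> leaves t}"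
  by (induction s) (auto simp: leaves_mix_row image_iff, force+)

lemma leaves_finish: "leaves (finish e t) = (\<lambda>(c,p,q). (c, leaf_row e p q, [])) ` leaves t"
  by (induction t) (simp_all add: image_Un)

lemma leaves_tree_of: "leaves (tree_of rs) = (\<lambda>r. (support r, r, [])) ` set rs"
proof -
  have "leaves (insert_row r t) = insert (support r, r, []) (leaves t)" for r t
    by (induction r t rule: insert_row.induct) auto
  then show ?thesis by (induction rs) auto
qed

lemma dominated_iff: "dominated S t \<longleftrightarrow> (\<forall>x\<in>leaves t. below S (fst x))"
  by (induction t) auto

text \<open>Comparing pairs states both that the rows agree and that the stored bit strings are
  their supports.\<close>

definition represents :: "int list \<Rightarrow> rowtree \<Rightarrow> int list set \<Rightarrow> bool" where
  "represents e t R \<longleftrightarrow> (\<lambda>(c,p,q). (c, leaf_row e p q)) ` leaves t = (\<lambda>r. (support r, r)) ` R"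

lemma representsD:
  assumes "represents e t R"
  shows "r \<in> R \<Longrightarrow> \<exists>p q. (support r, p, q) \<in> leaves t \<and> leaf_row e p q = r"
    and "(c,p,q) \<in> leaves t \<Longrightarrow> leaf_row e p q \<in> R \<and> c = support (leaf_row e p q)"
proof -
  assume "r \<in> R"
  then have "(support r, r) \<in> (\<lambda>(c,p,q). (c, leaf_row e p q)) ` leaves t"
    using assms unfolding represents_def by simp
  then show "\<exists>p q. (support r, p, q) \<in> leaves t \<and> leaf_row e p q = r" by auto
next
  assume "(c,p,q) \<in> leaves t"
  then have "(c, leaf_row e p q) \<in> (\<lambda>r. (support r, r)) ` R"
    using assms unfolding represents_def by force
  then show "leaf_row e p q \<in> R \<and> c = support (leaf_row e p q)" by auto
qed

lemma represents_finish: "represents e t R \<Longrightarrow> leaves (finish e t) = (\<lambda>r. (support r, r, [])) ` R"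
proof -
  assume r: "represents e t R"
  have "leaves (finish e t) = (\<lambda>(c,p). (c,p,[])) ` (\<lambda>(c,p,q). (c, leaf_row e p q)) ` leaves t"
    by (simp add: leaves_finish image_image case_prod_beta)
  also have "\<dots> = (\<lambda>r. (support r, r, [])) ` R"
    using r unfolding represents_def by (simp add: image_image)
  finally show ?thesis .
qed

text \<open>Only the support of a row enters the covering property, so a row may be replaced by any
  nonzero one with smaller support. This covers pruning as well as the final comparison with known
  normals.\<close>

lemma covers_dominated:
  assumes "covers m E R" "rows m E R" "\<And>r. r \<in> R \<Longrightarrow> \<exists>s\<in>R'. supp_le s r \<and> (\<exists>i<m. s ! i \<noteq> 0)"
  shows "covers m E R'"
  unfolding covers_def
proof (intro allI impI)
  fix y assume "sol m E y" "\<exists>i<m. y i \<noteq> 0"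
  then obtain r where r: "r \<in> R" "\<forall>i<m. r ! i \<noteq> 0 \<longrightarrow> y i \<noteq> 0"
    using assms(1) unfolding covers_def by blast
  obtain s where s: "s \<in> R'" "supp_le s r" "\<exists>i<m. s ! i \<noteq> 0" using assms(3)[OF r(1)] by blast
  have "length r = m" using assms(2) r(1) by (simp add: rows_def)
  then have "s ! i \<noteq> 0 \<longrightarrow> r ! i \<noteq> 0" if "i < m" for i
    using s(2) that by (auto simp: supp_le_iff list_all2_conv_all_nth)
  then show "\<exists>r\<in>R'. (\<exists>i<m. r ! i \<noteq> 0) \<and> (\<forall>i<m. r ! i \<noteq> 0 \<longrightarrow> y i \<noteq> 0)"
    using s r(2) by blast
qed

lemma represents_candidates:
  assumes t: "leaves t = (\<lambda>r. (support r, r, [])) ` R" and rows: "rows m E R" and e: "length e = m"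
  shows "represents e (candidates e t) (dd_step e R)"
proof -
  have comb: "leaf_row e p q = combine e p q \<and> bits_or (support p) (support q) = support (combine e p q)"
    if pq: "p \<in> R" "0 < dotl e p" "q \<in> R" "dotl e q < 0" for p q
  proof
    have len: "length p = m" "length q = m" using rows pq by (auto simp: rows_def)
    obtain i where "i < m" using rows pq(1) unfolding rows_def by blast
    then show "leaf_row e p q = combine e p q" using len by (cases q) (auto simp: leaf_row_def)
    show "bits_or (support p) (support q) = support (combine e p q)"
      using combine_nonzero_iff(1)[OF rows e pq] len length_combine[OF len]
      by (intro bits_or_support) auto
  qed
  have mix: "leaves (mix (positives e t) (negatives e t)) = {(bits_or (support p) (support q), p, q) | p q.
      p \<in> R \<and> 0 < dotl e p \<and> q \<in> R \<and> dotl e q < 0}"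
    unfolding leaves_mix leaves_select t by (auto simp: image_iff)
  have zero: "leaves (zeros e t) = (\<lambda>r. (support r, r, [])) ` {r \<in> R. dotl e r = 0}"
    unfolding leaves_select t by auto
  have "(\<lambda>(c,p,q). (c, leaf_row e p q)) ` leaves (zeros e t) = (\<lambda>r. (support r, r)) ` {r \<in> R. dotl e r = 0}"
    unfolding zero by (simp add: image_image leaf_row_def)
  moreover have "(\<lambda>(c,p,q). (c, leaf_row e p q)) ` leaves (mix (positives e t) (negatives e t))
     = (\<lambda>r. (support r, r)) ` {combine e p q | p q. p \<in> R \<and> 0 < dotl e p \<and> q \<in> R \<and> dotl e q < 0}"
    unfolding mix using comb by (force simp: image_iff)
  ultimately show ?thesis
    unfolding represents_def candidates_def leaves_fork dd_step_def image_Un by simp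
qed

lemma finish_prune_correct:
  assumes rep: "represents e t R" and rows: "rows m E R" and cov: "covers m E R"
  obtains R' where "leaves (finish e (prune t)) = (\<lambda>r. (support r, r, [])) ` R'" "rows m E R'" "covers m E R'"
proof -
  define R' where "R' = (\<lambda>(c,p,q). leaf_row e p q) ` leaves (prune t)"
  have c: "c = support (leaf_row e p q)" "leaf_row e p q \<in> R" if "(c,p,q) \<in> leaves (prune t)" for c p q
    using representsD(2)[OF rep] that leaves_prune by blast+
  have "(c, leaf_row e p q) = (support (leaf_row e p q), leaf_row e p q)" if "(c,p,q) \<in> leaves (prune t)" for c p q
    using c[OF that] by simp
  then have rep': "represents e (prune t) R'"
    unfolding represents_def R'_def image_image by (intro image_cong) auto
  have sub: "R' \<subseteq> R" unfolding R'_def using c(2) by auto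
  then have rows': "rows m E R'" using rows by (auto simp: rows_def)
  have "covers m E R'"
  proof (rule covers_dominated[OF cov rows])
    fix r assume "r \<in> R"
    then obtain p q where "(support r, p, q) \<in> leaves t" using representsD(1)[OF rep] by blast
    then have "below (prune t) (support r)" using prune_below by fastforce
    then obtain c' p' q' where x: "(c',p',q') \<in> leaves (prune t)" "bits_le c' (support r)"
      by (auto simp: below_iff)
    have "leaf_row e p' q' \<in> R'" unfolding R'_def using x(1) by force
    moreover have "supp_le (leaf_row e p' q') r" using x c(1) by (simp add: supp_le_def)
    ultimately show "\<exists>s\<in>R'. supp_le s r \<and> (\<exists>i<m. s ! i \<noteq> 0)" using rows' by (auto simp: rows_def)
  qed
  then show ?thesis using that represents_finish[OF rep'] rows' by blast
qed

lemma units_correct: "rows m [] (set (units m))" "covers m [] (set (units m))"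
proof -
  show "rows m [] (set (units m))" by (auto simp: rows_def units_def sol_def)
  show "covers m [] (set (units m))"
    unfolding covers_def
  proof (intro allI impI)
    fix y :: "nat \<Rightarrow> real" assume "\<exists>i<m. y i \<noteq> 0"
    then obtain i where i: "i < m" "y i \<noteq> 0" by blast
    then show "\<exists>r\<in>set (units m). (\<exists>i<m. r ! i \<noteq> 0) \<and> (\<forall>i<m. r ! i \<noteq> 0 \<longrightarrow> y i \<noteq> 0)"
      by (intro bexI[of _ "map (\<lambda>j. if i = j then 1 else 0) [0..<m]"] conjI exI[of _ i]) (auto simp: units_def)
  qed
qed

lemma dd_correct:
  assumes "\<And>e. e \<in> set E \<Longrightarrow> length e = m"
  shows "\<exists>R. leaves (dd m E) = (\<lambda>r. (support r, r, [])) ` R \<and> rows m E R \<and> covers m E R"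
  using assms
proof (induction E)
  case Nil
  then show ?case
    using units_correct[of m] by (intro exI[of _ "set (units m)"]) (simp add: leaves_tree_of)
next
  case (Cons e E)
  have e: "length e = m" using Cons.prems by simp
  obtain R where R: "leaves (dd m E) = (\<lambda>r. (support r, r, [])) ` R" "rows m E R" "covers m E R"
    using Cons by auto
  obtain R' where "leaves (finish e (prune (candidates e (dd m E)))) = (\<lambda>r. (support r, r, [])) ` R'"
    "rows m (e # E) R'" "covers m (e # E) R'"
    using finish_prune_correct[OF represents_candidates[OF R(1,2) e] rows_dd_step[OF R(2) e] covers_dd_step[OF R(3,2) e]]
    by blast
  then show ?case by auto
qed

text \<open>The soundness of the certificates: the list S, later the values of neighbouring normals,
  takes the place of the computed candidates.\<close>

lemma last_candidates_covers:
  assumes E: "\<And>e. e \<in> set E \<Longrightarrow> length e = m" and nz: "\<And>s. s \<in> set S \<Longrightarrow> \<exists>i<m. s ! i \<noteq> 0"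
    and dom: "dominated (tree_of S) (last_candidates m E)"
  shows "covers m E (set S)"
proof -
  obtain e R where R: "represents e (last_candidates m E) R" "rows m E R" "covers m E R"
  proof (cases E)
    case Nil
    then show ?thesis using units_correct[of m]
      by (intro that[of "[]" "set (units m)"]) (simp_all add: represents_def leaves_tree_of image_image leaf_row_def)
  next
    case (Cons e E')
    have e: "length e = m" using E Cons by simp
    obtain R where R: "leaves (dd m E') = (\<lambda>r. (support r, r, [])) ` R" "rows m E' R" "covers m E' R"
      using dd_correct[of E' m] E Cons by auto
    then show ?thesis
      using represents_candidates[OF R(1,2) e] rows_dd_step[OF R(2) e] covers_dd_step[OF R(3,2) e] Cons
      by (intro that[of e "dd_step e R"]) auto
  qed
  show ?thesis
  proof (rule covers_dominated[OF R(3,2)])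
    fix r assume "r \<in> R"
    then obtain p q where "(support r, p, q) \<in> leaves (last_candidates m E)"
      using representsD(1)[OF R(1)] by blast
    then have "below (tree_of S) (support r)" using dom by (force simp: dominated_iff)
    then obtain s where "s \<in> set S" "supp_le s r"
      by (auto simp: below_iff leaves_tree_of supp_le_def)
    then show "\<exists>s\<in>set S. supp_le s r \<and> (\<exists>i<m. s ! i \<noteq> 0)" using nz by blast
  qed
qed

section \<open>Certificates at the eight normals\<close>

definition ineqs :: "int list list" where
  "ineqs = [[-1,-1,0,0,0,-1,0,1,0,1,0,0,1,1,1],[-3,-1,-1,1,-1,-1,-1,3,-1,3,1,-1,3,1,3],
     [-1,-1,-1,1,-1,-1,-1,3,1,1,1,-1,1,1,1],[-1,-1,-1,-1,1,-1,1,1,-1,1,1,1,1,1,1],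
     [-1,0,0,0,-1,0,0,1,0,1,0,0,1,0,1],[-1,0,0,0,0,0,0,0,0,0,0,0,0,1,1],
     [-1,-1,0,1,0,-1,0,2,0,1,0,-1,1,0,1],[-1,-1,-1,1,-1,0,-1,2,0,2,0,-1,2,0,2]]"

definition normals :: "(real^15) set" where
  "normals = {S6_act \<sigma> (lvec (ineqs ! t)) | \<sigma> t. \<sigma> permutes {1..6} \<and> t < 8}"

fun act_word :: "duad list \<Rightarrow> 'a list \<Rightarrow> 'a list" where
  "act_word [] x = x"
| "act_word (d # w) x = act_word w (apply_duad d x)"

text \<open>Certificates for the representative normals \<open>r = ineqs ! t\<close>. The mask \<open>tight ! t\<close> selects the
  generators orthogonal to \<open>r\<close>, and \<open>relations ! t\<close> is a basis of the linear relations between them.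
  The pairs \<open>(t', w)\<close> in \<open>neighbours ! t\<close> stand for the images of the \<open>t'\<close>-th normal under the product
  of transpositions \<open>w\<close>. With \<open>e\<^sub>n\<close> the standard basis, row \<open>j - 1\<close> of \<open>kernels ! t\<close> expresses
  \<open>4 (r\<^sub>0 e\<^sub>j - r\<^sub>j e\<^sub>0)\<close> through the tight generators, so that these span the hyperplane
  orthogonal to \<open>r\<close>.\<close>

definition tight :: "bool list list" where
  "tight = [[True,True,False,False,False,True,True,True,True,False,True,True,False,True,False,False,True,True,True,False,True,True,True,False,False],
     [True,True,True,False,False,True,True,False,True,False,True,True,False,True,False,False,False,True,True,False,True,True,True,False,False],
     [True,True,True,False,True,False,True,True,True,False,True,True,False,True,False,False,True,True,True,False,True,True,True,False,True],
     [True,False,False,False,False,True,True,True,True,False,True,True,True,True,False,False,True,True,True,True,True,True,True,False,False],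
     [False,True,True,False,False,True,True,False,True,False,True,True,False,True,False,False,False,True,True,False,True,True,True,True,False],
     [True,True,True,False,False,True,True,True,True,False,False,True,True,True,True,True,True,True,True,False,True,True,True,True,False],
     [True,True,True,False,True,True,True,True,True,False,True,True,False,True,False,False,True,True,False,False,True,True,True,False,True],
     [True,True,True,False,True,True,True,False,True,False,True,True,False,True,False,False,False,True,True,False,True,True,False,False,False]]"

fun select :: "bool list \<Rightarrow> 'a list \<Rightarrow> 'a list" where
  "select (b # bs) (x # xs) = (if b then x # select bs xs else select bs xs)"
| "select _ _ = []"

definition tight_gens :: "nat \<Rightarrow> int list list" where
  "tight_gens t = select (tight ! t) gens"

definition relations :: "int list list list" where
  "relations = [[[0,0,0,-1,-1,0,0,0,-1,1,1,0,0,1,1]],[],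
     [[0,0,-1,-1,1,-1,-1,-1,0,1,0,0,0,2,0,0,2],[0,0,-1,1,-1,-1,1,-1,0,-1,0,2,0,0,0,2,0],
     [0,0,1,-1,-1,-1,-1,1,0,-1,2,0,0,0,2,0,0]],
     [[0,0,0,0,0,-1,-1,-1,0,0,0,1,1,1,0,1],[0,0,-1,-1,0,1,1,1,-1,1,1,-1,-1,-1,1,0]],[],
     [[1,0,-1,-1,0,0,-1,-1,0,1,-1,0,0,0,0,2,0,0,2],[1,-1,0,0,-1,-1,0,0,-1,-1,1,0,0,0,0,0,2,2,0],
     [-1,0,-1,-1,0,0,1,1,0,-1,-1,2,0,2,0,0,0,0,0],[0,1,-1,-1,-1,-1,1,1,1,0,0,0,0,2,-2,0,0,0,0],
     [0,1,1,1,-1,-1,-1,-1,1,0,0,-2,2,0,0,0,0,0,0]],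
     [[0,0,-1,-1,0,1,-1,-1,-1,0,1,0,0,2,0,0,2],[0,0,-1,1,0,-1,-1,1,-1,0,-1,0,2,0,0,2,0],
     [0,0,1,-1,0,-1,-1,-1,1,0,-1,2,0,0,2,0,0]],
     []]"

definition neighbours :: "(nat \<times> duad list) list list" where
  "neighbours = [[(3,[D12,D15,D36]),(3,[]),(2,[]),(5,[D15,D24]),(5,[]),(2,[D12,D14,D15]),(6,[]),(5,[D14,D45]),
     (0,[D13,D24,D56]),(1,[]),(5,[D13,D24]),(5,[D23,D26]),(2,[D35,D46]),(0,[D23,D45]),
     (5,[D14,D26]),(2,[D13,D26]),(0,[D12,D56]),(0,[D15,D23,D46]),(1,[D14,D25,D36]),(5,[D24,D46])],
    [(4,[]),(0,[D14,D23]),(0,[]),(2,[]),(0,[D13,D24,D56]),(2,[D14,D23]),(5,[]),(0,[D12,D34,D56]),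
     (5,[D13,D24]),(6,[D14,D23]),(6,[]),(2,[D13,D45]),(2,[D13,D26]),(7,[])],
    [(5,[D14]),(5,[D24,D45]),(5,[D13,D26]),(6,[]),(5,[D23,D26]),(3,[D13,D14,D26]),(3,[D35,D46]),
     (0,[D13,D14,D26]),(0,[D15,D23,D46]),(5,[D24,D46]),(5,[D13,D25]),(2,[D56]),(0,[D13,D24,D56]),
     (5,[D13,D24]),(5,[D13,D36]),(2,[D23]),(5,[D14,D26]),(3,[D12,D56]),(3,[D13,D15,D16]),
     (0,[D14,D16,D35]),(5,[D14,D45]),(3,[D24,D36]),(3,[D12]),(0,[D12,D24,D45]),(4,[D13,D45]),
     (5,[D13,D16]),(1,[D13,D45]),(2,[D12,D35]),(2,[D12,D46]),(0,[D12,D13,D25]),(6,[D12,D46]),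
     (1,[D12,D16,D23,D35]),(2,[D13,D45]),(0,[D24,D45,D46]),(4,[D15,D36]),(5,[D14,D25,D46]),(0,[]),
     (5,[D15,D24]),(5,[]),(2,[D14]),(2,[D35,D46]),(0,[D35,D46]),(6,[D14,D23]),(1,[D13,D26]),
     (1,[D14,D25,D36]),(2,[D14,D56]),(7,[]),(6,[D13,D26]),(1,[]),(2,[D14,D23]),(2,[D13,D26]),
     (0,[D13,D26]),(2,[D16,D25]),(0,[D12,D23,D34,D45]),(4,[D13,D26]),(5,[D24,D26]),
     (1,[D14,D15,D46]),(2,[D23,D56]),(2,[D25,D34]),(0,[D12,D24,D45,D56])],
    [(5,[D24]),(5,[D24,D45]),(5,[D15,D24]),(0,[D14,D15]),(5,[]),(2,[D12]),(5,[D14,D15]),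
     (2,[D12,D14,D15]),(0,[D14,D45]),(2,[D24,D36]),(0,[]),(5,[D14,D45]),(2,[D12,D23,D45]),
     (0,[D14,D23]),(5,[D13,D24]),(5,[D23,D26]),(2,[D35,D46]),(0,[D23,D45]),(0,[D15,D23]),
     (5,[D15,D23]),(2,[D12,D56]),(4,[D12,D25,D36]),(5,[D16,D24]),(3,[D56]),(5,[D13,D25,D36]),
     (3,[D16]),(4,[D24,D25,D36]),(3,[D46]),(4,[D14,D25,D36]),(5,[D24,D46])],
    [(3,[D13,D15,D26]),(3,[D12,D15,D36]),(5,[D14]),(3,[D12,D13,D16,D35]),(5,[D23]),(5,[]),
     (3,[D12,D14,D35,D46]),(5,[D13,D24]),(2,[D12,D16,D24]),(2,[D15,D36]),(2,[D13,D45]),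
     (2,[D13,D26]),(1,[D14,D56]),(1,[])],
    [(3,[D24,D56]),(5,[D16]),(5,[D26]),(3,[D12,D14,D56]),(5,[D15]),(3,[D24]),(5,[D24]),
     (3,[D25,D36]),(3,[D12,D14]),(5,[D25]),(3,[D12,D15,D36]),(5,[D14]),(3,[D24,D35,D46]),
     (5,[D23]),(5,[D13]),(3,[D12,D14,D35,D46]),(2,[D13,D14]),(5,[D15,D23]),(5,[D14,D26]),
     (2,[D13,D26]),(0,[D34,D36,D45]),(2,[D12,D23,D26]),(6,[D12,D56]),(3,[D13,D15,D36]),
     (5,[D24,D26]),(0,[D13,D15,D36]),(3,[D12,D13,D34,D46]),(0,[D15,D23,D24]),(2,[D12,D56]),
     (5,[D14,D46]),(5,[D13,D15]),(2,[D24,D26]),(0,[D12,D56]),(3,[D12,D56]),(0,[D13,D14,D15]),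
     (5,[D23,D35]),(3,[D34]),(6,[D34]),(2,[D34]),(0,[D34]),(2,[D12,D16,D23]),(5,[D16,D24]),
     (5,[D13,D25]),(2,[D14,D56]),(5,[D14,D16]),(3,[D12,D13,D35,D36]),(0,[D14,D15,D56]),
     (2,[D13,D16]),(0,[D15,D24,D56]),(6,[D56]),(2,[D12,D14,D16]),(5,[D23,D25]),(3,[D56]),
     (0,[D56]),(0,[D34,D35,D46]),(3,[D13,D14,D46]),(5,[D24,D46]),(2,[D56]),(6,[D12,D34]),
     (0,[D12,D34]),(2,[D12,D34]),(0,[D15,D34,D46]),(3,[D12,D34]),(5,[D13,D35]),(5,[D13,D24]),
     (5,[D15,D26]),(2,[D23,D45]),(2,[D12,D13,D45]),(2,[D12,D13,D36]),(2,[D23,D36]),(5,[D16,D23]),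
     (2,[D12,D24]),(2,[D24,D25]),(5,[D14,D25]),(0,[D12,D35,D46]),(3,[D12,D35,D46]),(2,[D13,D25]),
     (5,[D13,D16]),(6,[D13,D25]),(0,[D13,D14,D15,D56]),(2,[D36,D45]),(0,[D36,D45]),(6,[D12]),
     (2,[D12]),(0,[D12]),(5,[D24,D25]),(3,[D14,D36]),(0,[D15,D36]),(5,[D14,D45]),(3,[D12]),
     (0,[D34,D56]),(3,[D34,D56]),(2,[D34,D56]),(5,[D23,D36]),(1,[D12]),(0,[D26,D34,D45]),
     (0,[D12,D13,D24]),(2,[D13,D45]),(1,[D36,D45]),(0,[D12,D13,D14,D16]),(0,[D24,D25,D26]),
     (2,[D12,D23,D36]),(0,[D12,D16,D23,D24]),(0,[D12,D13,D45]),(0,[D23,D34,D35,D56]),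
     (0,[D23,D36]),(5,[D15,D24]),(2,[D12,D14,D15]),(2,[D14]),(5,[D13,D26]),(5,[D23,D26]),
     (2,[D35,D46]),(3,[D35,D46]),(0,[D35,D46]),(0,[D13,D15,D34,D46]),(6,[D14,D23]),
     (3,[D12,D13,D36]),(5,[D14,D15]),(0,[D14,D15]),(3,[]),(5,[D24,D45]),(0,[D15,D24]),
     (2,[D15,D24]),(6,[]),(0,[]),(2,[]),(5,[D13,D36]),(2,[D14,D23]),(3,[D12,D34,D56]),
     (0,[D12,D34,D56]),(2,[D12,D23,D45]),(0,[D14,D23]),(0,[D13,D24,D56]),(1,[]),(2,[D13,D36]),
     (0,[D12,D14,D15,D16]),(0,[D23,D24,D26]),(1,[D35,D46]),(0,[D23,D45]),(0,[D13,D14,D26]),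
     (0,[D12,D13,D36]),(0,[D16,D23,D24,D45]),(2,[D14,D26]),(2,[D12,D16,D24]),(2,[D14,D15]),
     (2,[D15,D36]),(0,[D12,D14,D23]),(1,[D34]),(2,[D24,D46]),(0,[D12,D16,D35]),
     (0,[D13,D24,D35,D46]),(1,[D34,D36,D45]),(2,[D12,D14,D35]),(0,[D24,D26]),(0,[D14,D26]),
     (0,[D23,D34,D35]),(0,[D12,D13,D34,D46]),(0,[D16,D24,D35]),(0,[D26,D35]),(2,[D12,D14,D46]),
     (1,[D56]),(0,[D13,D24]),(0,[D12,D14,D16]),(2,[D24,D35]),(1,[D34,D35,D46]),
     (0,[D23,D24,D25,D26]),(0,[D12,D13,D34,D35]),(0,[D12,D16,D24]),(0,[D23,D45,D56]),
     (0,[D23,D34,D46]),(4,[D12]),(3,[D13,D15,D26]),(3,[D12,D13,D16,D35]),(4,[]),(3,[D26,D35]),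
     (4,[D34]),(4,[D14]),(3,[D12,D16,D35]),(4,[D36,D45]),(3,[D16,D24]),(3,[D12,D14,D26]),
     (4,[D35,D46]),(3,[D12,D14,D16]),(4,[D14,D35,D46]),(4,[D14,D36,D45]),(3,[D24,D26])],
    [(2,[D15,D36]),(2,[D24,D36]),(2,[]),(2,[D15,D24]),(5,[D23,D26]),(0,[D15,D26,D34]),
     (0,[D23,D24,D26]),(5,[D15,D26]),(0,[D15,D23,D46]),(5,[D24,D46]),(5,[D13,D25]),
     (0,[D23,D34,D46]),(0,[D13,D24,D56]),(5,[D13,D24]),(5,[D13,D36]),(0,[D13,D35,D56]),
     (5,[D14,D26]),(0,[D16,D24,D35]),(0,[D13,D15,D16]),(5,[D13,D15]),(5,[D14,D45]),(0,[D24,D36]),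
     (0,[D15,D36]),(5,[D24,D25]),(1,[D12,D14,D45]),(2,[D12,D23,D36]),(7,[D13,D45]),(6,[D12,D35]),
     (2,[D12,D46]),(1,[D12,D13,D25]),(6,[D12,D46]),(7,[D12,D46]),(2,[D13,D45]),(1,[D24,D36]),
     (1,[D15,D36]),(2,[D12,D25,D26]),(0,[]),(5,[D15,D24]),(5,[]),(0,[D15,D24]),(2,[D35,D46]),
     (1,[D35,D46]),(6,[D14,D23]),(7,[D13,D26]),(1,[D14,D25,D36]),(2,[D14,D56]),(7,[]),
     (6,[D13,D26]),(1,[]),(2,[D14,D23]),(2,[D13,D26]),(1,[D15,D24]),(2,[D16,D25]),(1,[D16,D25]),
     (1,[D12,D14,D26]),(2,[D12,D14,D26]),(1,[D14,D15,D46]),(2,[D23,D56]),(2,[D25,D34]),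
     (1,[D13,D14,D46])],
    [(1,[D14,D56]),(1,[D14,D26,D35]),(1,[D14,D25,D36]),(1,[]),(2,[]),(1,[D14,D15,D46]),
     (2,[D14,D23]),(2,[D14,D56]),(1,[D14,D16,D45]),(2,[D23,D56]),(6,[D14,D23]),(6,[]),
     (6,[D12,D46]),(6,[D13,D26])]]"

definition kernels :: "int list list list" where
  "kernels = [[[0,0,0,2,2,2,-2,0,2,-4,-2,0,0,-2,0],[-1,1,1,0,1,0,0,-1,0,0,0,0,0,-2,0],
     [1,1,-1,0,-1,0,0,1,0,0,0,-2,0,0,0],[1,-1,1,0,1,0,0,-1,0,0,-2,0,0,0,0],
     [0,0,0,2,0,0,-2,0,0,-2,0,0,2,0,0],[-1,-1,1,0,1,0,0,1,0,0,0,0,-2,0,0],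
     [0,0,-2,-2,-2,0,2,0,0,2,2,-2,0,2,0],[-1,1,-1,-2,-1,0,0,1,-2,2,2,0,0,2,0],
     [0,0,0,-2,-2,0,2,0,-2,2,2,0,-2,2,0],[1,-1,-1,0,1,0,0,1,0,-2,0,0,0,0,0],
     [-1,-1,1,2,1,0,0,-1,0,0,-2,2,0,-2,0],[0,0,0,-2,-2,-2,2,0,0,2,0,0,0,2,0],
     [0,0,0,0,0,-2,0,-2,0,2,0,2,0,0,0],[0,0,0,-2,-2,0,0,0,0,2,2,0,0,0,0]],
    [[-2,-2,4,2,-2,2,-2,-2,-2,-2,4,-4,2,4],[-2,4,-2,2,-2,2,-2,-2,-2,4,-2,2,-4,4],
     [2,2,2,-2,2,-2,2,2,2,-4,-4,-2,-2,-4],[4,-2,-2,2,-2,2,-2,-2,-2,-2,-2,2,2,4],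
     [-2,-2,4,2,4,-4,-2,-2,-2,-2,4,2,2,-2],[-2,-2,-2,2,-2,2,-2,4,-2,4,-2,-4,2,4],
     [0,0,0,-6,0,0,6,0,6,0,-6,0,0,-6],[-2,4,-2,-4,-2,2,-2,4,-2,4,-2,2,2,-2],
     [0,0,0,0,0,0,6,0,0,0,0,-6,0,-6],[2,-4,2,-2,-4,-2,2,2,-4,2,2,-2,4,2],
     [-2,-2,-2,2,4,2,-2,-2,-2,-2,4,2,-4,4],[0,0,0,0,0,-6,6,0,6,-6,0,0,0,-6],
     [2,2,-4,-2,2,-2,-4,-4,2,2,2,4,-2,2],[0,0,0,0,0,0,0,0,6,0,0,0,-6,-6]],
    [[0,0,1,-1,1,1,1,-1,0,1,-2,-2,0,0,0,0,0],[0,2,0,-2,0,0,0,0,0,0,0,0,-2,2,0,0,0],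
     [0,0,1,1,-1,-1,-1,1,0,-1,2,0,0,-2,0,0,0],[2,0,-1,-1,1,1,1,-1,0,1,-2,-2,-2,2,0,0,0],
     [0,0,0,0,2,0,0,-2,0,0,-2,0,0,2,0,0,0],[0,0,-1,-1,1,1,1,-1,2,1,-2,0,-2,0,0,0,0],
     [-2,-2,1,3,-3,-1,-1,3,-2,-1,4,2,2,-4,0,0,0],[-2,0,0,2,-2,0,0,0,0,-2,2,2,2,-2,0,0,0],
     [0,0,-1,1,-1,-1,1,1,0,-1,0,2,0,-2,0,0,0],[0,-2,1,1,-1,1,-1,1,0,-1,0,0,2,-2,0,0,0],
     [0,0,0,-2,2,0,0,0,0,0,0,-2,0,2,0,0,0],[0,0,-1,1,-1,-1,-1,1,0,1,0,0,0,0,0,0,0],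
     [0,0,0,0,0,0,-2,0,-2,0,2,0,2,0,0,0,0],[0,0,0,0,-2,-2,0,0,0,0,2,2,0,0,0,0,0]],
    [[0,0,0,0,2,0,2,2,0,-2,0,-2,-2,-2,0,0],[0,2,0,0,0,2,2,2,-2,0,0,-2,-4,-2,0,0],
     [2,0,2,0,0,0,2,0,0,-2,-2,-2,-2,0,0,0],[0,0,-2,0,0,0,-2,0,0,2,0,0,2,0,0,0],
     [0,0,2,0,0,-2,0,0,0,-2,0,0,0,2,0,0],[-2,0,-2,0,0,0,0,0,0,2,2,0,2,-2,0,0],
     [0,-2,0,0,0,0,-2,-2,2,0,0,0,2,2,0,0],[0,0,2,2,0,-2,0,-2,0,-2,-2,2,0,2,0,0],
     [0,0,0,0,0,0,-2,-2,0,0,0,2,2,0,0,0],[0,-2,-2,0,0,0,0,0,0,0,2,0,2,0,0,0],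
     [-2,0,-2,-2,0,2,0,2,-2,4,2,0,0,-2,0,0],[0,0,0,0,-2,0,-2,-2,2,0,-2,2,2,2,0,0],
     [0,0,0,0,-2,0,-2,0,0,2,0,2,0,0,0,0],[0,0,-2,-2,0,0,0,0,0,2,2,0,0,0,0,0]],
    [[-1,1,0,-1,0,0,-1,0,-1,1,-1,1,1,1],[1,-1,0,-1,0,0,-1,0,1,-1,1,-1,1,1],
     [1,1,0,1,0,0,1,0,-1,-1,-1,-1,-1,-1],[0,0,2,0,2,-2,0,-2,0,0,0,0,2,-2],
     [-1,1,0,1,-2,0,-1,0,-1,1,1,1,-1,1],[-1,-1,0,-1,0,0,1,0,1,-1,-1,1,1,1],
     [0,0,-2,0,0,2,0,2,0,-2,0,0,-2,0],[1,-1,-2,-1,0,0,1,0,1,-1,1,1,-1,1],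
     [0,0,0,0,0,2,0,0,0,0,-2,0,-2,0],[-1,1,0,-1,0,0,1,-2,1,1,-1,1,1,-1],
     [-1,-1,0,1,0,0,-1,0,-1,1,1,-1,1,1],[0,0,0,0,-2,2,0,2,-2,0,0,0,-2,0],
     [1,-1,0,1,0,-2,-1,0,1,1,1,-1,1,-1],[0,0,0,0,0,0,0,2,0,0,0,-2,-2,0]],
    [[-1,0,1,0,-1,0,1,0,1,0,0,0,0,0,0,-2,0,0,0],[-1,1,0,1,0,1,0,-1,0,0,0,0,0,0,0,0,-2,0,0],
     [0,0,0,-1,1,0,0,1,-1,-1,-1,2,0,0,0,0,0,0,0],[0,-1,-1,0,0,1,1,0,0,-1,-1,2,0,0,0,0,0,0,0],
     [0,-1,1,0,0,-1,-1,0,0,-1,1,0,0,0,0,0,2,0,0],[-1,-1,0,1,0,1,0,1,0,0,0,0,0,0,0,-2,0,0,0],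
     [0,0,0,-1,1,0,0,-1,-1,1,-1,0,0,0,0,2,0,0,0],[0,0,0,-1,-1,0,0,1,-1,-1,1,0,0,0,0,0,2,0,0],
     [1,1,0,1,0,-1,0,-1,0,0,0,-2,0,0,0,0,0,0,0],[1,0,1,0,-1,0,-1,0,1,0,0,-2,0,0,0,0,0,0,0],
     [-1,0,-1,0,1,0,1,0,1,0,0,0,0,0,0,0,-2,0,0],[0,1,-1,0,0,-1,-1,0,0,1,-1,0,0,0,0,2,0,0,0],
     [1,0,-1,-1,0,0,-1,-1,0,1,1,0,0,0,0,0,0,0,0],[1,-1,0,0,-1,-1,0,0,-1,1,1,0,0,0,0,0,0,0,0]],
    [[0,0,1,-1,0,1,1,1,-1,0,1,-2,-2,0,0,0,0],[-1,1,1,-1,1,-1,0,-1,1,-1,-1,2,0,0,0,0,0],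
     [0,0,1,1,0,-1,-1,-1,1,0,-1,2,0,-2,0,0,0],[1,-1,0,0,1,0,1,0,0,-1,0,0,-2,0,0,0,0],
     [0,0,0,0,0,2,0,0,-2,0,0,-2,0,2,0,0,0],[-1,-1,0,0,1,0,1,0,0,1,0,0,0,-2,0,0,0],
     [-1,-1,0,2,-1,-2,-1,0,2,-1,0,2,2,-2,0,0,0],[-1,1,-1,1,-1,-1,0,1,-1,1,-1,0,2,0,0,0,0],
     [0,0,-1,1,0,-1,-1,1,1,0,-1,0,2,-2,0,0,0],[1,-1,0,0,-1,0,1,0,0,1,0,-2,0,0,0,0,0],
     [0,0,0,-2,0,2,0,0,0,0,0,0,-2,2,0,0,0],[0,0,-1,1,0,-1,-1,-1,1,0,1,0,0,0,0,0,0],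
     [1,1,-1,-1,-1,1,0,-1,-1,-1,1,0,0,2,0,0,0],[0,0,0,0,0,-2,-2,0,0,0,0,2,2,0,0,0,0]],
    [[0,0,2,-2,0,0,0,0,0,0,-2,0,0,2],[0,2,0,-2,0,0,0,0,0,0,0,-2,2,0],
     [0,0,0,2,0,0,0,0,0,0,0,0,-2,-2],[2,0,0,-2,0,0,0,0,0,0,-2,-2,2,2],
     [-1,-1,1,1,1,1,-1,-1,-1,-1,0,2,0,0],[0,0,0,-2,0,0,0,0,2,0,0,-2,0,2],
     [-1,-1,-1,3,-1,-1,1,1,-1,1,2,0,-2,-2],[-1,1,-1,1,-1,-1,1,-1,1,-1,2,0,0,0],
     [-1,-1,-1,3,1,-1,1,1,-1,-1,2,2,-4,-2],[1,-1,1,-1,-1,-1,-1,1,1,-1,0,0,0,2],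
     [0,0,0,-2,0,2,0,0,0,0,-2,0,2,0],[-1,-1,-1,3,1,-1,-1,1,-1,1,0,2,-2,-2],
     [1,1,-1,-1,-1,1,-1,-1,-1,1,0,0,2,0],[-1,-1,-1,3,1,-1,1,-1,-1,1,2,2,-2,-4]]]"

fun slacks :: "int list list \<Rightarrow> int list \<Rightarrow> int list" where
  "slacks [] n = []"
| "slacks (g # G) n = dotl g n # slacks G n"

fun all_slacks :: "int list list \<Rightarrow> (nat \<times> duad list) list \<Rightarrow> int list list" where
  "all_slacks G [] = []"
| "all_slacks G (n # N) = slacks G (act_word (snd n) (ineqs ! fst n)) # all_slacks G N"

text \<open>The supports of the neighbours on the tight generators lie below every support that the
  method produces from the relations among these generators.\<close>

definition local_check :: "nat \<Rightarrow> bool" where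
  "local_check t = dominated (tree_of (all_slacks (tight_gens t) (neighbours ! t)))
     (last_candidates (length (tight_gens t)) (relations ! t))"

definition coord_column :: "int list list \<Rightarrow> nat \<Rightarrow> int list" where
  "coord_column G n = map (\<lambda>g. g ! n) G"

lemma local_check_0: "local_check 0" by code_simp
lemma local_check_1: "local_check 1" by code_simp
lemma local_check_2: "local_check 2" by code_simp
lemma local_check_3: "local_check 3" by code_simp
lemma local_check_4: "local_check 4" by code_simp
lemma local_check_6: "local_check 6" by code_simp
lemma local_check_7: "local_check 7" by code_simp
lemma local_check_5: "local_check 5" by code_simp

lemma relations_check:
  "list_all (\<lambda>t. list_all (\<lambda>e. length e = length (tight_gens t) \<and>
     list_all (\<lambda>n. dotl e (coord_column (tight_gens t) n) = 0) [0..<15]) (relations ! t)) [0..<8]"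
  by code_simp

lemma neighbours_check:
  "list_all (\<lambda>t. list_all (\<lambda>n. fst n < 8) (neighbours ! t)) [0..<8]"
  by code_simp

lemma slacks_check:
  "list_all (\<lambda>t. list_all (list_ex (\<lambda>x. x \<noteq> 0)) (all_slacks (tight_gens t) (neighbours ! t))) [0..<8]"
  by code_simp

lemma tight_check:
  "list_all (\<lambda>t. list_all (\<lambda>x. x = 0) (slacks (tight_gens t) (ineqs ! t))) [0..<8]"
  by code_simp

lemma ineqs_check:
  "list_all (\<lambda>r. list_all (\<lambda>x. 0 \<le> x) (slacks gens r) \<and> length r = 15 \<and> hd r \<noteq> 0) ineqs"
  by code_simp

lemma kernels_check:
  "list_all (\<lambda>t. list_all (\<lambda>j. length (kernels ! t ! (j - 1)) = length (tight_gens t) \<and>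
     list_all (\<lambda>n. dotl (kernels ! t ! (j - 1)) (coord_column (tight_gens t) n) =
       4 * ((if n = j then ineqs ! t ! 0 else 0) - (if n = 0 then ineqs ! t ! j else 0))) [0..<15]) [1..<15]) [0..<8]"
  by code_simp

lemma local_check: "t < 8 \<Longrightarrow> local_check t"
  using local_check_0 local_check_1 local_check_2 local_check_3 local_check_4 local_check_5
    local_check_6 local_check_7 by (auto simp: less_Suc_eq numeral_eq_Suc)

lemma length_ineqs: "t < 8 \<Longrightarrow> length (ineqs ! t) = 15" "length ineqs = 8"
  by (auto simp: ineqs_def less_Suc_eq numeral_eq_Suc)

lemma inner_lvec: "length xs = 15 \<Longrightarrow> length ys = 15 \<Longrightarrow> lvec xs \<bullet> lvec ys = real_of_int (dotl xs ys)"
  by (simp add: lvec_def inner_vecf dotl_eq_sum)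

lemma lvec_ineqs_normal: "t < 8 \<Longrightarrow> lvec (ineqs ! t) \<in> normals"
  unfolding normals_def
  by (intro CollectI exI[of _ id] exI[of _ t]) (simp add: S6_act_id permutes_id)

lemma S6_act_normal:
  assumes "\<sigma> permutes {1..6}" "v \<in> normals"
  shows "S6_act \<sigma> v \<in> normals"
proof -
  obtain \<tau> t where v: "v = S6_act \<tau> (lvec (ineqs ! t))" "\<tau> permutes {1..6}" "t < 8"
    using assms(2) by (auto simp: normals_def)
  then have "S6_act \<sigma> v = S6_act (\<tau> \<circ> \<sigma>) (lvec (ineqs ! t))" using S6_act_comp[OF assms(1)] by simp
  moreover have "\<tau> \<circ> \<sigma> permutes {1..6}" using permutes_compose[OF assms(1) v(2)] .
  ultimately show ?thesis using v(3) unfolding normals_def by blast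
qed

lemma lvec_apply_duad:
  assumes "length xs = 15" "duad_pair d = (a, b)"
  shows "S6_act (Transposition.transpose a b) (lvec xs) = lvec (apply_duad d xs)"
  unfolding lvec_def by (rule S6_act_duad[OF assms])

lemma transpose_permutes: "duad_pair d = (a, b) \<Longrightarrow> Transposition.transpose a b permutes {1..6}"
  using duad_pair_range[of d a b] by (intro permutes_swap_id) auto

lemma act_word_normal:
  "length x = 15 \<Longrightarrow> lvec x \<in> normals \<Longrightarrow> length (act_word w x) = 15 \<and> lvec (act_word w x) \<in> normals"
proof (induction w arbitrary: x)
  case (Cons d w)
  obtain a b where d: "duad_pair d = (a, b)" by fastforce
  have "lvec (apply_duad d x) \<in> normals"
    using S6_act_normal[OF transpose_permutes[OF d] Cons.prems(2)] lvec_apply_duad[OF Cons.prems(1) d]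
    by simp
  then show ?case using Cons.IH[OF length_apply_duad[OF Cons.prems(1)]] by simp
qed simp

lemma set_select: "set (select bs xs) \<subseteq> set xs"
  by (induction bs xs rule: select.induct) auto

lemma length_slacks: "length (slacks G n) = length G"
  by (induction G) auto

lemma nth_slacks: "i < length G \<Longrightarrow> slacks G n ! i = dotl (G ! i) n"
  by (induction G arbitrary: i) (auto simp: nth_Cons split: nat.split)

lemma set_all_slacks: "set (all_slacks G N) = (\<lambda>n. slacks G (act_word (snd n) (ineqs ! fst n))) ` set N"
  by (induction N) auto

text \<open>An identity between integer columns becomes one between the values of an arbitrary
  vector on the generators; relations and kernel rows are both used in this way.\<close>

lemma linear_combination_of_generators:
  assumes "length c = length G"
  shows "(\<Sum>i<length G. real_of_int (c ! i) * (lvec (G ! i) \<bullet> vecf f))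
     = (\<Sum>n<15. real_of_int (dotl c (coord_column G n)) * f n)"
proof -
  have "dotl c (coord_column G n) = (\<Sum>i<length G. c ! i * G ! i ! n)" for n
    using assms by (simp add: dotl_eq_sum[of c "length G"] coord_column_def)
  then have "(\<Sum>n<15. real_of_int (dotl c (coord_column G n)) * f n)
      = (\<Sum>n<15. \<Sum>i<length G. real_of_int (c ! i) * real_of_int (G ! i ! n) * f n)"
    by (simp add: sum_distrib_right)
  also have "\<dots> = (\<Sum>i<length G. \<Sum>n<15. real_of_int (c ! i) * real_of_int (G ! i ! n) * f n)"
    by (rule sum.swap)
  also have "\<dots> = (\<Sum>i<length G. real_of_int (c ! i) * (lvec (G ! i) \<bullet> vecf f))"
    by (simp add: lvec_def inner_vecf sum_distrib_left mult.assoc)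
  finally show ?thesis by simp
qed

text \<open>Applied to y, the rows of \<open>kernels\<close> give
  \<open>r\<^sub>0 y\<^sub>j = r\<^sub>j y\<^sub>0\<close> for all j. The first coordinate of every
  representative is nonzero, so y is a multiple of r.\<close>

lemma tight_gens_kernel:
  assumes t: "t < 8" and y: "\<And>g. g \<in> set (tight_gens t) \<Longrightarrow> lvec g \<bullet> y = 0"
  shows "\<exists>\<alpha>. y = \<alpha> *\<^sub>R lvec (ineqs ! t)"
proof -
  obtain f where f: "y = vecf f" using vecf_surj by metis
  define r where "r = ineqs ! t"
  define G where "G = tight_gens t"
  have "r \<in> set ineqs" using t length_ineqs(2) by (simp add: r_def)
  then have "hd r \<noteq> 0" "length r = 15" using ineqs_check by (auto simp: list_all_iff)
  then have r0: "r ! 0 \<noteq> 0" by (cases r) auto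
  have "real_of_int (r ! 0) * f j = real_of_int (r ! j) * f 0" if j: "j < 15" for j
  proof (cases "j = 0")
    case False
    define c where "c = kernels ! t ! (j - 1)"
    have "j \<in> set [1..<15]" "t \<in> set [0..<8]" using j False t by auto
    then have "length c = length G \<and> list_all (\<lambda>n. dotl c (coord_column G n) =
       4 * ((if n = j then r ! 0 else 0) - (if n = 0 then r ! j else 0))) [0..<15]"
      using kernels_check unfolding list_all_iff c_def G_def r_def by blast
    then have c: "length c = length G" "\<And>n. n < 15 \<Longrightarrow> dotl c (coord_column G n) =
       4 * ((if n = j then r ! 0 else 0) - (if n = 0 then r ! j else 0))" by (auto simp: list_all_iff)
    have "0 = (\<Sum>i<length G. real_of_int (c ! i) * (lvec (G ! i) \<bullet> vecf f))"
      using y by (simp add: G_def f)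
    also have "\<dots> = (\<Sum>n<15. real_of_int (dotl c (coord_column G n)) * f n)"
      by (rule linear_combination_of_generators[OF c(1)])
    also have "\<dots> = (\<Sum>n<15. (if n = j then 4 * real_of_int (r ! 0) * f j else 0)
        - (if n = 0 then 4 * real_of_int (r ! j) * f 0 else 0))"
      using False by (intro sum.cong refl) (auto simp: c(2))
    also have "\<dots> = 4 * real_of_int (r ! 0) * f j - 4 * real_of_int (r ! j) * f 0"
      using j by (simp add: sum_subtractf)
    finally show ?thesis by simp
  qed simp
  then have "f j = f 0 / real_of_int (r ! 0) * real_of_int (r ! j)" if "j < 15" for j
    using that r0 by (simp add: field_simps)
  then have "y = (f 0 / real_of_int (r ! 0)) *\<^sub>R lvec r"
    unfolding f lvec_def scaleR_vecf vecf_eq_iff by blast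
  then show ?thesis unfolding r_def by blast
qed

lemma tight_gens_gens: "set (tight_gens t) \<subseteq> set gens"
  unfolding tight_gens_def by (rule set_select)

lemma normal_nonneg:
  assumes "t < 8" "g \<in> set gens"
  shows "0 \<le> lvec g \<bullet> lvec (ineqs ! t)"
proof -
  obtain i where i: "i < length gens" "g = gens ! i" using assms(2) by (metis in_set_conv_nth)
  have "ineqs ! t \<in> set ineqs" using assms(1) length_ineqs(2) by simp
  then have "\<forall>x\<in>set (slacks gens (ineqs ! t)). 0 \<le> x" using ineqs_check by (auto simp: list_all_iff)
  then have "0 \<le> dotl g (ineqs ! t)" using nth_slacks[OF i(1)] i length_slacks nth_mem by metis
  then show ?thesis
    using inner_lvec gens_length(2)[OF assms(2)] length_ineqs(1)[OF assms(1)] by simp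
qed

lemma tight_gens_tight:
  assumes "t < 8" "g \<in> set (tight_gens t)"
  shows "lvec g \<bullet> lvec (ineqs ! t) = 0"
proof -
  obtain i where i: "i < length (tight_gens t)" "g = tight_gens t ! i"
    using assms(2) by (metis in_set_conv_nth)
  have "t \<in> set [0..<8]" using assms(1) by simp
  then have "\<forall>x\<in>set (slacks (tight_gens t) (ineqs ! t)). x = 0"
    using tight_check unfolding list_all_iff by blast
  then have "dotl g (ineqs ! t) = 0" using nth_slacks[OF i(1)] i length_slacks nth_mem by metis
  moreover have "length g = 15" using gens_length(2) tight_gens_gens assms(2) by blast
  ultimately show ?thesis using inner_lvec length_ineqs(1)[OF assms(1)] by simp
qed

lemma dual_cone_nonneg_S6:
  assumes "\<sigma> permutes {1..6}" "\<forall>x\<in>C62. 0 \<le> x \<bullet> y"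
  shows "\<forall>x\<in>C62. 0 \<le> x \<bullet> S6_act \<sigma> y"
proof
  fix x assume x: "x \<in> C62"
  have "S6_act (inv \<sigma>) x \<in> C62" using S6_act_C62[OF permutes_inv[OF assms(1)]] x by blast
  then have "0 \<le> S6_act (inv \<sigma>) x \<bullet> y" using assms(2) by blast
  also have "S6_act (inv \<sigma>) x \<bullet> y = x \<bullet> S6_act \<sigma> y"
    using inner_S6_act_left[OF permutes_inv[OF assms(1)], of x y] permutes_inv_inv[OF assms(1)]
    by simp
  finally show "0 \<le> x \<bullet> S6_act \<sigma> y" .
qed

lemma dual_cone_iff: "(\<forall>x\<in>C62. 0 \<le> x \<bullet> y) \<longleftrightarrow> (\<forall>g\<in>set gens. 0 \<le> lvec g \<bullet> y)"
proof
  assume "\<forall>x\<in>C62. 0 \<le> x \<bullet> y"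
  then show "\<forall>g\<in>set gens. 0 \<le> lvec g \<bullet> y"
    unfolding C62_eq using hull_inc[of _ "lvec ` set gens" convex_cone] by blast
next
  assume *: "\<forall>g\<in>set gens. 0 \<le> lvec g \<bullet> y"
  have "convex_cone {x. 0 \<le> x \<bullet> y}"
    by (auto simp: convex_cone_iff inner_add_left)
  then have "C62 \<subseteq> {x. 0 \<le> x \<bullet> y}" unfolding C62_eq using * by (intro hull_minimal) auto
  then show "\<forall>x\<in>C62. 0 \<le> x \<bullet> y" by blast
qed

lemma normals_in_dual_cone: "v \<in> normals \<Longrightarrow> \<forall>x\<in>C62. 0 \<le> x \<bullet> v"
  unfolding normals_def using dual_cone_nonneg_S6 dual_cone_iff normal_nonneg by (clarify, metis)

text \<open>At a representative normal r, the elements of the dual cone are described, modulo r, by their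
  values on the tight generators. Every such nonzero value vector dominates, in support, that of a
  neighbouring normal, which can be subtracted until a further value vanishes.\<close>

lemma local_decomposition:
  assumes t: "t < 8"
  shows "(\<forall>g\<in>set (tight_gens t). 0 \<le> lvec g \<bullet> y) \<Longrightarrow>
    \<exists>\<alpha> k. k \<in> convex_cone hull normals \<and> y = \<alpha> *\<^sub>R lvec (ineqs ! t) + k"
proof (induction "card {i. i < length (tight_gens t) \<and> lvec (tight_gens t ! i) \<bullet> y \<noteq> 0}" arbitrary: y rule: less_induct)
  case less
  define G where "G = tight_gens t"
  define m where "m = length G"
  define E where "E = relations ! t"
  define S where "S = all_slacks G (neighbours ! t)"
  define v where "v y i = lvec (G ! i) \<bullet> y" for y i
  have tt: "t \<in> set [0..<8]" using t by simp
  have rel: "length e = m \<and> (\<forall>n<15. dotl e (coord_column G n) = 0)" if "e \<in> set E" for e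
    using relations_check tt that unfolding list_all_iff E_def m_def G_def by fastforce
  have lenS: "length s = m \<and> (\<exists>i<m. s ! i \<noteq> 0)" if s: "s \<in> set S" for s
  proof -
    have "length s = m"
      using s unfolding S_def set_all_slacks m_def using length_slacks by fastforce
    moreover have "list_ex (\<lambda>x. x \<noteq> 0) s"
      using slacks_check tt s unfolding list_all_iff S_def G_def by blast
    ultimately show ?thesis by (auto simp: list_ex_length)
  qed
  have "dominated (tree_of S) (last_candidates m E)"
    using local_check[OF t] by (simp add: local_check_def S_def G_def m_def E_def)
  then have cov: "covers m E (set S)" using last_candidates_covers[of E m S] rel lenS by blast
  have nonneg: "0 \<le> v y i" if "i < m" for i using less.prems that by (simp add: v_def G_def m_def)
  \<comment> \<open>A linear relation between the tight generators annihilates the values of any y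
    on them.\<close>
  have "lin m (\<lambda>i. real_of_int (e ! i)) (v y) = 0" if e: "e \<in> set E" for e
  proof -
    obtain f where f: "y = vecf f" using vecf_surj by metis
    have "lin m (\<lambda>i. real_of_int (e ! i)) (v y) = (\<Sum>n<15. real_of_int (dotl e (coord_column G n)) * f n)"
      using rel[OF e] linear_combination_of_generators[of e G f]
      by (simp add: lin_def v_def f m_def)
    also have "\<dots> = 0" using rel[OF e] by simp
    finally show ?thesis .
  qed
  then have sol: "sol m E (v y)" using nonneg by (simp add: sol_def)
  show ?case
  proof (cases "\<exists>i<m. v y i \<noteq> 0")
    case False
    \<comment> \<open>Now y is orthogonal to all tight generators, hence on the line through the
      normal.\<close>
    have "lvec g \<bullet> y = 0" if "g \<in> set (tight_gens t)" for g
      using that False by (metis G_def in_set_conv_nth m_def v_def)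
    then obtain \<alpha> where "y = \<alpha> *\<^sub>R lvec (ineqs ! t)" using tight_gens_kernel[OF t] by blast
    then show ?thesis by (intro exI[of _ \<alpha>] exI[of _ 0]) (simp add: convex_cone_hull_contains_0)
  next
    case True
    then obtain s where s: "s \<in> set S" "\<exists>i<m. s ! i \<noteq> 0" "\<forall>i<m. s ! i \<noteq> 0 \<longrightarrow> v y i \<noteq> 0"
      using cov sol unfolding covers_def by blast
    obtain n where n: "n \<in> set (neighbours ! t)" "s = slacks G (act_word (snd n) (ineqs ! fst n))"
      using s(1) by (auto simp: S_def set_all_slacks)
    define x where "x = act_word (snd n) (ineqs ! fst n)"
    have "fst n < 8" using neighbours_check tt n(1) unfolding list_all_iff by blast
    then have x: "length x = 15" "lvec x \<in> normals"
      using act_word_normal length_ineqs(1) lvec_ineqs_normal unfolding x_def by blast+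
    have G15: "length (G ! i) = 15" "G ! i \<in> set gens" if "i < m" for i
      using gens_length(2) tight_gens_gens that nth_mem unfolding G_def m_def by blast+
    have sv: "real_of_int (s ! i) = v (lvec x) i" if "i < m" for i
      using that nth_slacks[of i G x] n(2) inner_lvec[OF G15(1)[OF that] x(1)]
      by (simp add: x_def v_def m_def)
    have xnn: "0 \<le> v (lvec x) i" if "i < m" for i
      using normals_in_dual_cone[OF x(2)] dual_cone_iff G15(2)[OF that] by (auto simp: v_def)
    have xnz: "\<exists>i<m. v (lvec x) i \<noteq> 0" using s(2) sv by fastforce
    have xsub: "v y i \<noteq> 0" if "i < m" "v (lvec x) i \<noteq> 0" for i
      using s(3) sv[OF that(1)] that by fastforce
    obtain q where q: "0 < q" "\<forall>i<m. 0 \<le> v y i - q * v (lvec x) i"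
      "{i. i < m \<and> v y i - q * v (lvec x) i \<noteq> 0} \<subset> {i. i < m \<and> v y i \<noteq> 0}"
      by (rule subtract_until_zero[OF nonneg xnn xnz xsub])
    define y' where "y' = y - q *\<^sub>R lvec x"
    have vy': "v y' i = v y i - q * v (lvec x) i" for i by (simp add: v_def y'_def inner_diff_right)
    have "card {i. i < m \<and> v y' i \<noteq> 0} < card {i. i < m \<and> v y i \<noteq> 0}"
      unfolding vy' using q(3) by (intro psubset_card_mono) auto
    moreover have "\<forall>g\<in>set (tight_gens t). 0 \<le> lvec g \<bullet> y'"
      using q(2) unfolding vy'[symmetric] by (metis G_def in_set_conv_nth m_def v_def)
    ultimately obtain \<alpha> k where k: "k \<in> convex_cone hull normals" "y' = \<alpha> *\<^sub>R lvec (ineqs ! t) + k"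
      using less.hyps[of y'] unfolding v_def m_def G_def by blast
    have "k + q *\<^sub>R lvec x \<in> convex_cone hull normals"
      using q(1) by (intro convex_cone_hull_add[OF k(1)] convex_cone_hull_mul hull_inc x(2)) simp
    moreover have "y = \<alpha> *\<^sub>R lvec (ineqs ! t) + (k + q *\<^sub>R lvec x)"
      using k(2) by (simp add: y'_def algebra_simps)
    ultimately show ?thesis by blast
  qed
qed

section \<open>The dual cone and the facets\<close>

definition ones :: "real^15" where
  "ones = vecf (\<lambda>n. 1)"

text \<open>A pair partition shares no pair with 8 of the others, and all its pairs are separated by
  4 of the ten splittings into triples. Hence the generators add up to 12 times
  \<open>ones\<close>.\<close>

lemma gens_columns_check: "list_all (\<lambda>n. dotl (replicate 25 1) (coord_column gens n) = 12) [0..<15]"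
  by code_simp

lemma ineqs_sum_check: "list_all (\<lambda>r. 0 < sum_list r) ineqs"
  by code_simp

lemma inner_ones: "ones \<bullet> v = (\<Sum>i\<in>UNIV. v $ i)"
  by (simp add: ones_def vecf_def inner_vec_def)

text \<open>\<open>ones\<close> is a positive multiple of the sum of the generators. The coordinate
  sum can therefore serve as the normalising functional on the dual cone.\<close>

lemma inner_ones_nonneg:
  assumes "\<forall>x\<in>C62. 0 \<le> x \<bullet> y"
  shows "0 \<le> ones \<bullet> y"
proof -
  obtain f where f: "y = vecf f" using vecf_surj by metis
  have "0 \<le> (\<Sum>i<length gens. lvec (gens ! i) \<bullet> vecf f)"
    using assms unfolding dual_cone_iff f by (intro sum_nonneg) auto
  also have "\<dots> = (\<Sum>n<15. real_of_int (dotl (replicate 25 1) (coord_column gens n)) * f n)"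
    using linear_combination_of_generators[of "replicate 25 1" gens f] gens_length(1) by simp
  also have "\<dots> = 12 * (ones \<bullet> y)"
    using gens_columns_check by (simp add: list_all_iff ones_def f inner_vecf sum_distrib_left)
  finally show ?thesis by simp
qed

text \<open>The function \<phi> allows for sums of coordinates and for sums of their fourth powers,
  both of which identify the type of a normal.\<close>

lemma sum_S6_act:
  fixes \<phi> :: "real \<Rightarrow> real"
  assumes "\<sigma> permutes {1..6}"
  shows "(\<Sum>i\<in>UNIV. \<phi> (S6_act \<sigma> x $ i)) = (\<Sum>i\<in>UNIV. \<phi> (x $ i))"
proof -
  have eq: "(\<chi> i. \<phi> (S6_act \<sigma> x $ i)) = S6_act \<sigma> (\<chi> i. \<phi> (x $ i))"
    by (simp add: S6_act_def vec_eq_iff)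
  have o: "S6_act \<sigma> ones = ones" by (simp add: S6_act_def ones_def vecf_def vec_eq_iff)
  have "(\<Sum>i\<in>UNIV. \<phi> (S6_act \<sigma> x $ i)) = ones \<bullet> (\<chi> i. \<phi> (S6_act \<sigma> x $ i))" by (simp add: inner_ones)
  also have "\<dots> = S6_act \<sigma> ones \<bullet> S6_act \<sigma> (\<chi> i. \<phi> (x $ i))" by (simp only: eq o)
  also have "\<dots> = ones \<bullet> (\<chi> i. \<phi> (x $ i))" by (rule inner_S6_act[OF assms])
  finally show ?thesis by (simp add: inner_ones)
qed

lemma sum_lvec: "(\<Sum>i\<in>UNIV. \<phi> (lvec xs $ i)) = (\<Sum>n<15. \<phi> (real_of_int (xs ! n)))"
  unfolding lvec_def vecf_def vec_lambda_beta
  by (rule sum.reindex_bij_betw[OF idx_minus_1_bij, of "\<lambda>n. \<phi> (real_of_int (xs ! n))"])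

lemma normalE:
  assumes "v \<in> normals"
  obtains \<sigma> t where "v = S6_act \<sigma> (lvec (ineqs ! t))" "\<sigma> permutes {1..6}" "t < 8"
  using assms unfolding normals_def by blast

lemma normal_sum_pos: "v \<in> normals \<Longrightarrow> 0 < ones \<bullet> v"
proof (erule normalE)
  fix \<sigma> t assume v: "v = S6_act \<sigma> (lvec (ineqs ! t))" "\<sigma> permutes {1..6}" "t < 8"
  have "ineqs ! t \<in> set ineqs" using v(3) length_ineqs(2) by simp
  then have "0 < sum_list (ineqs ! t)" using ineqs_sum_check by (auto simp: list_all_iff)
  then have "0 < (\<Sum>n<15. ineqs ! t ! n)"
    using length_ineqs(1)[OF v(3)] by (simp add: sum_list_sum_nth atLeast0LessThan)
  moreover have "ones \<bullet> v = real_of_int (\<Sum>n<15. ineqs ! t ! n)"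
    using sum_S6_act[OF v(2), of "\<lambda>x. x"] sum_lvec[of "\<lambda>x. x"] by (simp add: v(1) inner_ones)
  ultimately show "0 < ones \<bullet> v" by (metis of_int_0_less_iff)
qed

lemma finite_normals: "finite normals"
proof -
  have "normals = (\<lambda>(\<sigma>, t). S6_act \<sigma> (lvec (ineqs ! t))) ` ({\<sigma>. \<sigma> permutes {1..6}} \<times> {..<8})"
    by (auto simp: normals_def)
  then show ?thesis
    by (metis finite_SigmaI finite_atLeastAtMost finite_imageI finite_lessThan finite_permutations)
qed

lemma normal_decomposition:
  assumes v: "v \<in> normals" and y: "\<forall>x\<in>C62. 0 \<le> x \<bullet> y"
  shows "\<exists>\<alpha> k. k \<in> convex_cone hull normals \<and> y = \<alpha> *\<^sub>R v + k"
proof -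
  obtain \<sigma> t where \<sigma>: "v = S6_act \<sigma> (lvec (ineqs ! t))" "\<sigma> permutes {1..6}" "t < 8"
    using normalE[OF v] by metis
  have "\<forall>x\<in>C62. 0 \<le> x \<bullet> S6_act (inv \<sigma>) y" using dual_cone_nonneg_S6[OF permutes_inv[OF \<sigma>(2)] y] .
  then have "\<forall>g\<in>set (tight_gens t). 0 \<le> lvec g \<bullet> S6_act (inv \<sigma>) y"
    using tight_gens_gens[of t] unfolding dual_cone_iff by blast
  then obtain \<alpha> k where k: "k \<in> convex_cone hull normals" "S6_act (inv \<sigma>) y = \<alpha> *\<^sub>R lvec (ineqs ! t) + k"
    using local_decomposition[OF \<sigma>(3)] by blast
  have "y = S6_act \<sigma> (S6_act (inv \<sigma>) y)" by (simp add: S6_act_inv[OF \<sigma>(2)])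
  also have "\<dots> = \<alpha> *\<^sub>R v + S6_act \<sigma> k"
    unfolding k(2) \<sigma>(1) by (simp add: linear_add[OF linear_S6_act] linear_cmul[OF linear_S6_act])
  finally have "y = \<alpha> *\<^sub>R v + S6_act \<sigma> k" .
  moreover have "S6_act \<sigma> k \<in> convex_cone hull normals"
  proof -
    have "S6_act \<sigma> k \<in> convex_cone hull (S6_act \<sigma> ` normals)"
      unfolding convex_cone_hull_linear_image[OF linear_S6_act] using k(1) by blast
    also have "\<dots> \<subseteq> convex_cone hull normals" using S6_act_normal[OF \<sigma>(2)] by (intro hull_mono) auto
    finally show ?thesis .
  qed
  ultimately show ?thesis by blast
qed

text \<open>The optimality argument of the simplex method: a separating functional attains its minimal
  ratio to the coordinate sum at some normal v, and the decomposition at v shows that it cannot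
  separate.\<close>

lemma dual_cone_generated:
  assumes y: "\<forall>x\<in>C62. 0 \<le> x \<bullet> y"
  shows "y \<in> convex_cone hull normals"
proof (rule ccontr)
  let ?K = "convex_cone hull normals"
  assume "y \<notin> ?K"
  then obtain f b where fb: "f \<bullet> y < b" "\<And>x. x \<in> ?K \<Longrightarrow> b < f \<bullet> x"
    using separating_hyperplane_closed_point[OF convex_convex_cone_hull closed_convex_cone_hull[OF finite_normals]]
    by blast
  have "b < 0" using fb(2)[OF convex_cone_hull_contains_0] by simp
  then have fy: "f \<bullet> y < 0" using fb(1) by simp
  have fK: "0 \<le> f \<bullet> x" if x: "x \<in> ?K" for x
  proof (rule ccontr)
    assume "\<not> 0 \<le> f \<bullet> x"
    then have neg: "f \<bullet> x < 0" by simp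
    \<comment> \<open>The multiple is chosen so that f takes exactly the value b on it, against the
      strict separation.\<close>
    have "(b / (f \<bullet> x)) *\<^sub>R x \<in> ?K"
      using x neg \<open>b < 0\<close> by (intro convex_cone_hull_mul) (auto simp: divide_nonpos_neg)
    from fb(2)[OF this] show False using neg by simp
  qed
  have ne: "normals \<noteq> {}" using lvec_ineqs_normal[of 0] by auto
  define m where "m = Min ((\<lambda>v. (f \<bullet> v) / (ones \<bullet> v)) ` normals)"
  have "m \<in> (\<lambda>v. (f \<bullet> v) / (ones \<bullet> v)) ` normals"
    unfolding m_def using finite_normals ne by (intro Min_in) auto
  then obtain v where v: "v \<in> normals" "m = (f \<bullet> v) / (ones \<bullet> v)" by auto
  have mle: "m \<le> (f \<bullet> w) / (ones \<bullet> w)" if "w \<in> normals" for w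
    unfolding m_def using finite_normals that by (intro Min_le) auto
  have m0: "0 \<le> m" using v fK[OF hull_inc[OF v(1)]] normal_sum_pos[OF v(1)] by simp
  \<comment> \<open>This functional vanishes at v and is nonnegative on all normals. Since
    \<open>0 \<le> m\<close>, it does not exceed f on the dual cone, so the separation of y would
    persist.\<close>
  define f' where "f' = f - m *\<^sub>R ones"
  have f'v: "f' \<bullet> v = 0" using v normal_sum_pos[OF v(1)] by (simp add: f'_def inner_diff_left)
  have f'w: "0 \<le> f' \<bullet> w" if "w \<in> normals" for w
    using mle[OF that] normal_sum_pos[OF that] by (simp add: f'_def inner_diff_left field_simps)
  have "convex_cone {x. 0 \<le> f' \<bullet> x}" by (auto simp: convex_cone_iff inner_add_right)
  then have f'K: "?K \<subseteq> {x. 0 \<le> f' \<bullet> x}" using f'w by (intro hull_minimal) auto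
  obtain \<alpha> k where k: "k \<in> ?K" "y = \<alpha> *\<^sub>R v + k" using normal_decomposition[OF v(1) y] by blast
  have "0 \<le> f' \<bullet> y" using f'K k f'v by (auto simp: inner_add_right)
  moreover have "f' \<bullet> y \<le> f \<bullet> y"
    using m0 inner_ones_nonneg[OF y] by (simp add: f'_def inner_diff_left)
  ultimately show False using fy by simp
qed

section \<open>Exposed faces, dimensions and facets\<close>

definition exposed :: "real^15 \<Rightarrow> (real^15) set" where
  "exposed a = C62 \<inter> {x. a \<bullet> x = 0}"

lemma S6_act_exposed:
  assumes "\<sigma> permutes {1..6}"
  shows "S6_act \<sigma> ` exposed a = exposed (S6_act \<sigma> a)"
proof (intro set_eqI iffI)
  fix x assume "x \<in> S6_act \<sigma> ` exposed a"
  then obtain z where z: "x = S6_act \<sigma> z" "z \<in> C62" "a \<bullet> z = 0" by (auto simp: exposed_def)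
  then show "x \<in> exposed (S6_act \<sigma> a)"
    using S6_act_C62[OF assms] inner_S6_act[OF assms, of a z] by (auto simp: exposed_def)
next
  fix x assume x: "x \<in> exposed (S6_act \<sigma> a)"
  have "S6_act (inv \<sigma>) x \<in> C62"
    using S6_act_C62[OF permutes_inv[OF assms]] x by (auto simp: exposed_def)
  moreover have "a \<bullet> S6_act (inv \<sigma>) x = 0"
    using x inner_S6_act_left[OF assms, of a x] by (simp add: exposed_def)
  ultimately show "x \<in> S6_act \<sigma> ` exposed a"
    by (intro image_eqI[of _ _ "S6_act (inv \<sigma>) x"]) (auto simp: exposed_def S6_act_inv[OF assms])
qed

text \<open>The face contains the transported tight generators, which span a hyperplane. This
  determines the dimension of the face and also its normal up to a factor.\<close>

lemma exposed_kernel: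
  assumes a: "a \<in> normals" and v: "\<And>x. x \<in> exposed a \<Longrightarrow> v \<bullet> x = 0"
  shows "\<exists>\<alpha>. v = \<alpha> *\<^sub>R a"
proof -
  obtain \<sigma> t where \<sigma>: "a = S6_act \<sigma> (lvec (ineqs ! t))" "\<sigma> permutes {1..6}" "t < 8"
    using normalE[OF a] by metis
  have "lvec g \<bullet> S6_act (inv \<sigma>) v = 0" if g: "g \<in> set (tight_gens t)" for g
  proof -
    have "lvec g \<in> C62" unfolding C62_eq using tight_gens_gens g by (intro hull_inc) auto
    then have "lvec g \<in> exposed (lvec (ineqs ! t))"
      using tight_gens_tight[OF \<sigma>(3) g] by (simp add: exposed_def inner_commute)
    then have "S6_act \<sigma> (lvec g) \<in> exposed a"
      unfolding \<sigma>(1) S6_act_exposed[OF \<sigma>(2), symmetric] by blast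
    then have "v \<bullet> S6_act \<sigma> (lvec g) = 0" by (rule v)
    then show ?thesis using inner_S6_act_left[OF \<sigma>(2), of "lvec g" v] by (simp add: inner_commute)
  qed
  then obtain \<alpha> where "S6_act (inv \<sigma>) v = \<alpha> *\<^sub>R lvec (ineqs ! t)"
    using tight_gens_kernel[OF \<sigma>(3)] by blast
  then have "S6_act \<sigma> (S6_act (inv \<sigma>) v) = \<alpha> *\<^sub>R a"
    by (simp add: \<sigma>(1) linear_cmul[OF linear_S6_act])
  then show ?thesis by (auto simp: S6_act_inv[OF \<sigma>(2)])
qed

text \<open>The part of x orthogonal to the span of S is a multiple of a; as x itself is orthogonal
  to a, that part is orthogonal to itself.\<close>

lemma span_contains_hyperplane:
  fixes a :: "'a::euclidean_space"
  assumes "\<And>v. (\<And>x. x \<in> S \<Longrightarrow> v \<bullet> x = 0) \<Longrightarrow> \<exists>\<alpha>. v = \<alpha> *\<^sub>R a"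
  shows "{x. a \<bullet> x = 0} \<subseteq> span S"
proof
  fix x assume x: "x \<in> {x. a \<bullet> x = 0}"
  obtain y z where yz: "y \<in> span S" "\<And>w. w \<in> span S \<Longrightarrow> orthogonal z w" "x = y + z"
    using orthogonal_subspace_decomp_exists[of S x] by metis
  have "z \<bullet> w = 0" if "w \<in> S" for w using yz(2)[OF span_base[OF that]] by (simp add: orthogonal_def)
  then obtain \<alpha> where \<alpha>: "z = \<alpha> *\<^sub>R a" using assms by blast
  have "z \<bullet> y = 0" using yz(2)[OF yz(1)] by (simp add: orthogonal_def)
  moreover have "z \<bullet> x = 0" using \<alpha> x by simp
  ultimately have "z \<bullet> z = 0" unfolding yz(3) by (simp add: inner_add_right)
  then show "x \<in> span S" using yz by simp
qed

lemma zero_in_C62: "0 \<in> C62"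
  unfolding C62_def by (rule convex_cone_hull_contains_0)

lemma ones_in_C62: "ones \<in> C62"
proof -
  have "12 *\<^sub>R ones = (\<Sum>g\<leftarrow>gens. lvec g)"
  proof -
    have "12 *\<^sub>R ones \<bullet> vecf f = (\<Sum>g\<leftarrow>gens. lvec g) \<bullet> vecf f" for f
    proof -
      have "(\<Sum>g\<leftarrow>gens. lvec g) \<bullet> vecf f = (\<Sum>i<length gens. lvec (gens ! i) \<bullet> vecf f)"
        by (simp add: sum_list_sum_nth inner_sum_left atLeast0LessThan)
      also have "\<dots> = (\<Sum>n<15. real_of_int (dotl (replicate 25 1) (coord_column gens n)) * f n)"
        using linear_combination_of_generators[of "replicate 25 1" gens f] gens_length(1) by simp
      also have "\<dots> = 12 *\<^sub>R ones \<bullet> vecf f"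
        using gens_columns_check by (simp add: list_all_iff ones_def inner_vecf sum_distrib_left)
      finally show ?thesis by simp
    qed
    then have "12 *\<^sub>R ones \<bullet> z = (\<Sum>g\<leftarrow>gens. lvec g) \<bullet> z" for z using vecf_surj[of z] by metis
    then show ?thesis by (metis vector_eq_rdot)
  qed
  moreover have "(\<Sum>g\<leftarrow>gens. lvec g) \<in> C62"
    unfolding C62_eq
    by (intro sum_list_in_convex_cone convex_cone_convex_cone_hull) (auto intro: hull_inc)
  ultimately have "12 *\<^sub>R ones \<in> C62" by simp
  then have "(1/12) *\<^sub>R (12 *\<^sub>R ones) \<in> C62"
    unfolding C62_def by (rule convex_cone_hull_mul) simp
  then show ?thesis by simp
qed

lemma aff_dim_C62: "aff_dim C62 = 15"
proof -
  obtain a where a: "a \<in> normals" using lvec_ineqs_normal[of 0] by auto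
  have "span C62 = UNIV"
  proof -
    \<comment> \<open>With normal vector 0 the hyperplane is the whole space. The condition then
      says that only 0 is orthogonal to \<open>C62\<close>: any such vector is a multiple of a, and
      a is positive on \<open>ones\<close>.\<close>
    have "{x. 0 \<bullet> x = 0} \<subseteq> span C62"
    proof (rule span_contains_hyperplane)
      fix v assume v: "\<And>x. x \<in> C62 \<Longrightarrow> v \<bullet> x = 0"
      then obtain \<alpha> where \<alpha>: "v = \<alpha> *\<^sub>R a"
        using exposed_kernel[OF a, of v] by (auto simp: exposed_def)
      have "\<alpha> * (ones \<bullet> a) = 0" using v[OF ones_in_C62] \<alpha> by (simp add: inner_commute)
      then have "\<alpha> = 0" using normal_sum_pos[OF a] by simp
      then show "\<exists>\<alpha>. v = \<alpha> *\<^sub>R 0" using \<alpha> by simp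
    qed
    then show ?thesis by auto
  qed
  then have "dim C62 = DIM(real^15)" using dim_span[of C62] dim_UNIV[where 'a = "real^15"] by simp
  then have "dim C62 = 15" by simp
  moreover have "0 \<in> affine hull C62" using zero_in_C62 by (rule hull_inc)
  ultimately show ?thesis by (simp add: aff_dim_zero)
qed

lemma exposed_facet:
  assumes a: "a \<in> normals"
  shows "exposed a facet_of C62"
proof -
  have "0 \<in> exposed a" using zero_in_C62 by (simp add: exposed_def)
  have a0: "a \<noteq> 0" using normal_sum_pos[OF a] by auto
  have "exposed a face_of C62"
    unfolding exposed_def
  proof (rule face_of_Int_supporting_hyperplane_ge)
    show "convex C62" unfolding C62_def by (rule convex_convex_cone_hull)
    show "a \<bullet> x \<ge> 0" if "x \<in> C62" for x
      using normals_in_dual_cone[OF a] that by (metis inner_commute)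
  qed
  moreover have "aff_dim (exposed a) = 14"
  proof -
    have "{x. a \<bullet> x = 0} \<subseteq> span (exposed a)"
      by (rule span_contains_hyperplane) (rule exposed_kernel[OF a])
    moreover have "span (exposed a) \<subseteq> {x. a \<bullet> x = 0}"
      by (intro span_minimal) (auto simp: exposed_def subspace_hyperplane)
    ultimately have "span (exposed a) = {x. a \<bullet> x = 0}" by blast
    then have "dim (exposed a) = DIM(real^15) - 1" using dim_hyperplane[OF a0] by (metis dim_span)
    then show ?thesis
      using \<open>0 \<in> exposed a\<close> hull_inc[of 0 "exposed a" affine] by (simp add: aff_dim_zero)
  qed
  ultimately show ?thesis using \<open>0 \<in> exposed a\<close> aff_dim_C62 by (auto simp: facet_of_def)
qed

lemma polyhedron_C62: "polyhedron C62"
  unfolding C62_eq by (intro polyhedron_convex_cone_hull) auto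

lemma C62_add: "x \<in> C62 \<Longrightarrow> y \<in> C62 \<Longrightarrow> x + y \<in> C62"
  unfolding C62_def by (rule convex_cone_hull_add)

text \<open>If F lay in no exposed face of a normal, a sum of witnesses from F would be strictly
  positive under every normal, hence under every nonzero element of the dual cone. But the nonzero
  vector \<open>- a\<close> that defines F vanishes there. So F lies in some exposed face, and equal
  dimensions give equality.\<close>

lemma facet_is_exposed:
  assumes F: "F facet_of C62"
  shows "\<exists>l\<in>normals. F = exposed l"
proof -
  obtain a b where ab: "a \<noteq> 0" "C62 \<subseteq> {x. a \<bullet> x \<le> b}" "F = C62 \<inter> {x. a \<bullet> x = b}"
    using facet_of_polyhedron[OF polyhedron_C62 F] by metis
  have "F \<noteq> {}" using F by (simp add: facet_of_def)
  then obtain x0 where x0: "x0 \<in> C62" "a \<bullet> x0 = b" using ab(3) by auto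
  \<comment> \<open>A supporting hyperplane of a cone passes through 0: doubling a point gives
    \<open>b + b \<le> b\<close>, and the apex gives \<open>0 \<le> b\<close>.\<close>
  have "a \<bullet> (x0 + x0) \<le> b" using ab(2) C62_add[OF x0(1) x0(1)] by blast
  then have "b + b \<le> b" unfolding inner_add_right x0(2) .
  moreover have "0 \<le> b" using ab(2) zero_in_C62 by auto
  ultimately have b: "b = 0" by simp
  have "- a \<in> convex_cone hull normals"
    using ab(2) b by (intro dual_cone_generated) (auto simp: inner_commute)
  have "\<exists>l\<in>normals. F \<subseteq> exposed l"
  proof (rule ccontr)
    assume "\<not> ?thesis"
    then have "\<forall>l\<in>normals. \<exists>x. x \<in> F \<and> l \<bullet> x \<noteq> 0" using ab(3) by (auto simp: exposed_def)
    then obtain x where x: "\<And>l. l \<in> normals \<Longrightarrow> x l \<in> F \<and> l \<bullet> x l \<noteq> 0" by metis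
    define s where "s = (\<Sum>l\<in>normals. x l)"
    have nn: "0 \<le> l \<bullet> x l'" if "l \<in> normals" "l' \<in> normals" for l l'
      using normals_in_dual_cone[OF that(1)] x[OF that(2)] ab(3) by (metis IntE inner_commute)
    have pos: "0 < l \<bullet> s" if l: "l \<in> normals" for l
    proof -
      have "0 < l \<bullet> x l" using nn[OF l l] x[OF l] by simp
      also have "\<dots> \<le> (\<Sum>l'\<in>normals. l \<bullet> x l')"
        using nn[OF l] finite_normals l by (intro member_le_sum) auto
      finally show ?thesis by (simp add: s_def inner_sum_right)
    qed
    have "a \<bullet> s = 0" unfolding s_def inner_sum_right using x ab(3) b by (intro sum.neutral) auto
    moreover have "convex_cone {v. v = 0 \<or> 0 < v \<bullet> s}"
      by (auto simp: convex_cone_iff inner_add_left)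
    then have "convex_cone hull normals \<subseteq> {v. v = 0 \<or> 0 < v \<bullet> s}"
      using pos by (intro hull_minimal) auto
    ultimately show False using \<open>- a \<in> _\<close> ab(1) by auto
  qed
  then obtain l where l: "l \<in> normals" "F \<subseteq> exposed l" by blast
  have "F face_of exposed l"
    using F l(2) facet_of_imp_subset[OF exposed_facet[OF l(1)]]
    by (meson face_of_subset facet_of_imp_face_of)
  moreover have "convex (exposed l)"
    using exposed_facet[OF l(1)] facet_of_imp_face_of face_of_imp_convex
    convex_convex_cone_hull by (metis)
  moreover have "aff_dim F = aff_dim (exposed l)"
    using F exposed_facet[OF l(1)] by (simp add: facet_of_def)
  ultimately have "F = exposed l" using face_of_aff_dim_lt by (metis less_irrefl)
  then show ?thesis using l(1) by blast
qed

lemma facets_eq: "{F. F facet_of C62} = exposed ` normals"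
  using exposed_facet facet_is_exposed by blast

text \<open>Fourth powers are needed: up to scaling, the sum and the sum of squares of the coordinates
  agree for types 3 and 8, and for types 6 and 7.\<close>

lemma type_invariant_check:
  "list_all (\<lambda>t. list_all (\<lambda>t'. sum_list (map (\<lambda>x. x ^ 4) (ineqs ! t)) * sum_list (ineqs ! t') ^ 4
     = sum_list (map (\<lambda>x. x ^ 4) (ineqs ! t')) * sum_list (ineqs ! t) ^ 4 \<longrightarrow> t = t') [0..<8]) [0..<8]"
  by code_simp

text \<open>Equal faces have proportional normals. The sum of fourth powers divided by the fourth
  power of the sum is invariant under scaling and permutation and tells the eight types apart.
  Within one type the equal positive coordinate sums force the factor 1.\<close>

lemma exposed_normals_unique:
  assumes \<sigma>: "\<sigma> permutes {1..6}" "\<sigma>' permutes {1..6}" "t < 8" "t' < 8"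
    and eq: "exposed (S6_act \<sigma> (lvec (ineqs ! t))) = exposed (S6_act \<sigma>' (lvec (ineqs ! t')))"
  shows "t = t' \<and> S6_act \<sigma> (lvec (ineqs ! t)) = S6_act \<sigma>' (lvec (ineqs ! t'))"
proof -
  define a a' where "a = S6_act \<sigma> (lvec (ineqs ! t))" and "a' = S6_act \<sigma>' (lvec (ineqs ! t'))"
  have n: "a \<in> normals" "a' \<in> normals" using \<sigma> unfolding a_def a'_def normals_def by blast+
  have "a' \<bullet> x = 0" if "x \<in> exposed a" for x
  proof -
    have "x \<in> exposed a'" using that eq by (simp add: a_def a'_def)
    then show ?thesis by (simp add: exposed_def)
  qed
  then obtain \<alpha> where \<alpha>: "a' = \<alpha> *\<^sub>R a" using exposed_kernel[OF n(1)] by blast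
  define s where "s t = real_of_int (sum_list (ineqs ! t))" for t
  define p where "p t = real_of_int (sum_list (map (\<lambda>x. x ^ 4) (ineqs ! t)))" for t
  have val: "(\<Sum>n<15. real_of_int (ineqs ! t ! n)) = s t" "(\<Sum>n<15. real_of_int (ineqs ! t ! n) ^ 4) = p t" if "t < 8" for t
    using length_ineqs(1)[OF that] by (simp_all add: s_def p_def sum_list_sum_nth atLeast0LessThan)
  have sa: "(\<Sum>i\<in>UNIV. a $ i) = s t" "(\<Sum>i\<in>UNIV. (a $ i) ^ 4) = p t"
    unfolding a_def
    using sum_S6_act[OF \<sigma>(1), of "\<lambda>x. x"] sum_lvec[of "\<lambda>x. x"] sum_S6_act[OF \<sigma>(1), of "\<lambda>x. x ^ 4"] sum_lvec[of "\<lambda>x. x ^ 4"]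
      val[OF \<sigma>(3)] by simp_all
  have sa': "(\<Sum>i\<in>UNIV. a' $ i) = s t'" "(\<Sum>i\<in>UNIV. (a' $ i) ^ 4) = p t'"
    unfolding a'_def
    using sum_S6_act[OF \<sigma>(2), of "\<lambda>x. x"] sum_lvec[of "\<lambda>x. x"] sum_S6_act[OF \<sigma>(2), of "\<lambda>x. x ^ 4"] sum_lvec[of "\<lambda>x. x ^ 4"]
      val[OF \<sigma>(4)] by simp_all
  have s: "s t' = \<alpha> * s t" and p: "p t' = \<alpha> ^ 4 * p t"
    using sa sa' unfolding \<alpha> by (simp_all add: power_mult_distrib flip: sum_distrib_left)
  then have "p t * s t' ^ 4 = p t' * s t ^ 4" by (simp add: power_mult_distrib)
  then have "real_of_int (sum_list (map (\<lambda>x. x ^ 4) (ineqs ! t)) * sum_list (ineqs ! t') ^ 4)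
     = real_of_int (sum_list (map (\<lambda>x. x ^ 4) (ineqs ! t')) * sum_list (ineqs ! t) ^ 4)"
    unfolding of_int_mult of_int_power s_def p_def .
  then have "sum_list (map (\<lambda>x. x ^ 4) (ineqs ! t)) * sum_list (ineqs ! t') ^ 4
     = sum_list (map (\<lambda>x. x ^ 4) (ineqs ! t')) * sum_list (ineqs ! t) ^ 4"
    by (simp only: of_int_eq_iff)
  moreover have "t \<in> set [0..<8]" "t' \<in> set [0..<8]" using \<sigma> by auto
  ultimately have tt: "t = t'" using type_invariant_check unfolding list_all_iff by blast
  have "0 < s t" using normal_sum_pos[OF n(1)] sa(1) by (simp add: inner_ones)
  moreover have "s t = \<alpha> * s t" using s unfolding tt[symmetric] .
  ultimately have "\<alpha> = 1" by (metis less_irrefl mult_cancel_right1)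
  then have "a = a'" using \<alpha> by simp
  then show ?thesis using tt unfolding a_def a'_def by blast
qed

section \<open>Orbits\<close>

text \<open>The permutations are sorted by the image b of a; composing with the transposition of a
  and b identifies each class with the permutations of S.\<close>

lemma card_permutes_insert:
  assumes S: "finite S" "a \<notin> S"
  shows "card {\<sigma>. \<sigma> permutes insert a S \<and> P \<sigma>}
     = (\<Sum>b\<in>insert a S. card {p. p permutes S \<and> P (Transposition.transpose a b \<circ> p)})"
proof -
  define A where "A b = (\<lambda>p. Transposition.transpose a b \<circ> p) ` {p. p permutes S \<and> P (Transposition.transpose a b \<circ> p)}" for b
  have "{\<sigma>. \<sigma> permutes insert a S \<and> P \<sigma>} = (\<Union>b\<in>insert a S. A b)"
  proof (intro set_eqI iffI)
    fix \<sigma> assume "\<sigma> \<in> {\<sigma>. \<sigma> permutes insert a S \<and> P \<sigma>}"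
    then have s: "\<sigma> \<in> {p. p permutes insert a S}" "P \<sigma>" by simp_all
    from s(1)[unfolded permutes_insert] obtain b p
      where "b \<in> insert a S" "p permutes S" "\<sigma> = Transposition.transpose a b \<circ> p"
        by (elim imageE) auto
    then show "\<sigma> \<in> (\<Union>b\<in>insert a S. A b)" using s(2) unfolding A_def by blast
  next
    fix \<sigma> assume "\<sigma> \<in> (\<Union>b\<in>insert a S. A b)"
    then obtain b p where b: "b \<in> insert a S" "p permutes S" "\<sigma> = Transposition.transpose a b \<circ> p" "P \<sigma>"
      unfolding A_def by blast
    then have "\<sigma> \<in> {p. p permutes insert a S}"
      unfolding permutes_insert by (intro image_eqI[of _ _ "(b, p)"]) auto
    then show "\<sigma> \<in> {\<sigma>. \<sigma> permutes insert a S \<and> P \<sigma>}" using b(4) by simp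
  qed
  moreover have "card (\<Union>b\<in>insert a S. A b) = (\<Sum>b\<in>insert a S. card (A b))"
  proof (rule card_UN_disjoint)
    show "finite (insert a S)" using S by simp
    show "\<forall>b\<in>insert a S. finite (A b)" unfolding A_def using finite_permutations[OF S(1)] by auto
    have img: "\<sigma> a = b" if \<sigma>: "\<sigma> \<in> A b" for \<sigma> b
    proof -
      obtain p where p: "p permutes S" "\<sigma> = Transposition.transpose a b \<circ> p"
        using \<sigma> unfolding A_def by blast
      have "p a = a" by (rule permutes_not_in[OF p(1) S(2)])
      then show ?thesis using p(2) by simp
    qed
    show "\<forall>b\<in>insert a S. \<forall>c\<in>insert a S. b \<noteq> c \<longrightarrow> A b \<inter> A c = {}"
    proof (intro ballI impI equals0I)
      fix b c \<sigma> assume "b \<noteq> c" "\<sigma> \<in> A b \<inter> A c"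
      then show False using img[of \<sigma> b] img[of \<sigma> c] by simp
    qed
  qed
  moreover have "card (A b) = card {p. p permutes S \<and> P (Transposition.transpose a b \<circ> p)}" for b
    unfolding A_def
    by (rule card_image) (metis (no_types, lifting) bij_id bij_transpose fun.inj_map inj_onI bij_is_inj injD)
  ultimately show ?thesis by simp
qed

text \<open>By coset decomposition along the chain of the symmetric groups on \<open>{1..k}\<close>, \<open>count_to\<close> counts
  the permutations that map one coefficient list to another.\<close>

fun count_to :: "duad list list \<Rightarrow> int list \<Rightarrow> int list \<Rightarrow> nat"
  and count_via :: "duad list \<Rightarrow> duad list list \<Rightarrow> int list \<Rightarrow> int list \<Rightarrow> nat" where
  "count_to [] x y = (if x = y then 1 else 0)"
| "count_to (l # ls) x y = count_to ls x y + count_via l ls x y"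
| "count_via [] ls x y = 0"
| "count_via (d # l) ls x y = count_to ls (apply_duad d x) y + count_via l ls x y"

definition levels :: "duad list list" where
  "levels = [[D16,D26,D36,D46,D56], [D15,D25,D35,D45], [D14,D24,D34], [D13,D23], [D12]]"

definition counts :: "duad list list \<Rightarrow> nat \<Rightarrow> bool" where
  "counts ls k \<longleftrightarrow> (\<forall>x y. length x = 15 \<longrightarrow> length y = 15 \<longrightarrow>
     count_to ls x y = card {\<sigma>. \<sigma> permutes {1..k} \<and> S6_act \<sigma> (lvec x) = lvec y})"

lemma count_via_sum: "count_via l ls x y = (\<Sum>d\<leftarrow>l. count_to ls (apply_duad d x) y)"
  by (induction l) auto

lemma counts_Nil: "counts [] 1"
  unfolding counts_def
proof (intro allI impI)
  fix x y :: "int list" assume len: "length x = 15" "length y = 15"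
  have "{\<sigma>. \<sigma> permutes {1..1::nat} \<and> S6_act \<sigma> (lvec x) = lvec y} = (if x = y then {id} else {})"
    using lvec_inject[OF len] by (auto simp: S6_act_id)
  then show "count_to [] x y = card {\<sigma>. \<sigma> permutes {1..1::nat} \<and> S6_act \<sigma> (lvec x) = lvec y}"
    by simp
qed

text \<open>The transpositions in l, together with the identity, represent the cosets of the
  permutations of \<open>{1..k}\<close> in those of \<open>{1..Suc k}\<close>.\<close>

lemma counts_Cons:
  assumes ls: "counts ls k" and k: "1 \<le> k" "k < 6" and l: "map duad_pair l = map (\<lambda>j. (j, Suc k)) [1..<Suc k]"
  shows "counts (l # ls) (Suc k)"
  unfolding counts_def
proof (intro allI impI)
  fix x y :: "int list" assume len: "length x = 15" "length y = 15"
  define T where "T b = Transposition.transpose (Suc k) b" for b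
  define N where "N b = card {p. p permutes {1..k} \<and> S6_act p (S6_act (T b) (lvec x)) = lvec y}" for b
  have ins: "{1..Suc k} = insert (Suc k) {1..k}" by auto
  have p6: "p permutes {1..6}" if "p permutes {1..k}" for p
    using that k by (rule_tac permutes_subset) auto
  have T6: "T b permutes {1..6}" if "b \<in> {1..Suc k}" for b
    unfolding T_def using that k by (intro permutes_swap_id) auto
  have "card {\<sigma>. \<sigma> permutes {1..Suc k} \<and> S6_act \<sigma> (lvec x) = lvec y}
      = (\<Sum>b\<in>insert (Suc k) {1..k}. card {p. p permutes {1..k} \<and> S6_act (T b \<circ> p) (lvec x) = lvec y})"
    unfolding ins T_def by (rule card_permutes_insert) auto
  also have "\<dots> = (\<Sum>b\<in>insert (Suc k) {1..k}. N b)"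
  proof (rule sum.cong[OF refl])
    fix b assume "b \<in> insert (Suc k) {1..k}"
    then have b: "b \<in> {1..Suc k}" unfolding ins .
    have "S6_act (T b \<circ> p) (lvec x) = S6_act p (S6_act (T b) (lvec x))" if "p permutes {1..k}" for p
      using S6_act_comp[OF p6[OF that] T6[OF b]] by simp
    then show "card {p. p permutes {1..k} \<and> S6_act (T b \<circ> p) (lvec x) = lvec y} = N b"
      unfolding N_def by (metis (no_types, lifting))
  qed
  also have "\<dots> = N (Suc k) + (\<Sum>b\<in>{1..k}. N b)" by simp
  \<comment> \<open>The image \<open>b = Suc k\<close> belongs to the identity coset, the summand
    that \<open>count_to\<close> adds outside \<open>count_via\<close>.\<close>
  also have "N (Suc k) = count_to ls x y"
    using ls len by (simp add: N_def T_def counts_def transpose_same S6_act_id)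
  also have "(\<Sum>b\<in>{1..k}. N b) = count_via l ls x y"
  proof -
    have "count_to ls (apply_duad d x) y = N (fst (duad_pair d))" if d: "d \<in> set l" for d
    proof -
      have "duad_pair d \<in> set (map duad_pair l)" using d by simp
      then obtain j where j: "duad_pair d = (j, Suc k)" unfolding l by auto
      have "S6_act (T j) (lvec x) = lvec (apply_duad d x)"
        using lvec_apply_duad[OF len(1) j] by (simp add: T_def transpose_commute)
      then show ?thesis using ls len length_apply_duad[OF len(1)] by (simp add: N_def counts_def j)
    qed
    then have "count_via l ls x y = (\<Sum>d\<leftarrow>l. N (fst (duad_pair d)))"
      unfolding count_via_sum by (intro arg_cong[where f = sum_list] map_cong) auto
    also have "\<dots> = sum_list (map (N \<circ> fst) (map duad_pair l))" by (simp add: comp_def)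
    also have "\<dots> = (\<Sum>j\<leftarrow>[1..<Suc k]. N j)" unfolding l by (simp add: comp_def)
    also have "\<dots> = (\<Sum>b\<in>{1..k}. N b)"
      by (simp add: interv_sum_list_conv_sum_set_nat atLeastLessThanSuc_atLeastAtMost del: upt_Suc)
    finally show ?thesis by simp
  qed
  finally show "count_to (l # ls) x y = card {\<sigma>. \<sigma> permutes {1..Suc k} \<and> S6_act \<sigma> (lvec x) = lvec y}"
    by simp
qed

lemma counts_levels: "counts levels 6"
proof -
  have 2: "counts [[D12]] 2"
    using counts_Cons[OF counts_Nil, of "[D12]"] by (simp add: numeral_2_eq_2)
  have 3: "counts [[D13,D23],[D12]] 3"
    using counts_Cons[OF 2, of "[D13,D23]"] by (simp add: upt_rec numeral_3_eq_3 numeral_2_eq_2)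
  have 4: "counts [[D14,D24,D34],[D13,D23],[D12]] 4"
    using counts_Cons[OF 3, of "[D14,D24,D34]"] by (simp add: upt_rec)
  have 5: "counts [[D15,D25,D35,D45],[D14,D24,D34],[D13,D23],[D12]] 5"
    using counts_Cons[OF 4, of "[D15,D25,D35,D45]"] by (simp add: upt_rec)
  show ?thesis unfolding levels_def
    using counts_Cons[OF 5, of "[D16,D26,D36,D46,D56]"] by (simp add: upt_rec)
qed

lemma stabilizer_orders:
  "map (\<lambda>r. count_to levels r r) ineqs = [2, 4, 6, 6, 8, 16, 24, 24]"
  by code_simp

text \<open>As the action is from the right, the permutations with the same value as \<tau> are
  those of the form \<open>\<rho> \<circ> \<tau>\<close> with \<rho> in the stabilizer. All fibres
  thus have the same size.\<close>

lemma orbit_stabilizer: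
  "card ((\<lambda>\<sigma>. S6_act \<sigma> x) ` {\<sigma>. \<sigma> permutes {1..6}}) * card {\<sigma>. \<sigma> permutes {1..6} \<and> S6_act \<sigma> x = x} = 720"
proof -
  define G where "G = {\<sigma>. \<sigma> permutes {1..6::nat}}"
  define f where "f \<sigma> = S6_act \<sigma> x" for \<sigma>
  have finG: "finite G" unfolding G_def by (rule finite_permutations) simp
  have "card {1..6::nat} = 6" by simp
  then have cardG: "card G = 720"
    unfolding G_def using card_permutations[of "{1..6::nat}" 6] by (simp add: fact_numeral)
  have fib: "card {\<sigma> \<in> G. f \<sigma> = f \<tau>} = card {\<sigma> \<in> G. f \<sigma> = x}" if \<tau>: "\<tau> \<in> G" for \<tau>
  proof -
    have t: "\<tau> permutes {1..6}" using \<tau> by (simp add: G_def)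
    have "{\<sigma> \<in> G. f \<sigma> = f \<tau>} = (\<lambda>\<rho>. \<rho> \<circ> \<tau>) ` {\<sigma> \<in> G. f \<sigma> = x}"
    proof (intro set_eqI iffI)
      fix \<sigma> assume "\<sigma> \<in> {\<sigma> \<in> G. f \<sigma> = f \<tau>}"
      then have s: "\<sigma> permutes {1..6}" "S6_act \<sigma> x = S6_act \<tau> x" by (auto simp: G_def f_def)
      have "S6_act (\<sigma> \<circ> inv \<tau>) x = S6_act (inv \<tau>) (S6_act \<tau> x)"
        using S6_act_comp[OF permutes_inv[OF t] s(1), of x] s(2) by simp
      then have "S6_act (\<sigma> \<circ> inv \<tau>) x = x" by (simp add: S6_act_inv[OF t])
      moreover have "\<sigma> \<circ> inv \<tau> permutes {1..6}" using permutes_compose[OF permutes_inv[OF t] s(1)] .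
      moreover have "\<sigma> = (\<sigma> \<circ> inv \<tau>) \<circ> \<tau>" by (simp add: comp_assoc permutes_inv_o(2)[OF t])
      ultimately show "\<sigma> \<in> (\<lambda>\<rho>. \<rho> \<circ> \<tau>) ` {\<sigma> \<in> G. f \<sigma> = x}" by (auto simp: G_def f_def)
    next
      fix \<sigma> assume "\<sigma> \<in> (\<lambda>\<rho>. \<rho> \<circ> \<tau>) ` {\<sigma> \<in> G. f \<sigma> = x}"
      then obtain \<rho> where r: "\<sigma> = \<rho> \<circ> \<tau>" "\<rho> permutes {1..6}" "S6_act \<rho> x = x"
        by (auto simp: G_def f_def)
      then show "\<sigma> \<in> {\<sigma> \<in> G. f \<sigma> = f \<tau>}"
        using S6_act_comp[OF t r(2), of x] permutes_compose[OF t r(2)] by (simp add: G_def f_def)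
    qed
    moreover have "inj_on (\<lambda>\<rho>. \<rho> \<circ> \<tau>) {\<sigma> \<in> G. f \<sigma> = x}"
    proof (rule inj_onI)
      fix a b :: "nat \<Rightarrow> nat" assume "a \<circ> \<tau> = b \<circ> \<tau>"
      then have "(a \<circ> \<tau>) \<circ> inv \<tau> = (b \<circ> \<tau>) \<circ> inv \<tau>" by simp
      then show "a = b" by (simp add: comp_assoc permutes_inv_o(1)[OF t])
    qed
    ultimately show ?thesis by (simp add: card_image)
  qed
  have "card G = card (\<Union>y\<in>f ` G. {\<sigma> \<in> G. f \<sigma> = y})" by (intro arg_cong[where f = card]) auto
  also have "\<dots> = (\<Sum>y\<in>f ` G. card {\<sigma> \<in> G. f \<sigma> = y})" using finG by (intro card_UN_disjoint) auto
  also have "\<dots> = (\<Sum>y\<in>f ` G. card {\<sigma> \<in> G. f \<sigma> = x})" using fib by (intro sum.cong) auto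
  also have "\<dots> = card (f ` G) * card {\<sigma> \<in> G. f \<sigma> = x}" by simp
  finally show ?thesis using cardG by (simp add: G_def f_def[abs_def])
qed

definition orbit :: "nat \<Rightarrow> (real^15) set" where
  "orbit t = (\<lambda>\<sigma>. S6_act \<sigma> (lvec (ineqs ! t))) ` {\<sigma>. \<sigma> permutes {1..6}}"

text \<open>These are the quotients of 720 by the stabilizer orders, and their sum is 975.\<close>

lemma card_orbits: "map (\<lambda>t. card (orbit t)) [0..<8] = [360, 180, 120, 120, 90, 45, 30, 30]"
proof -
  have card: "card (orbit t) * ([2, 4, 6, 6, 8, 16, 24, 24] ! t) = 720" if t: "t < 8" for t
  proof -
    note len = length_ineqs(1)[OF t]
    have "count_to levels (ineqs ! t) (ineqs ! t) = map (\<lambda>r. count_to levels r r) ineqs ! t"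
      using t length_ineqs(2) by simp
    then have "card {\<sigma>. \<sigma> permutes {1..6} \<and> S6_act \<sigma> (lvec (ineqs ! t)) = lvec (ineqs ! t)} = [2, 4, 6, 6, 8, 16, 24, 24] ! t"
      using counts_levels len unfolding stabilizer_orders counts_def by simp
    then show ?thesis using orbit_stabilizer[of "lvec (ineqs ! t)"] by (simp add: orbit_def)
  qed
  have "[0..<8] = [0, 1, 2, 3, 4, 5, 6, 7::nat]" by code_simp
  then show ?thesis
    using card[of 0] card[of 1] card[of 2] card[of 3] card[of 4] card[of 5] card[of 6] card[of 7]
    by simp
qed

lemma exposed_inj: "inj_on exposed normals"
proof (rule inj_onI)
  fix a b assume "a \<in> normals" "b \<in> normals" "exposed a = exposed b"
  then show "a = b" using exposed_normals_unique by (elim normalE) blast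
qed

lemma card_normals: "card normals = 975"
proof -
  have un: "normals = (\<Union>t<8. orbit t)" by (auto simp: normals_def orbit_def)
  have dis: "orbit t \<inter> orbit t' = {}" if "t < 8" "t' < 8" "t \<noteq> t'" for t t'
  proof (rule ccontr)
    assume "orbit t \<inter> orbit t' \<noteq> {}"
    then obtain \<sigma> \<sigma>' where "\<sigma> permutes {1..6}" "\<sigma>' permutes {1..6}"
      "S6_act \<sigma> (lvec (ineqs ! t)) = S6_act \<sigma>' (lvec (ineqs ! t'))" unfolding orbit_def by auto
    then show False using exposed_normals_unique[of \<sigma> \<sigma>' t t'] that by simp
  qed
  have fin: "finite (orbit t)" for t
    unfolding orbit_def by (intro finite_imageI finite_permutations) simp
  have "card normals = (\<Sum>t<8. card (orbit t))"
    unfolding un by (rule card_UN_disjoint) (use dis fin in auto)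
  also have "\<dots> = sum_list (map (\<lambda>t. card (orbit t)) [0..<8])"
    by (simp only: interv_sum_list_conv_sum_set_nat set_upt atLeast0LessThan)
  also have "\<dots> = 975" unfolding card_orbits by simp
  finally show ?thesis .
qed

text \<open>Types are numbered from 1 in \<open>ineq_vec\<close>, whereas positions in the list
  \<open>ineqs\<close> start at 0.\<close>

lemma ineq_vec_eq: "t < 8 \<Longrightarrow> ineq_vec (Suc t) = lvec (ineqs ! t)"
proof -
  assume t: "t < 8"
  have "ineq_coeffs (Suc t) = map real_of_int (ineqs ! t)"
    using t by (auto simp: ineq_coeffs_def ineqs_def less_Suc_eq numeral_eq_Suc)
  then show ?thesis
    using idx_minus_1_less length_ineqs(1)[OF t]
    by (simp add: ineq_vec_def lvec_def vecf_def vec_eq_iff)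
qed

lemma facet_rep_eq: "t < 8 \<Longrightarrow> facet_rep (Suc t) = exposed (lvec (ineqs ! t))"
  by (simp add: facet_rep_def exposed_def ineq_vec_eq)

lemma facet_orbit_exposed: "facet_orbit (exposed a) = {exposed (S6_act \<sigma> a) | \<sigma>. \<sigma> permutes {1..6}}"
  unfolding facet_orbit_def using S6_act_exposed by (auto; metis)

lemma facet_orbit_member_unique:
  assumes "t < 8" "t' < 8" "F \<in> facet_orbit (facet_rep (Suc t))" "F \<in> facet_orbit (facet_rep (Suc t'))"
  shows "t = t'"
proof -
  obtain \<sigma> \<sigma>' where "F = exposed (S6_act \<sigma> (lvec (ineqs ! t)))" "\<sigma> permutes {1..6}"
    "F = exposed (S6_act \<sigma>' (lvec (ineqs ! t')))" "\<sigma>' permutes {1..6}"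
    using assms(3,4)
    unfolding facet_rep_eq[OF assms(1)] facet_rep_eq[OF assms(2)] facet_orbit_exposed by blast
  then show ?thesis using exposed_normals_unique[of \<sigma> \<sigma>' t t'] assms(1,2) by simp
qed

lemma facet_in_orbit:
  assumes "F facet_of C62"
  shows "\<exists>t<8. F \<in> facet_orbit (facet_rep (Suc t)) \<and> facet_orbit F = facet_orbit (facet_rep (Suc t))"
proof -
  obtain a where "a \<in> normals" "F = exposed a" using facet_is_exposed[OF assms] by blast
  then obtain \<sigma> t where F: "F = exposed (S6_act \<sigma> (lvec (ineqs ! t)))" "\<sigma> permutes {1..6}" "t < 8"
    by (elim normalE) auto
  define r where "r = lvec (ineqs ! t)"
  have "{exposed (S6_act \<tau> (S6_act \<sigma> r)) | \<tau>. \<tau> permutes {1..6}} = {exposed (S6_act \<tau> r) | \<tau>. \<tau> permutes {1..6}}"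
  proof (intro set_eqI iffI)
    fix X assume "X \<in> {exposed (S6_act \<tau> (S6_act \<sigma> r)) | \<tau>. \<tau> permutes {1..6}}"
    then obtain \<tau> where X: "X = exposed (S6_act \<tau> (S6_act \<sigma> r))" "\<tau> permutes {1..6}" by blast
    then have "X = exposed (S6_act (\<sigma> \<circ> \<tau>) r)" "\<sigma> \<circ> \<tau> permutes {1..6}"
      using S6_act_comp[OF X(2) F(2)] permutes_compose[OF X(2) F(2)] by auto
    then show "X \<in> {exposed (S6_act \<tau> r) | \<tau>. \<tau> permutes {1..6}}" by blast
  next
    fix X assume "X \<in> {exposed (S6_act \<tau> r) | \<tau>. \<tau> permutes {1..6}}"
    then obtain \<tau> where X: "X = exposed (S6_act \<tau> r)" "\<tau> permutes {1..6}" by blast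
    have p: "inv \<sigma> \<circ> \<tau> permutes {1..6}" using permutes_compose[OF X(2) permutes_inv[OF F(2)]] .
    have "S6_act (inv \<sigma> \<circ> \<tau>) (S6_act \<sigma> r) = S6_act \<tau> (S6_act (inv \<sigma>) (S6_act \<sigma> r))"
      using S6_act_comp[OF X(2) permutes_inv[OF F(2)]] by simp
    then have "X = exposed (S6_act (inv \<sigma> \<circ> \<tau>) (S6_act \<sigma> r))"
      using X(1) by (simp add: S6_act_inv[OF F(2)])
    then show "X \<in> {exposed (S6_act \<tau> (S6_act \<sigma> r)) | \<tau>. \<tau> permutes {1..6}}" using p by blast
  qed
  then have "facet_orbit F = facet_orbit (facet_rep (Suc t))"
    unfolding F(1) facet_rep_eq[OF F(3)] facet_orbit_exposed r_def .
  moreover have "F \<in> facet_orbit (facet_rep (Suc t))"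
    unfolding F(1) facet_rep_eq[OF F(3)] facet_orbit_exposed using F(2) by blast
  ultimately show ?thesis using F(3) by blast
qed

lemma facet_rep_facet: "t < 8 \<Longrightarrow> facet_rep (Suc t) facet_of C62"
  unfolding facet_rep_eq using exposed_facet lvec_ineqs_normal by simp

lemma facet_rep_in_orbit: "t < 8 \<Longrightarrow> facet_rep (Suc t) \<in> facet_orbit (facet_rep (Suc t))"
  unfolding facet_rep_eq facet_orbit_exposed
  by (intro CollectI exI[of _ id]) (simp add: S6_act_id permutes_id)

lemma card_facet_orbits: "card (facet_orbit ` {F. F facet_of C62}) = 8"
proof -
  have "facet_orbit ` {F. F facet_of C62} = (\<lambda>t. facet_orbit (facet_rep (Suc t))) ` {..<8}"
    using facet_in_orbit facet_rep_facet by (auto simp: image_iff) blast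
  moreover have "inj_on (\<lambda>t. facet_orbit (facet_rep (Suc t))) {..<8}"
    using facet_orbit_member_unique facet_rep_in_orbit by (intro inj_onI) (metis lessThan_iff)
  ultimately show ?thesis by (simp add: card_image)
qed

theorem theorem7p1:
  shows "C62 = convex_cone hull (\<Union> (rays33 \<union> rays222))
    \<and> card rays33 = 10 \<and> card rays222 = 15
    \<and> card {F. F facet_of C62} = 975
    \<and> card (facet_orbit ` {F. F facet_of C62}) = 8
    \<and> (\<forall>t\<in>{1..8}. (\<forall>x\<in>C62. ineq_vec t \<bullet> x \<ge> 0) \<and> facet_rep t facet_of C62)
    \<and> (\<forall>F. F facet_of C62 \<longrightarrow> (\<exists>!t. t \<in> {1..8} \<and> F \<in> facet_orbit (facet_rep t)))"
proof (intro conjI ballI allI impI)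
  show "C62 = convex_cone hull (\<Union> (rays33 \<union> rays222))" using C62_eq hull_rays by simp
  show "card rays33 = 10" "card rays222 = 15" by (fact card_rays)+
  show "card {F. F facet_of C62} = 975"
    unfolding facets_eq by (simp add: card_image[OF exposed_inj] card_normals)
  show "card (facet_orbit ` {F. F facet_of C62}) = 8" by (rule card_facet_orbits)
next
  fix t :: nat assume "t \<in> {1..8}"
  then obtain s where s: "t = Suc s" "s < 8" by (cases t) auto
  show "facet_rep t facet_of C62" unfolding s(1) by (rule facet_rep_facet[OF s(2)])
  show "ineq_vec t \<bullet> x \<ge> 0" if "x \<in> C62" for x
    unfolding s(1) ineq_vec_eq[OF s(2)]
    using normals_in_dual_cone[OF lvec_ineqs_normal[OF s(2)]] that by (metis inner_commute)
next
  fix F assume "F facet_of C62"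
  then obtain s where s: "s < 8" "F \<in> facet_orbit (facet_rep (Suc s))" using facet_in_orbit by blast
  show "\<exists>!t. t \<in> {1..8} \<and> F \<in> facet_orbit (facet_rep t)"
  proof (rule ex1I[of _ "Suc s"])
    show "Suc s \<in> {1..8} \<and> F \<in> facet_orbit (facet_rep (Suc s))" using s by simp
    fix t assume t: "t \<in> {1..8} \<and> F \<in> facet_orbit (facet_rep t)"
    then obtain s' where "t = Suc s'" "s' < 8" by (cases t) auto
    then show "t = Suc s" using facet_orbit_member_unique[of s' s F] s t by simp
  qed
qed

end
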